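(* Let $\mathbf{a}=(a_1,\dots,a_p)\in\mathbb{C}^{p}$ with $\Re a_k>0$ for all $k=1,\dots,p$, and assume without loss of generality that $\Re a_p=\min_{1\le k\le p}\Re a_k$. Let $\mathbf{b}=(b_1,\dots,b_p)\in\mathbb{C}^{p}$ with $-b_j\notin\mathbb{N}\cup\{0\}$ for all $j$, and let $z\in\mathbb{C}$. Write $\mathbf{a}_{[p]}=(a_1,\dots,a_{p-1})$, $\psi(\mathbf{a};\mathbf{b})=\sum_{j=1}^pb_j-\sum_{j=1}^pa_j$ and $\psi(\mathbf{a}_{[p]};\mathbf{b})=\sum_{j=1}^pb_j-\sum_{j=1}^{p-1}a_j$. Denote by $-\alpha$ the real part of the rightmost pole(s) of the function $s\mapsto\Gamma(\mathbf{a}_{[p]}+s)/\Gamma(\mathbf{b}+s)$, and by $r\in\mathbb{N}$ the maximal multiplicity among all its poles with real part $-\alpha$. If $\Re\psi(\mathbf{a};\mathbf{b})>0$, then for any $N\in\mathbb{N}$ $$ {}_{p}F_p(\mathbf{a};\mathbf{b};-z)= \frac{\Gamma(\mathbf{b})}{\Gamma(\mathbf{a}_{[p]})}\sum_{n=0}^{N-1}\frac{g_n(\mathbf{a}_{[p]};\mathbf{b})}{\Gamma(\psi(\mathbf{a}_{[p]};\mathbf{b})+n)}\,M\big(a_p,\psi(\mathbf{a}_{[p]};\mathbf{b})+n,-z\big)+R_N(z), $$ where the remainder is bounded in the form $$ |R_N(z)|\le K\,H(z)\,\frac{\log^{r-1}N}{N^{\alpha}}, $$ with $K>0$ independent of $N$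 and $z$ and $H(z):=\max(1,e^{-\Re z})$. Therefore, the expansion is uniformly convergent for $z$ in any half-plane $\Re z\ge\Lambda$ with arbitrary $\Lambda\in\mathbb{R}$.
   Context: Notation for vectors: for a vector $\mathbf{c}=(c_1,c_2,\dots)$, $\Gamma(\mathbf{c})=\prod_k\Gamma(c_k)$, $\mathbf{c}+s=(c_1+s,c_2+s,\dots)$, $\Gamma(\mathbf{c}+s)=\prod_k\Gamma(c_k+s)$ (empty products equal $1$). $(x)_n=\Gamma(x+n)/\Gamma(x)=x(x+1)\cdots(x+n-1)$ is the Pochhammer symbol, $(x)_0=1$. The generalized hypergeometric function is ${}_{q}F_p(\mathbf{a};\mathbf{b};z)=\sum_{k=0}^\infty\frac{(a_1)_k\cdots(a_q)_k}{(b_1)_k\cdots(b_p)_k}\frac{z^k}{k!}$, an entire function of $z$ for $q\le p$. $M(a,b,z)={}_1F_1(a;b;z)$ is the Kummer (confluent hypergeometric) function of the first kind. Nørlund's coefficients $g_n(\mathbf{c};\mathbf{b})$, for $\mathbf{c}=(c_1,\dots,c_{p-1})\in\mathbb{C}^{p-1}$, $\mathbf{b}\in\mathbb{C}^p$, $n\ge0$: for $p=1$, $g_0=1$ and $g_n=0$ for $n\ge1$; for $p\ge2$, $$g_n(\mathbf{c};\mathbf{b})=\sum_{0\le j_1\le j_2\le\cdots\le j_{p-2}\le n}\ \prod_{m=1}^{p-1}\frac{(\psi_m+j_{m-1})_{j_m-j_{m-1}}}{(j_m-j_{m-1})!}(b_{m+1}-c_m)_{j_m-j_{m-1}},$$ where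 $\psi_m=\sum_{i=1}^m(b_i-c_i)$, $j_0=0$, $j_{p-1}=n$. (For $p=2$ this is $g_n=(b_1-c_1)_n(b_2-c_1)_n/n!$.) $\log^{r-1}N$ means $(\log N)^{r-1}$, equal to $1$ when $r=1$.
   Formalization: For N=1 and r≥2 the printed bound is 0 and fails (e.g. a=(1,1,1), b=(2,2,2)), so it is claimed only for N≥2, or N=1 with r=1; it is claimed only if the Gamma quotient has a pole, as otherwise α and r are undefined; uniform convergence is claimed in all cases. *)

theory Defs
  imports "HOL-Complex_Analysis.Complex_Analysis"
begin

text \<open>
  A vector \<open>(c\<^sub>1, \<dots>, c\<^sub>m)\<close> is a function \<^typ>\<open>nat \<Rightarrow> complex\<close> of which only the values at
  \<open>1, \<dots>, m\<close> are used; the length is passed separately. In particular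
  \<open>(a\<^sub>1, \<dots>, a\<^sub>p\<^sub>-\<^sub>1)\<close> is \<open>a\<close> used with length \<open>p - 1\<close>.
\<close>

definition Gamma_vec :: "nat \<Rightarrow> (nat \<Rightarrow> complex) \<Rightarrow> complex \<Rightarrow> complex" where
  "Gamma_vec m c s = (\<Prod>k=1..m. Gamma (c k + s))"

definition hypergeom ::
  "nat \<Rightarrow> nat \<Rightarrow> (nat \<Rightarrow> complex) \<Rightarrow> (nat \<Rightarrow> complex) \<Rightarrow> complex \<Rightarrow> complex" where
  "hypergeom q p a b z =
     (\<Sum>k. (\<Prod>i=1..q. pochhammer (a i) k) / (\<Prod>j=1..p. pochhammer (b j) k) * (z ^ k / fact k))"

definition Kummer_M :: "complex \<Rightarrow> complex \<Rightarrow> complex \<Rightarrow> complex" where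
  "Kummer_M a b z = hypergeom 1 1 (\<lambda>_. a) (\<lambda>_. b) z"

definition psi :: "nat \<Rightarrow> nat \<Rightarrow> (nat \<Rightarrow> complex) \<Rightarrow> (nat \<Rightarrow> complex) \<Rightarrow> complex" where
  "psi q p a b = (\<Sum>j=1..p. b j) - (\<Sum>j=1..q. a j)"

text \<open>Index tuples \<open>0 = j\<^sub>0 \<le> j\<^sub>1 \<le> \<dots> \<le> j\<^sub>p\<^sub>-\<^sub>2 \<le> j\<^sub>p\<^sub>-\<^sub>1 = n\<close>, including the two fixed end points.\<close>

definition norlund_indices :: "nat \<Rightarrow> nat \<Rightarrow> (nat \<Rightarrow> nat) set" where
  "norlund_indices p n =
     {j \<in> {0..p-1} \<rightarrow>\<^sub>E {0..n}. j 0 = 0 \<and> j (p - 1) = n \<and> (\<forall>m\<in>{1..p-1}. j (m - 1) \<le> j m)}"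

definition norlund_g ::
  "nat \<Rightarrow> (nat \<Rightarrow> complex) \<Rightarrow> (nat \<Rightarrow> complex) \<Rightarrow> nat \<Rightarrow> complex" where
  "norlund_g p c b n =
     (if p = 1 then (if n = 0 then 1 else 0)
      else (\<Sum>j\<in>norlund_indices p n. \<Prod>m=1..p-1.
              pochhammer ((\<Sum>i=1..m. b i - c i) + of_nat (j (m - 1))) (j m - j (m - 1))
                / fact (j m - j (m - 1))
              * pochhammer (b (m + 1) - c m) (j m - j (m - 1))))"

definition expansion_sum ::
  "nat \<Rightarrow> (nat \<Rightarrow> complex) \<Rightarrow> (nat \<Rightarrow> complex) \<Rightarrow> nat \<Rightarrow> complex \<Rightarrow> complex" where
  "expansion_sum p a b N z =
     Gamma_vec p b 0 / Gamma_vec (p - 1) a 0 *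
       (\<Sum>n<N. norlund_g p a b n / Gamma (psi (p - 1) p a b + of_nat n)
               * Kummer_M (a p) (psi (p - 1) p a b + of_nat n) (- z))"

text \<open>
  \<^const>\<open>is_pole\<close> and \<^const>\<open>zorder\<close> only depend on the values in punctured neighbourhoods, so the
  conventions \<open>Gamma (-n) = 0\<close> and \<open>x / 0 = 0\<close> do not affect this notion when \<open>f\<close> is a quotient of
  products of Gamma functions. The multiplicity of a pole \<open>s\<close> is \<open>- zorder f s\<close>.
\<close>

definition rightmost_poles :: "(complex \<Rightarrow> complex) \<Rightarrow> real \<Rightarrow> nat \<Rightarrow> bool" where
  "rightmost_poles f \<alpha> r \<longleftrightarrow>
     (\<forall>s. is_pole f s \<longrightarrow> Re s \<le> - \<alpha>) \<and>
     (\<exists>s. is_pole f s \<and> Re s = - \<alpha> \<and> - zorder f s = int r) \<and>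
     (\<forall>s. is_pole f s \<and> Re s = - \<alpha> \<longrightarrow> - zorder f s \<le> int r)"

end

theory Submission imports Defs "HOL-Real_Asymp.Real_Asymp" begin

text \<open>
  Put \<open>f(s) = \<Gamma>(a\<^sub>[\<^sub>p\<^sub>] + s) / \<Gamma>(b + s)\<close> and \<open>\<psi> = \<psi>(a\<^sub>[\<^sub>p\<^sub>]; b)\<close>. Norlund's coefficients are those of the
  inverse factorial series \<open>f(s) = \<Sum>\<^sub>n g\<^sub>n / \<Gamma>(\<psi> + s + n)\<close>: attaching one more factor
  \<open>\<Gamma>(c + s) / \<Gamma>(b + s)\<close> to such a series is Gauss' summation of \<open>\<^sub>2F\<^sub>1\<close> at \<open>1\<close>. Taking \<open>s = k\<close>, multiplying
  by \<open>(a\<^sub>p)\<^sub>k (-z)\<^sup>k / k!\<close> and summing over \<open>k\<close> gives the expansion. Euler's integral bounds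
  \<open>M(a\<^sub>p, \<psi> + n, -z) / \<Gamma>(\<psi> + n)\<close> by a multiple of \<open>H(z) / \<Gamma>(Re \<psi> + n)\<close>, so everything rests on the sharp
  estimate \<open>g\<^sub>n / \<Gamma>(\<psi> + n) = O(n\<^sup>-\<^sup>\<alpha>\<^sup>-\<^sup>1 log\<^sup>r\<^sup>-\<^sup>1 n)\<close>.

  For the latter, shift the parameters by large integers: \<open>f = F \<cdot> Q\<close> with \<open>Q\<close> rational and \<open>F\<close> a Gamma
  quotient whose poles are so far to the left that crude bounds on its coefficients suffice. In the region
  that matters \<open>F\<close> has neither poles nor zeros, so the poles of \<open>Q\<close> in lowest terms are those of \<open>f\<close>.
  Partial fractions reduce the claim to \<open>F / (s + \<mu>)\<^sup>m\<close>, and dividing by \<open>s + \<mu>\<close> just replaces the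
  coefficients by weighted partial sums. Since an inverse factorial series determines its coefficients, the
  estimate obtained in this way holds for \<open>g\<^sub>n\<close>.
\<close>

section \<open>Growth of Pochhammer symbols and of the reciprocal Gamma function\<close>

text \<open>Estimating the nested sum for \<open>norlund_g\<close> directly loses powers of n, and
  it cannot see that a pole of some \<open>Gamma (c k + s)\<close> may be cancelled by a zero of
  some \<open>rGamma (b j + s)\<close>, while the exponent concerns only the poles that survive. The
  crude loss depends on the differences c_m - b_(m+1) alone, so a common shift by N leaves it
  unchanged and yet moves all poles N units to the left: a large N beats any fixed loss. The price
  is a rational factor, but its roots are explicit, so cancellation becomes subtraction of multisets
  and pole order becomes multiplicity. Powers of the logarithm arise in one place only, the repeated
  division by the same s + mu, where the weighted partial sums diverge like a harmonic series.
  Everything is normalised by \<open>rGamma\<close> instead of being divided by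
  \<open>Gamma\<close>, so the identities hold across the poles. Gauss' theorem serves twice: it
  attaches a Gamma factor to a series, and it evaluates the complex Beta integral behind Euler's
  formula.\<close>

text \<open>
  The growth scale: \<open>fpow (Re z - 1) n\<close> is comparable to \<open>|\<Gamma>(z + n)|\<close>, but stays positive and
  manageable when \<open>z + n\<close> hits a pole.
\<close>

definition fpow :: "real \<Rightarrow> nat \<Rightarrow> real" where
  "fpow e n = fact n * (real n + 1) powr e"

lemma fpow_pos [simp]: "fpow e n > 0"
  by (simp add: fpow_def)

lemma fpow_nonneg [simp]: "fpow e n \<ge> 0"
  by (simp add: fpow_def)

lemma fpow_plus1: "fpow (e + 1) n = (real n + 1) * fpow e n"
  by (simp add: fpow_def powr_add)

lemma fpow_divide: "fpow e n / fpow e' n = (real n + 1) powr (e - e')"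
  by (simp add: fpow_def powr_diff)

lemma fpow_mult_powr: "fpow e n * (real n + 1) powr e' = fpow (e + e') n"
  by (simp add: fpow_def powr_add)

lemma powr_Suc_le: 
  assumes "n \<ge> 1"
  shows "real n powr e \<le> 2 powr \<bar>e\<bar> * (real n + 1) powr e"
proof (cases "e \<ge> 0")
  case True
  have "real n powr e \<le> (real n + 1) powr e"
    using True by (intro powr_mono2) auto
  also have "\<dots> \<le> 2 powr \<bar>e\<bar> * (real n + 1) powr e"
    by (simp add: ge_one_powr_ge_zero)
  finally show ?thesis .
next
  case False
  have "real n powr e = 2 powr \<bar>e\<bar> * (2 * real n) powr e"
    using False assms by (simp add: powr_mult powr_minus field_simps)
  also have "(2 * real n) powr e \<le> (real n + 1) powr e"
    using False assms by (intro powr_mono2') auto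
  finally show ?thesis by simp
qed

lemma powr_Suc_ge: 
  assumes "n \<ge> 1"
  shows "(real n + 1) powr e \<le> 2 powr \<bar>e\<bar> * real n powr e"
  using powr_Suc_le[OF assms, of "-e"] assms by (simp add: powr_minus field_simps)

text \<open>The counterpart of Gamma(z + 1 + n) = Gamma(z + (n + 1)), which survives only up to
  constants. Inductions along z -> z + 1 trade a unit of the exponent for a unit of the
  index.\<close>

lemma fpow_Suc_le: "fpow e (Suc n) \<le> 2 powr \<bar>e\<bar> * fpow (e + 1) n"
  and fpow_Suc_ge: "fpow (e + 1) n \<le> 2 powr \<bar>e\<bar> * fpow e (Suc n)"
proof -
  have eq: "fpow (e + 1) n = fact (Suc n) * real (Suc n) powr e"
    unfolding fpow_def by (simp add: powr_add add_ac)
  show "fpow e (Suc n) \<le> 2 powr \<bar>e\<bar> * fpow (e + 1) n"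
    unfolding eq unfolding fpow_def
    using powr_Suc_ge[of "Suc n" e] by (simp add: mult_ac del: of_nat_Suc)
  show "fpow (e + 1) n \<le> 2 powr \<bar>e\<bar> * fpow e (Suc n)"
    unfolding eq unfolding fpow_def
    using powr_Suc_le[of "Suc n" e] by (simp add: mult_ac del: of_nat_Suc)
qed

lemma tendsto_norm_pochhammer:
  fixes z :: complex
  shows "(\<lambda>n. norm (pochhammer z n) / fpow (Re z - 1) n) \<longlonglongrightarrow> norm (rGamma z)"
proof -
  \<comment> \<open>Euler's limit is normalised by n! n^z at index n, \<open>fpow\<close> at
    \<open>Suc n\<close> by (n+1)! (n+2)^(Re z - 1). The second factor is the ratio of the two and
    tends to 1.\<close>
  have "(\<lambda>n. norm (rGamma_series z n) * (real n powr Re z / ((real n + 1) * (real n + 2) powr (Re z - 1))))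
          \<longlonglongrightarrow> norm (rGamma z) * 1"
    by (intro tendsto_mult tendsto_norm rGamma_series_LIMSEQ) real_asymp
  moreover have "eventually (\<lambda>n. norm (rGamma_series z n) * (real n powr Re z / ((real n + 1) * (real n + 2) powr (Re z - 1)))
      = norm (pochhammer z (Suc n)) / fpow (Re z - 1) (Suc n)) sequentially"
    using eventually_gt_at_top[of 0]
  proof eventually_elim
    case (elim n)
    have "norm (exp (z * of_real (ln (real n)))) = real n powr Re z"
      using elim by (simp add: powr_def)
    thus ?case using elim
      by (simp add: rGamma_series_def norm_divide norm_mult fpow_def add_ac mult_ac)
  qed
  ultimately have "(\<lambda>n. norm (pochhammer z (Suc n)) / fpow (Re z - 1) (Suc n)) \<longlonglongrightarrow> norm (rGamma z)"
    by (simp add: tendsto_cong)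
  thus ?thesis by (rule LIMSEQ_imp_Suc)
qed

lemma norm_pochhammer_le:
  fixes z :: complex
  obtains C where "C > 0" "\<And>n. norm (pochhammer z n) \<le> C * fpow (Re z - 1) n"
proof -
  have "Bseq (\<lambda>n. norm (pochhammer z n) / fpow (Re z - 1) n)"
    using tendsto_norm_pochhammer[of z] convergent_imp_Bseq convergentI by blast
  then obtain K where K: "K > 0" "\<And>n. norm (norm (pochhammer z n) / fpow (Re z - 1) n) \<le> K"
    unfolding Bseq_def by blast
  show ?thesis
  proof (rule that[OF K(1)])
    show "norm (pochhammer z n) \<le> K * fpow (Re z - 1) n" for n
      using K(2)[of n] by (simp add: divide_le_eq)
  qed
qed

text \<open>The limit \<open>norm (rGamma z)\<close> is nonzero exactly off the nonpositive
  integers, so there the inverse quotient converges too and is bounded.\<close>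

lemma norm_pochhammer_ge:
  fixes z :: complex
  assumes z: "z \<notin> \<int>\<^sub>\<le>\<^sub>0"
  obtains C where "C > 0" "\<And>n. fpow (Re z - 1) n \<le> C * norm (pochhammer z n)"
proof -
  have nz: "pochhammer z n \<noteq> 0" for n
    using z by (auto simp: pochhammer_eq_0_iff)
  have "(\<lambda>n. inverse (norm (pochhammer z n) / fpow (Re z - 1) n)) \<longlonglongrightarrow> inverse (norm (rGamma z))"
    using z by (intro tendsto_inverse tendsto_norm_pochhammer) (simp add: rGamma_eq_zero_iff)
  hence "Bseq (\<lambda>n. fpow (Re z - 1) n / norm (pochhammer z n))"
    using convergent_imp_Bseq convergentI by (fastforce simp: field_simps)
  then obtain K where K: "K > 0" "\<And>n. norm (fpow (Re z - 1) n / norm (pochhammer z n)) \<le> K"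
    unfolding Bseq_def by blast
  show ?thesis
  proof (rule that[OF K(1)])
    show "fpow (Re z - 1) n \<le> K * norm (pochhammer z n)" for n
      using K(2)[of n] nz[of n] by (simp add: divide_le_eq)
  qed
qed

text \<open>Reduces claims about all z to those z where (z)_n never vanishes: finitely many unit
  steps to the right leave the nonpositive integers.\<close>

lemma complex_shift_induct [case_names base step]:
  fixes z :: complex
  assumes base: "\<And>z. z \<notin> \<int>\<^sub>\<le>\<^sub>0 \<Longrightarrow> P z" and step: "\<And>z. P (z + 1) \<Longrightarrow> P z"
  shows "P z"
proof -
  have "P (z + of_nat m) \<Longrightarrow> P z" for m
  proof (induction m)
    case (Suc m)
    thus ?case using step[of "z + of_nat m"] by (simp add: add_ac)
  qed auto
  moreover obtain m :: nat where "real m > - Re z"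
    using reals_Archimedean2 by blast
  hence "z + of_nat m \<notin> \<int>\<^sub>\<le>\<^sub>0" by (auto elim!: nonpos_Ints_cases simp: complex_eq_iff)
  ultimately show ?thesis using base by blast
qed

text \<open>The constant is uniform in j and k. Off the poles (z + j)_k is (z)_(j+k) / (z)_j; at a
  nonpositive integer this turns into 0/0 for large j, hence the descent from z + 1, in which only j
  = 0 is treated by hand.\<close>

lemma norm_pochhammer_shift_le:
  fixes z :: complex
  shows "\<exists>C>0. \<forall>j k. norm (pochhammer (z + of_nat j) k) \<le> C * (fpow (Re z - 1) (j + k) / fpow (Re z - 1) j)"
proof (induction z rule: complex_shift_induct)
  case (base z)
  obtain C where C: "C > 0" "\<And>n. norm (pochhammer z n) \<le> C * fpow (Re z - 1) n"
    using norm_pochhammer_le[of z] by blast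
  obtain D where D: "D > 0" "\<And>n. fpow (Re z - 1) n \<le> D * norm (pochhammer z n)"
    using norm_pochhammer_ge[OF base] by blast
  have "norm (pochhammer (z + of_nat j) k) \<le> C * D * (fpow (Re z - 1) (j + k) / fpow (Re z - 1) j)" for j k
  proof -
    have "fpow (Re z - 1) j * norm (pochhammer (z + of_nat j) k) \<le> (D * norm (pochhammer z j)) * norm (pochhammer (z + of_nat j) k)"
      by (intro mult_right_mono D) auto
    also have "\<dots> = D * norm (pochhammer z (j + k))"
      by (simp add: pochhammer_product' norm_mult)
    also have "\<dots> \<le> D * (C * fpow (Re z - 1) (j + k))"
      using C D by (intro mult_left_mono) auto
    finally show ?thesis by (simp add: field_simps)
  qed
  thus ?case using C D by (intro exI[of _ "C * D"]) auto
next
  case (step z)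
  then obtain C where C: "C > 0" "\<And>j k. norm (pochhammer (z + 1 + of_nat j) k) \<le> C * (fpow (Re z) (j + k) / fpow (Re z) j)"
    by auto
  define e where "e = Re z - 1"
  define K where "K = 2 powr \<bar>e\<bar>"
  have K: "K \<ge> 1" unfolding K_def by (simp add: ge_one_powr_ge_zero)
  have fS: "fpow (Re z) n \<le> K * fpow e (Suc n)" "fpow e (Suc n) \<le> K * fpow (Re z) n" for n
    using fpow_Suc_le[of e n] fpow_Suc_ge[of e n] by (simp_all add: e_def K_def)
  define E where "E = max (C * K * K) (max 1 (norm z * C * K))"
  have E: "E \<ge> C * K * K" "E \<ge> 1" "E \<ge> norm z * C * K" by (auto simp: E_def)
  have "norm (pochhammer (z + of_nat j) k) \<le> E * (fpow e (j + k) / fpow e j)" for j k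
  proof (cases j)
    case (Suc i)
    have "norm (pochhammer (z + of_nat j) k) \<le> C * (fpow (Re z) (i + k) / fpow (Re z) i)"
      using C(2)[of i k] Suc by (simp add: add_ac)
    also have "\<dots> \<le> C * ((K * fpow e (Suc (i + k))) / (fpow e (Suc i) / K))"
      using C K fS by (intro mult_left_mono frac_le) (auto simp: divide_le_eq mult_ac)
    also have "\<dots> = C * K * K * (fpow e (j + k) / fpow e j)"
      by (simp add: Suc)
    also have "\<dots> \<le> E * (fpow e (j + k) / fpow e j)"
      by (intro mult_right_mono E) auto
    finally show ?thesis .
  next
    case 0
    show ?thesis
    proof (cases k)
      case 0
      thus ?thesis using \<open>j = 0\<close> E by (simp add: fpow_def)
    next
      case (Suc l)
      have "norm (pochhammer (z + of_nat j) k) = norm z * norm (pochhammer (z + 1) l)"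
        using 0 Suc by (simp add: pochhammer_rec norm_mult)
      also have "\<dots> \<le> norm z * (C * fpow (Re z) l)"
        using C(2)[of 0 l] by (intro mult_left_mono) (auto simp: fpow_def)
      also have "\<dots> \<le> norm z * (C * (K * fpow e (Suc l)))"
        using C by (intro mult_left_mono fS) auto
      also have "\<dots> = norm z * C * K * (fpow e (j + k) / fpow e j)"
        using 0 Suc by (simp add: fpow_def)
      also have "\<dots> \<le> E * (fpow e (j + k) / fpow e j)"
        by (intro mult_right_mono E) auto
      finally show ?thesis .
    qed
  qed
  thus ?case using E unfolding e_def by (intro exI[of _ E]) auto
qed

text \<open>Since rGamma(z) = (z)_n rGamma(z + n), a lower bound for Pochhammer symbols is an upper
  bound here.\<close>

lemma norm_rGamma_le:
  fixes z :: complex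
  shows "\<exists>C>0. \<forall>n. norm (rGamma (z + of_nat n)) * fpow (Re z - 1) n \<le> C"
proof (induction z rule: complex_shift_induct)
  case (base z)
  obtain D where D: "D > 0" "\<And>n. fpow (Re z - 1) n \<le> D * norm (pochhammer z n)"
    using norm_pochhammer_ge[OF base] by blast
  have "norm (rGamma (z + of_nat n)) * fpow (Re z - 1) n \<le> D * norm (rGamma z)" for n
  proof -
    have "norm (rGamma (z + of_nat n)) * fpow (Re z - 1) n \<le> norm (rGamma (z + of_nat n)) * (D * norm (pochhammer z n))"
      by (intro mult_left_mono D) auto
    also have "\<dots> = D * norm (rGamma z)"
      by (subst pochhammer_rGamma[of z n]) (simp add: norm_mult)
    finally show ?thesis .
  qed
  thus ?case using D base by (intro exI[of _ "D * norm (rGamma z)"]) (auto simp: rGamma_eq_zero_iff)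
next
  case (step z)
  then obtain C where C: "C > 0" "\<And>n. norm (rGamma (z + 1 + of_nat n)) * fpow (Re z) n \<le> C"
    by auto
  define e where "e = Re z - 1"
  define K where "K = 2 powr \<bar>e\<bar>"
  have K: "K \<ge> 1" unfolding K_def by (simp add: ge_one_powr_ge_zero)
  have fS: "fpow e (Suc n) \<le> K * fpow (Re z) n" for n
    using fpow_Suc_le[of e n] by (simp add: e_def K_def)
  define E where "E = max (norm (rGamma z)) (K * C)"
  have "norm (rGamma (z + of_nat n)) * fpow e n \<le> E" for n
  proof (cases n)
    case (Suc m)
    have "norm (rGamma (z + of_nat n)) * fpow e n \<le> norm (rGamma (z + 1 + of_nat m)) * (K * fpow (Re z) m)"
      using fS[of m] Suc by (simp add: add_ac mult_left_mono)
    also have "\<dots> \<le> K * C"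
      using C(2)[of m] K by (simp add: mult_ac mult_left_mono)
    finally show ?thesis by (simp add: E_def)
  qed (auto simp: E_def fpow_def)
  moreover have "E > 0" using C K by (auto simp: E_def less_max_iff_disj)
  ultimately show ?case unfolding e_def by (intro exI[of _ E]) auto
qed

section \<open>Gauss' summation theorem\<close>

abbreviation logp :: "nat \<Rightarrow> real" where "logp n \<equiv> 1 + ln (real n + 1)"

lemma logp_power_le:
  fixes \<epsilon> :: real
  assumes "\<epsilon> > 0"
  shows "\<exists>K>0. \<forall>x\<ge>1::real. (1 + ln x) ^ l \<le> K * x powr \<epsilon>"
proof -
  \<comment> \<open>Each of the l factors may spend epsilon / l; using l + 1 covers l = 0 as
    well.\<close>
  define \<delta> where "\<delta> = \<epsilon> / (real l + 1)"
  have \<delta>: "\<delta> > 0" using assms by (simp add: \<delta>_def)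
  have "(1 + ln x) ^ l \<le> (1 + 1 / \<delta>) ^ l * x powr \<epsilon>" if "x \<ge> 1" for x :: real
  proof -
    have "1 + ln x \<le> x powr \<delta> + x powr \<delta> / \<delta>"
      using that \<delta> by (intro add_mono ln_powr_bound) (auto simp: ge_one_powr_ge_zero)
    also have "\<dots> = (1 + 1 / \<delta>) * x powr \<delta>" by (simp add: field_simps)
    finally have "(1 + ln x) ^ l \<le> ((1 + 1 / \<delta>) * x powr \<delta>) ^ l"
      using that by (intro power_mono) auto
    also have "\<dots> = (1 + 1 / \<delta>) ^ l * x powr (\<delta> * real l)"
      using that by (simp add: power_mult_distrib powr_power mult.commute)
    also have "\<dots> \<le> (1 + 1 / \<delta>) ^ l * x powr \<epsilon>"
      using that \<delta> assms by (intro mult_left_mono powr_mono) (auto simp: \<delta>_def field_simps)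
    finally show ?thesis .
  qed
  thus ?thesis using \<delta> by (intro exI[of _ "(1 + 1 / \<delta>) ^ l"]) (auto intro!: zero_less_power add_pos_pos)
qed

lemma summable_powr_Suc:
  assumes "e < -1"
  shows "summable (\<lambda>n. (real n + 1) powr e)"
proof -
  have "summable (\<lambda>n. real (Suc n) powr e)"
    using assms by (subst summable_Suc_iff) (simp add: summable_real_powr_iff)
  thus ?thesis by (simp add: add_ac)
qed

lemma summable_powr_logp:
  assumes "e < -1"
  shows "summable (\<lambda>n. (real n + 1) powr e * logp n ^ l)"
proof -
  define \<epsilon> where "\<epsilon> = (-1 - e) / 2"
  have \<epsilon>: "\<epsilon> > 0" using assms by (simp add: \<epsilon>_def)
  obtain K where K: "K > 0" "\<And>x. x \<ge> 1 \<Longrightarrow> (1 + ln x) ^ l \<le> K * x powr \<epsilon>"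
    using logp_power_le[OF \<epsilon>] by blast
  show ?thesis
  proof (rule summable_comparison_test')
    show "summable (\<lambda>n. K * (real n + 1) powr (e + \<epsilon>))"
      by (intro summable_mult summable_powr_Suc) (use assms in \<open>auto simp: \<epsilon>_def field_simps\<close>)
    show "norm ((real n + 1) powr e * logp n ^ l) \<le> K * (real n + 1) powr (e + \<epsilon>)" if "n \<ge> 0" for n
      using K(2)[of "real n + 1"] by (simp add: powr_add mult_ac mult_left_mono)
  qed
qed

text \<open>The factorials in the bounds for g_n and for 1/Gamma(w + n) cancel and leave a pure
  power with logarithms, so absolute convergence becomes the condition Re w > e + 2.\<close>

lemma inv_fact_term_bound:
  fixes g :: "nat \<Rightarrow> complex"
  assumes g: "\<And>n. norm (g n) \<le> C * (fpow e n * logp n ^ l)"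
  shows "\<exists>K>0. \<forall>n. norm (g n * rGamma (w + of_nat n)) \<le> K * ((real n + 1) powr (e + 1 - Re w) * logp n ^ l)"
proof -
  obtain D where D: "D > 0" "\<And>n. norm (rGamma (w + of_nat n)) * fpow (Re w - 1) n \<le> D"
    using norm_rGamma_le[of w] by blast
  define K where "K = max 1 (\<bar>C\<bar> * D)"
  have "norm (g n * rGamma (w + of_nat n)) \<le> K * ((real n + 1) powr (e + 1 - Re w) * logp n ^ l)" for n
  proof -
    have "norm (g n) \<le> \<bar>C\<bar> * (fpow e n * logp n ^ l)"
      using g[of n] by (rule order_trans) (intro mult_right_mono, auto)
    hence "norm (g n * rGamma (w + of_nat n)) \<le> (\<bar>C\<bar> * (fpow e n * logp n ^ l)) * (D / fpow (Re w - 1) n)"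
      unfolding norm_mult using D(2)[of n] by (intro mult_mono) (auto simp: pos_le_divide_eq)
    also have "\<dots> = (\<bar>C\<bar> * D) * ((fpow e n / fpow (Re w - 1) n) * logp n ^ l)" by simp
    also have "\<dots> = (\<bar>C\<bar> * D) * ((real n + 1) powr (e + 1 - Re w) * logp n ^ l)" 
      unfolding fpow_divide by (simp add: algebra_simps)
    also have "\<dots> \<le> K * ((real n + 1) powr (e + 1 - Re w) * logp n ^ l)"
      by (intro mult_right_mono) (auto simp: K_def)
    finally show ?thesis .
  qed
  thus ?thesis by (intro exI[of _ K]) (auto simp: K_def)
qed

lemma inv_fact_summable:
  fixes g :: "nat \<Rightarrow> complex"
  assumes g: "\<And>n. norm (g n) \<le> C * (fpow e n * logp n ^ l)" and w: "Re w > e + 2"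
  shows "summable (\<lambda>n. norm (g n * rGamma (w + of_nat n)))"
proof -
  obtain K where K: "\<And>n. norm (g n * rGamma (w + of_nat n)) \<le> K * ((real n + 1) powr (e + 1 - Re w) * logp n ^ l)"
    using inv_fact_term_bound[OF g] by blast
  show ?thesis
    by (rule summable_comparison_test'[of "\<lambda>n. K * ((real n + 1) powr (e + 1 - Re w) * logp n ^ l)" 0])
       (use K w in \<open>auto intro!: summable_mult summable_powr_logp\<close>)
qed

lemma norm_pochhammer_of_real_le:
  assumes "0 < x" "x \<le> Re z"
  shows "norm (pochhammer (complex_of_real x) n) \<le> norm (pochhammer z n)"
  unfolding pochhammer_prod prod_norm[symmetric]
proof (intro prod_mono conjI)
  fix i
  have "norm (complex_of_real x + of_nat i) = x + real i"
    using assms by (metis abs_of_pos add_pos_nonneg norm_of_real of_nat_0_le_iff of_real_add of_real_of_nat_eq)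
  also have "\<dots> \<le> Re (z + of_nat i)" using assms by simp
  also have "\<dots> \<le> norm (z + of_nat i)" by (rule complex_Re_le_cmod)
  finally show "norm (complex_of_real x + of_nat i) \<le> norm (z + of_nat i)" .
qed auto

lemma tendsto_inverse_add_of_nat: "(\<lambda>m. inverse (c + of_nat m :: complex)) \<longlonglongrightarrow> 0"
  by (rule filterlim_compose[OF tendsto_inverse_0])
     (intro tendsto_add_filterlim_at_infinity[OF tendsto_const] tendsto_of_nat)

lemma tendsto_inverse_pochhammer:
  "(\<lambda>m. inverse (pochhammer (w + of_nat m :: complex) (Suc n))) \<longlonglongrightarrow> 0"
proof (induction n)
  case 0
  thus ?case using tendsto_inverse_add_of_nat[of w] by simp
next
  case (Suc n)
  have "(\<lambda>m. inverse (pochhammer (w + of_nat m :: complex) (Suc n)) * 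
          inverse ((w + of_nat (Suc n)) + of_nat m)) \<longlonglongrightarrow> 0 * 0"
    by (intro tendsto_mult Suc tendsto_inverse_add_of_nat)
  also have "(\<lambda>m. inverse (pochhammer (w + of_nat m :: complex) (Suc n)) * 
          inverse ((w + of_nat (Suc n)) + of_nat m)) = (\<lambda>m. inverse (pochhammer (w + of_nat m :: complex) (Suc (Suc n))))"
    by (subst (2) pochhammer_Suc) (simp add: add_ac)
  finally show ?case by simp
qed

text \<open>After multiplication by Gamma(w + m) the n-th term is g_n / (w + m)_n, which tends to 0
  unless n = 0. So the leading coefficient can be read off from the function; this yields both
  uniqueness and the normalisation in Gauss' theorem.\<close>

lemma inv_fact_limit:
  fixes g :: "nat \<Rightarrow> complex"
  assumes g: "\<And>n. norm (g n) \<le> C * (fpow e n * logp n ^ l)"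
  shows "(\<lambda>m. (\<Sum>n. g n * rGamma (w + of_nat m + of_nat n)) * Gamma (w + of_nat m)) \<longlonglongrightarrow> g 0"
proof -
  \<comment> \<open>Provides a real point x in the region of absolute convergence. For m >= m0 each
    factor of (w + m)_n dominates that of (x)_n, which gives Tannery's theorem a majorant
    independent of m.\<close>
  obtain m0 :: nat where m0: "real m0 > \<bar>Re w\<bar> + \<bar>e\<bar> + 3"
    using reals_Archimedean2 by blast
  define x where "x = Re w + real m0"
  have x: "x > 0" "x > e + 2" using m0 by (auto simp: x_def)
  have xn: "complex_of_real x \<notin> \<int>\<^sub>\<le>\<^sub>0" using x by (auto elim!: nonpos_Ints_cases simp: complex_eq_iff)
  define M where "M n = norm (g n / pochhammer (complex_of_real x) n)" for n
  have Mx: "g n / pochhammer (complex_of_real x) n = Gamma (of_real x) * (g n * rGamma (of_real x + of_nat n))" for n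
    using pochhammer_Gamma[OF xn, of n] by (simp add: rGamma_inverse_Gamma divide_inverse)
  have sM: "summable M"
    unfolding M_def Mx norm_mult[of "Gamma _"] using x by (intro summable_mult inv_fact_summable[OF g]) auto
  have nn: "w + of_nat m \<notin> \<int>\<^sub>\<le>\<^sub>0" if "m \<ge> m0" for m
    using that x by (auto elim!: nonpos_Ints_cases simp: complex_eq_iff x_def)
  have eq: "g n * rGamma (w + of_nat m + of_nat n) * Gamma (w + of_nat m) = g n / pochhammer (w + of_nat m) n" if "m \<ge> m0" for m n
    using pochhammer_Gamma[OF nn[OF that], of n] by (simp add: rGamma_inverse_Gamma divide_inverse)
  define a where "a n m = g n / pochhammer (w + of_nat m) n" for n m
  have "((\<lambda>m. \<Sum>n. a n m) \<longlonglongrightarrow> (\<Sum>n. if n = 0 then g 0 else 0))"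
  proof (rule tannerys_theorem[where M = M, THEN conjunct2, THEN conjunct2])
    show "(\<lambda>m. a n m) \<longlonglongrightarrow> (if n = 0 then g 0 else 0)" for n
    proof (cases n)
      case (Suc k)
      thus ?thesis using tendsto_mult[OF tendsto_const[of "g n"] tendsto_inverse_pochhammer[of w k]]
        by (simp add: a_def divide_inverse)
    qed (simp add: a_def)
    have "norm (a n m) \<le> M n" if "m \<ge> m0" for n m
    proof -
      have "norm (pochhammer (complex_of_real x) n) \<le> norm (pochhammer (w + of_nat m) n)"
        using x that by (intro norm_pochhammer_of_real_le) (auto simp: x_def)
      moreover have "pochhammer (complex_of_real x) n \<noteq> 0"
        using xn by (auto simp: pochhammer_eq_0_iff)
      ultimately show ?thesis unfolding a_def M_def norm_divide
        by (intro divide_left_mono mult_pos_pos) auto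
    qed
    thus "eventually (\<lambda>(n,m). norm (a n m) \<le> M n) (at_top \<times>\<^sub>F sequentially)"
      unfolding eventually_prod_filter
      by (intro exI[of _ "\<lambda>_. True"] exI[of _ "\<lambda>m. m \<ge> m0"]) auto
  qed (use sM in auto)
  also have "(\<Sum>n. if n = 0 then g 0 else 0) = g 0"
    using suminf_finite[of "{0}" "\<lambda>n. if n = 0 then g 0 else 0"] by auto
  finally have "(\<lambda>m. \<Sum>n. a n m) \<longlonglongrightarrow> g 0" .
  moreover have "eventually (\<lambda>m. (\<Sum>n. a n m) = (\<Sum>n. g n * rGamma (w + of_nat m + of_nat n)) * Gamma (w + of_nat m)) sequentially"
    using eventually_ge_at_top[of m0]
  proof eventually_elim
    case (elim m)
    have "summable (\<lambda>n. g n * rGamma (w + of_nat m + of_nat n))"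
      using elim x by (intro summable_norm_cancel[OF inv_fact_summable[OF g]]) (auto simp: x_def)
    hence "(\<Sum>n. g n * rGamma (w + of_nat m + of_nat n)) * Gamma (w + of_nat m) =
             (\<Sum>n. g n * rGamma (w + of_nat m + of_nat n) * Gamma (w + of_nat m))"
      by (rule suminf_mult2)
    thus ?case by (simp add: a_def eq[OF elim])
  qed
  ultimately show ?thesis by (rule Lim_transform_eventually)
qed

section \<open>Gauss' theorem from a contiguous relation\<close>

lemma norm_gauss_coeff_le:
  "\<exists>C>0. \<forall>k. norm (pochhammer A k * pochhammer B k / fact k :: complex) \<le> C * fpow (Re A + Re B - 2) k"
proof -
  obtain C where C: "C > 0" "\<And>n. norm (pochhammer A n) \<le> C * fpow (Re A - 1) n"
    using norm_pochhammer_le[of A] by blast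
  obtain D where D: "D > 0" "\<And>n. norm (pochhammer B n) \<le> D * fpow (Re B - 1) n"
    using norm_pochhammer_le[of B] by blast
  have "norm (pochhammer A k * pochhammer B k / fact k) \<le> (C * D) * fpow (Re A + Re B - 2) k" for k
  proof -
    have "norm (pochhammer A k * pochhammer B k / fact k) \<le> (C * fpow (Re A - 1) k) * (D * fpow (Re B - 1) k) / fact k"
      unfolding norm_divide norm_mult norm_fact using C D
      by (intro divide_right_mono mult_mono) auto
    also have "\<dots> = (C * D) * fpow (Re A + Re B - 2) k"
      by (simp add: fpow_def powr_add [symmetric])
    finally show ?thesis .
  qed
  thus ?thesis using C D by (intro exI[of _ "C * D"]) auto
qed

lemma gauss_recurrence:
  fixes A B C :: complex
  defines "S \<equiv> \<lambda>C. \<Sum>k. pochhammer A k * pochhammer B k / fact k * rGamma (C + of_nat k)"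
  assumes "Re (C - A - B) > 0"
  shows "(C - A - B) * S C = (C - A) * (C - B) * S (C + 1)"
proof -
  define u where "u k = pochhammer A k * pochhammer B k / fact k" for k
  obtain K where K: "K > 0" "\<And>k. norm (u k) \<le> K * fpow (Re A + Re B - 2) k"
    using norm_gauss_coeff_le[of A B] unfolding u_def by blast
  hence K': "norm (u k) \<le> K * (fpow (Re A + Re B - 2) k * logp k ^ 0)" for k by simp
  \<comment> \<open>Telescoping certificate: the combination of the two series is termwise a
    difference of values of \<open>t\<close>, which vanishes at k = 0 and, because Re (C - A - B) >
    0, also at infinity.\<close>
  define t where "t k = of_nat k * u k * rGamma (C + of_nat k)" for k
  have uS: "of_nat (Suc k) * u (Suc k) = (A + of_nat k) * (B + of_nat k) * u k" for k
    by (simp add: u_def pochhammer_Suc del: of_nat_Suc)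
  have s: "summable (\<lambda>k. u k * rGamma (C + of_nat k))" "summable (\<lambda>k. u k * rGamma (C + 1 + of_nat k))"
    using assms by (intro summable_norm_cancel[OF inv_fact_summable[OF K']]; simp)+
  have tel: "(C - A - B) * (u k * rGamma (C + of_nat k)) - (C - A) * (C - B) * (u k * rGamma (C + 1 + of_nat k))
             = - (t (Suc k) - t k)" for k
  proof -
    have 1: "rGamma (C + of_nat k) = (C + of_nat k) * rGamma (C + 1 + of_nat k)"
      using rGamma_plus1[of "C + of_nat k"] by (simp add: add_ac)
    have "t (Suc k) = (A + of_nat k) * (B + of_nat k) * u k * rGamma (C + 1 + of_nat k)"
      unfolding t_def uS by (simp add: add_ac)
    thus ?thesis unfolding t_def 1 by (simp add: algebra_simps)
  qed
  have "t \<longlonglongrightarrow> 0"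
  proof -
    obtain L where L: "\<And>n. norm (u n * rGamma (C + of_nat n)) \<le> L * ((real n + 1) powr (Re A + Re B - 2 + 1 - Re C) * logp n ^ 0)"
      using inv_fact_term_bound[OF K'] by blast
    have "norm (t n) \<le> L * ((real n + 1) powr (- Re (C - A - B)))" for n
    proof -
      have "norm (t n) = real n * norm (u n * rGamma (C + of_nat n))"
        by (simp add: t_def norm_mult)
      also have "\<dots> \<le> (real n + 1) * norm (u n * rGamma (C + of_nat n))"
        by (intro mult_right_mono) auto
      also have "\<dots> \<le> (real n + 1) * (L * ((real n + 1) powr (- Re (C - A - B) - 1)))"
        using L[of n] by (intro mult_left_mono) (simp_all add: algebra_simps)
      also have "\<dots> = L * ((real n + 1) powr (- Re (C - A - B)))"
        by (simp add: powr_diff)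
      finally show ?thesis .
    qed
    moreover have "(\<lambda>n. L * ((real n + 1) powr (- Re (C - A - B)))) \<longlonglongrightarrow> L * 0"
      using assms by (intro tendsto_mult tendsto_const tendsto_neg_powr) (auto intro!: filterlim_tendsto_add_at_top filterlim_real_sequentially simp: add.commute[of _ 1])
    ultimately show ?thesis
      by (intro Lim_null_comparison[of t]) auto
  qed
  have "(\<lambda>k. (C - A - B) * (u k * rGamma (C + of_nat k)) - (C - A) * (C - B) * (u k * rGamma (C + 1 + of_nat k)))
     sums ((C - A - B) * S C - (C - A) * (C - B) * S (C + 1))"
    unfolding S_def using s unfolding u_def by (intro sums_diff sums_mult summable_sums)
  moreover have "(\<lambda>k. - (t (Suc k) - t k)) sums - (0 - t 0)"
    by (intro sums_minus telescope_sums \<open>t \<longlonglongrightarrow> 0\<close>)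
  ultimately show ?thesis unfolding tel by (simp add: sums_iff t_def)
qed

text \<open>Iterating the relation moves C to C + m, where the series divided by its first term
  tends to 1. A nonpositive integer C is reached by the same relation, read from C + 1 back to
  C.\<close>

theorem gauss_sums:
  fixes A B C :: complex
  assumes "Re (C - A - B) > 0"
  shows "(\<lambda>k. pochhammer A k * pochhammer B k / fact k * rGamma (C + of_nat k)) sums
           (Gamma (C - A - B) * rGamma (C - A) * rGamma (C - B))"
proof -
  define u where "u k = pochhammer A k * pochhammer B k / fact k" for k
  obtain K where K: "K > 0" "\<And>k. norm (u k) \<le> K * fpow (Re A + Re B - 2) k"
    using norm_gauss_coeff_le[of A B] unfolding u_def by blast
  hence K': "norm (u k) \<le> K * (fpow (Re A + Re B - 2) k * logp k ^ 0)" for k by simp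
  define S where "S = (\<lambda>C. \<Sum>k. u k * rGamma (C + of_nat k))"
  have rec: "(C - A - B) * S C = (C - A) * (C - B) * S (C + 1)" if "Re (C - A - B) > 0" for C
    using gauss_recurrence[OF that] by (simp add: S_def u_def)
  have "Re (C - A - B) > 0 \<longrightarrow> S C = Gamma (C - A - B) * rGamma (C - A) * rGamma (C - B)"
  proof (induction C rule: complex_shift_induct)
    case (step C)
    show ?case
    proof
      assume *: "Re (C - A - B) > 0"
      hence "S (C + 1) = Gamma ((C - A - B) + 1) * rGamma ((C - A) + 1) * rGamma ((C - B) + 1)"
        using step by (simp add: algebra_simps)
      moreover have "C - A - B \<notin> \<int>\<^sub>\<le>\<^sub>0" using * by (auto elim!: nonpos_Ints_cases simp: complex_eq_iff)
      hence "Gamma ((C - A - B) + 1) = (C - A - B) * Gamma (C - A - B)" by (rule Gamma_plus1)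
      ultimately have "(C - A - B) * S C = (C - A - B) * (Gamma (C - A - B) * ((C - A) * rGamma ((C - A) + 1)) * ((C - B) * rGamma ((C - B) + 1)))"
        using rec[OF *] by (simp only: mult_ac)
      also have "\<dots> = (C - A - B) * (Gamma (C - A - B) * rGamma (C - A) * rGamma (C - B))"
        by (simp only: rGamma_plus1)
      finally show "S C = Gamma (C - A - B) * rGamma (C - A) * rGamma (C - B)"
        using * by (metis mult_cancel_left order_less_irrefl zero_complex.simps(1))
    qed
  next
    case (base C)
    show ?case
    proof
      assume *: "Re (C - A - B) > 0"
      define D where "D = C - A - B"
      have D: "D \<notin> \<int>\<^sub>\<le>\<^sub>0" using * by (auto elim!: nonpos_Ints_cases simp: complex_eq_iff D_def)
      hence pD: "pochhammer D m \<noteq> 0" for m by (auto simp: pochhammer_eq_0_iff)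
      have pC: "pochhammer C m \<noteq> 0" for m using base by (auto simp: pochhammer_eq_0_iff)
      have iter: "pochhammer D m * S C = pochhammer (C - A) m * pochhammer (C - B) m * S (C + of_nat m)" for m
      proof (induction m)
        case (Suc m)
        have "(D + of_nat m) * S (C + of_nat m) = (C - A + of_nat m) * (C - B + of_nat m) * S (C + of_nat m + 1)"
          using rec[of "C + of_nat m"] * by (simp add: D_def algebra_simps)
        moreover have "pochhammer D (Suc m) * S C = (D + of_nat m) * (pochhammer D m * S C)"
          by (simp add: pochhammer_Suc mult_ac)
        ultimately have "pochhammer D (Suc m) * S C = pochhammer (C - A) m * pochhammer (C - B) m * 
                  ((C - A + of_nat m) * (C - B + of_nat m) * S (C + of_nat m + 1))"
          unfolding Suc.IH by (metis mult.left_commute)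
        thus ?case by (simp add: pochhammer_Suc mult_ac add_ac)
      qed simp
      define L where "L m = S (C + of_nat m) * Gamma (C + of_nat m)" for m
      have "L \<longlonglongrightarrow> 1"
        using inv_fact_limit[OF K', of C] by (simp add: S_def u_def L_def [abs_def])
      hence L: "(\<lambda>n. L (Suc n)) \<longlonglongrightarrow> 1" by (rule LIMSEQ_Suc)
      have "(\<lambda>n. rGamma_series (C - A) n * rGamma_series (C - B) n / (rGamma_series D n * rGamma_series C n) * rGamma C * L (Suc n))
        \<longlonglongrightarrow> rGamma (C - A) * rGamma (C - B) / (rGamma D * rGamma C) * rGamma C * 1"
        using D base by (intro tendsto_intros L) (auto simp: rGamma_eq_zero_iff)
      moreover have "eventually (\<lambda>n. rGamma_series (C - A) n * rGamma_series (C - B) n / (rGamma_series D n * rGamma_series C n) * rGamma C * L (Suc n) = S C) sequentially"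
        using eventually_gt_at_top[of 0]
      proof eventually_elim
        case (elim n)
        \<comment> \<open>The powers of n in the four Euler products cancel because (C - A) + (C -
          B) = D + C.\<close>
        have ee: "exp ((C - A) * of_real (ln (real n))) * exp ((C - B) * of_real (ln (real n))) = 
              exp (D * of_real (ln (real n))) * exp (C * complex_of_real (ln (real n)))"
          by (simp add: D_def exp_add [symmetric] algebra_simps)
        have q: "x1 / (fa * e1) * (x2 / (fa * e2)) / (x3 / (fa * e3) * (x4 / (fa * e4))) = x1 * x2 / (x3 * x4)"
          if "e1 * e2 = e3 * e4" "fa \<noteq> 0" "e1 \<noteq> 0" "e2 \<noteq> 0" "e3 \<noteq> 0" "e4 \<noteq> 0" for x1 x2 x3 x4 fa e1 e2 e3 e4 :: complex
        proof -
          have "x1 / (fa * e1) * (x2 / (fa * e2)) / (x3 / (fa * e3) * (x4 / (fa * e4))) = 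
                  (x1 * x2) * (e3 * e4) / ((x3 * x4) * (e1 * e2))"
            using that(2-) by (simp add: field_simps)
          thus ?thesis using that by simp
        qed
        have h1: "rGamma_series (C - A) n * rGamma_series (C - B) n / (rGamma_series D n * rGamma_series C n) =
           pochhammer (C - A) (Suc n) * pochhammer (C - B) (Suc n) / (pochhammer D (Suc n) * pochhammer C (Suc n))"
          unfolding rGamma_series_def using ee by (subst q) auto
        have h2: "rGamma C * Gamma (C + of_nat (Suc n)) = pochhammer C (Suc n)"
          using pochhammer_Gamma[OF base, of "Suc n"] by (simp add: rGamma_inverse_Gamma divide_inverse mult_ac)
        have "rGamma_series (C - A) n * rGamma_series (C - B) n / (rGamma_series D n * rGamma_series C n) * rGamma C * L (Suc n)
          = rGamma_series (C - A) n * rGamma_series (C - B) n / (rGamma_series D n * rGamma_series C n) * S (C + of_nat (Suc n)) *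
              (rGamma C * Gamma (C + of_nat (Suc n)))"
          by (simp only: L_def mult_ac)
        also have "\<dots> = (pochhammer (C - A) (Suc n) * pochhammer (C - B) (Suc n) * S (C + of_nat (Suc n))) / (pochhammer D (Suc n) * pochhammer C (Suc n)) * pochhammer C (Suc n)"
          unfolding h1 h2 by simp
        also have "\<dots> = S C" unfolding iter[symmetric] using pD pC by simp
        finally show ?case .
      qed
      ultimately have "(\<lambda>n::nat. S C) \<longlonglongrightarrow> rGamma (C - A) * rGamma (C - B) / (rGamma D * rGamma C) * rGamma C * 1"
        by (rule Lim_transform_eventually)
      hence "S C = rGamma (C - A) * rGamma (C - B) / (rGamma D * rGamma C) * rGamma C"
        by (simp add: LIMSEQ_const_iff)
      also have "\<dots> = Gamma D * rGamma (C - A) * rGamma (C - B)"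
        using base D by (simp add: rGamma_inverse_Gamma Gamma_eq_zero_iff field_simps)
      finally show "S C = Gamma (C - A - B) * rGamma (C - A) * rGamma (C - B)" by (simp add: D_def)
    qed
  qed
  moreover have "summable (\<lambda>k. u k * rGamma (C + of_nat k))"
    using assms by (intro summable_norm_cancel[OF inv_fact_summable[OF K']]) simp
  ultimately show ?thesis using assms by (simp add: sums_iff S_def u_def)
qed

section \<open>Inverse factorial series\<close>

text \<open>
  \<open>f(s) = \<Sum>\<^sub>n g\<^sub>n / \<Gamma>(\<psi> + s + n)\<close> for \<open>Re s > -\<alpha>\<close>, where \<open>g\<^sub>n / \<Gamma>(\<psi> + n) = O(n\<^sup>-\<^sup>\<alpha>\<^sup>-\<^sup>1 log\<^sup>l n)\<close>.
\<close>

definition inv_fact_repr ::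
  "real \<Rightarrow> nat \<Rightarrow> complex \<Rightarrow> (nat \<Rightarrow> complex) \<Rightarrow> (complex \<Rightarrow> complex) \<Rightarrow> bool" where
  "inv_fact_repr \<alpha> l \<psi> g f \<longleftrightarrow>
     (\<exists>C. \<forall>n. norm (g n) \<le> C * (fpow (Re \<psi> - 2 - \<alpha>) n * logp n ^ l)) \<and>
     (\<forall>s. Re s > - \<alpha> \<longrightarrow> (\<lambda>n. g n * rGamma (\<psi> + s + of_nat n)) sums f s)"

lemma inv_fact_reprD_bound:
  assumes "inv_fact_repr \<alpha> l \<psi> g f"
  obtains C where "C > 0" "\<And>n. norm (g n) \<le> C * (fpow (Re \<psi> - 2 - \<alpha>) n * logp n ^ l)"
proof -
  obtain C where C: "\<And>n. norm (g n) \<le> C * (fpow (Re \<psi> - 2 - \<alpha>) n * logp n ^ l)"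
    using assms by (auto simp: inv_fact_repr_def)
  have "norm (g n) \<le> max C 1 * (fpow (Re \<psi> - 2 - \<alpha>) n * logp n ^ l)" for n
    using C[of n] by (rule order_trans) (intro mult_right_mono, auto)
  thus ?thesis by (intro that[of "max C 1"]) auto
qed

lemma inv_fact_reprD_sums:
  "inv_fact_repr \<alpha> l \<psi> g f \<Longrightarrow> Re s > - \<alpha> \<Longrightarrow> (\<lambda>n. g n * rGamma (\<psi> + s + of_nat n)) sums f s"
  by (auto simp: inv_fact_repr_def)

lemma inv_fact_reprI:
  assumes "\<And>n. norm (g n) \<le> C * (fpow (Re \<psi> - 2 - \<alpha>) n * logp n ^ l)"
    and "\<And>s. Re s > - \<alpha> \<Longrightarrow> (\<lambda>n. g n * rGamma (\<psi> + s + of_nat n)) sums f s"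
  shows "inv_fact_repr \<alpha> l \<psi> g f"
  using assms unfolding inv_fact_repr_def by blast

lemma inv_fact_repr_cong:
  assumes "inv_fact_repr \<alpha> l \<psi> g f" "\<And>s. Re s > - \<alpha> \<Longrightarrow> f s = f' s"
  shows "inv_fact_repr \<alpha> l \<psi> g f'"
  using assms unfolding inv_fact_repr_def by auto

text \<open>A strict loss in the exponent absorbs every power of the logarithm, so l' is then
  arbitrary.\<close>

lemma inv_fact_repr_weaken:
  assumes R: "inv_fact_repr \<alpha> l \<psi> g f" and le: "\<alpha>' \<le> \<alpha>" "l \<le> l' \<or> \<alpha>' < \<alpha>"
  shows "inv_fact_repr \<alpha>' l' \<psi> g f"
proof -
  obtain C where C: "C > 0" "\<And>n. norm (g n) \<le> C * (fpow (Re \<psi> - 2 - \<alpha>) n * logp n ^ l)"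
    using inv_fact_reprD_bound[OF R] by blast
  have fp: "fpow (Re \<psi> - 2 - \<alpha>') n = fpow (Re \<psi> - 2 - \<alpha>) n * (real n + 1) powr (\<alpha> - \<alpha>')" for n
    unfolding fpow_mult_powr by (rule arg_cong2[where f = fpow]) auto
  have "\<exists>K>0. \<forall>n. logp n ^ l \<le> K * ((real n + 1) powr (\<alpha> - \<alpha>') * logp n ^ l')"
  proof (cases "\<alpha>' < \<alpha>")
    case True
    then obtain K where K: "K > 0" "\<And>x. x \<ge> 1 \<Longrightarrow> (1 + ln x) ^ l \<le> K * x powr (\<alpha> - \<alpha>')"
      using logp_power_le[of "\<alpha> - \<alpha>'" l] by auto
    have "logp n ^ l \<le> K * ((real n + 1) powr (\<alpha> - \<alpha>') * logp n ^ l')" for n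
    proof -
      have "logp n ^ l \<le> K * (real n + 1) powr (\<alpha> - \<alpha>')" using K(2)[of "real n + 1"] by simp
      also have "\<dots> \<le> K * (real n + 1) powr (\<alpha> - \<alpha>') * logp n ^ l'"
        using K(1) mult_left_mono[of 1 "logp n ^ l'" "K * (real n + 1) powr (\<alpha> - \<alpha>')"] by (simp add: one_le_power)
      finally show ?thesis by (simp add: mult_ac)
    qed
    thus ?thesis using K by blast
  next
    case False
    hence "\<alpha>' = \<alpha>" "l \<le> l'" using le by auto
    thus ?thesis by (intro exI[of _ 1]) (auto intro!: power_increasing)
  qed
  then obtain K where K: "K > 0" "\<And>n. logp n ^ l \<le> K * ((real n + 1) powr (\<alpha> - \<alpha>') * logp n ^ l')" by blast
  show ?thesis
  proof (rule inv_fact_reprI)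
    fix n
    have "norm (g n) \<le> C * (fpow (Re \<psi> - 2 - \<alpha>) n * (K * ((real n + 1) powr (\<alpha> - \<alpha>') * logp n ^ l')))"
      using C(1) by (intro order_trans[OF C(2)] mult_left_mono K) auto
    also have "\<dots> = (C * K) * (fpow (Re \<psi> - 2 - \<alpha>') n * logp n ^ l')" by (simp add: fp)
    finally show "norm (g n) \<le> (C * K) * (fpow (Re \<psi> - 2 - \<alpha>') n * logp n ^ l')" .
  next
    fix s assume "Re s > - \<alpha>'"
    thus "(\<lambda>n. g n * rGamma (\<psi> + s + of_nat n)) sums f s"
      using le by (intro inv_fact_reprD_sums[OF R]) auto
  qed
qed

lemma inv_fact_repr_lincomb:
  assumes R: "inv_fact_repr \<alpha> l \<psi> g f" and R': "inv_fact_repr \<alpha> l \<psi> g' f'"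
  shows "inv_fact_repr \<alpha> l \<psi> (\<lambda>n. x * g n + y * g' n) (\<lambda>s. x * f s + y * f' s)"
proof -
  obtain C where C: "C > 0" "\<And>n. norm (g n) \<le> C * (fpow (Re \<psi> - 2 - \<alpha>) n * logp n ^ l)"
    using inv_fact_reprD_bound[OF R] by blast
  obtain C' where C': "C' > 0" "\<And>n. norm (g' n) \<le> C' * (fpow (Re \<psi> - 2 - \<alpha>) n * logp n ^ l)"
    using inv_fact_reprD_bound[OF R'] by blast
  show ?thesis
  proof (rule inv_fact_reprI)
    fix n
    have "norm (x * g n + y * g' n) \<le> norm x * norm (g n) + norm y * norm (g' n)"
      by (metis norm_mult norm_triangle_ineq)
    also have "\<dots> \<le> norm x * (C * (fpow (Re \<psi> - 2 - \<alpha>) n * logp n ^ l)) + norm y * (C' * (fpow (Re \<psi> - 2 - \<alpha>) n * logp n ^ l))"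
      by (intro add_mono mult_left_mono C C') auto
    finally show "norm (x * g n + y * g' n) \<le> (norm x * C + norm y * C') * (fpow (Re \<psi> - 2 - \<alpha>) n * logp n ^ l)"
      by (simp add: algebra_simps)
  next
    fix s assume s: "Re s > - \<alpha>"
    have "(\<lambda>n. x * (g n * rGamma (\<psi> + s + of_nat n)) + y * (g' n * rGamma (\<psi> + s + of_nat n))) sums (x * f s + y * f' s)"
      by (intro sums_add sums_mult inv_fact_reprD_sums[OF R s] inv_fact_reprD_sums[OF R' s])
    thus "(\<lambda>n. (x * g n + y * g' n) * rGamma (\<psi> + s + of_nat n)) sums (x * f s + y * f' s)"
      by (simp add: algebra_simps)
  qed
qed

text \<open>The n-th term at psi is the (n + 1)-st term at psi - 1. Lowering psi by integers brings
  representations of different origin to a common psi, where they can be added.\<close>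

lemma inv_fact_repr_shift:
  assumes R: "inv_fact_repr \<alpha> l \<psi> g f"
  shows "inv_fact_repr \<alpha> l (\<psi> - 1) (\<lambda>n. if n = 0 then 0 else g (n - 1)) f"
proof -
  define e where "e = Re \<psi> - 3 - \<alpha>"
  obtain C where C: "C > 0" "\<And>n. norm (g n) \<le> C * (fpow (e + 1) n * logp n ^ l)"
    using inv_fact_reprD_bound[OF R] by (auto simp: e_def algebra_simps)
  define K where "K = 2 powr \<bar>e\<bar>"
  have K: "K > 0" by (simp add: K_def)
  show ?thesis
  proof (rule inv_fact_reprI)
    fix n
    have "norm (if n = 0 then 0 else g (n - 1)) \<le> (C * K) * (fpow e n * logp n ^ l)"
    proof (cases n)
      case (Suc m)
      have "norm (g m) \<le> C * (fpow (e + 1) m * logp m ^ l)" by (rule C)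
      also have "\<dots> \<le> C * ((K * fpow e (Suc m)) * logp (Suc m) ^ l)"
        using C(1) fpow_Suc_ge[of e m] by (intro mult_left_mono mult_mono power_mono) (auto simp: K_def)
      finally show ?thesis using Suc by (simp add: mult_ac)
    qed (use C K in auto)
    thus "norm (if n = 0 then 0 else g (n - 1)) \<le> (C * K) * (fpow (Re (\<psi> - 1) - 2 - \<alpha>) n * logp n ^ l)"
      by (simp add: e_def algebra_simps)
  next
    fix s assume s: "Re s > - \<alpha>"
    have "(\<lambda>n. (\<lambda>n. (if n = 0 then 0 else g (n - 1)) * rGamma (\<psi> - 1 + s + of_nat n)) (Suc n)) sums f s"
      using inv_fact_reprD_sums[OF R s] by (simp add: add_ac)
    from sums_Suc[OF this] show "(\<lambda>n. (if n = 0 then 0 else g (n - 1)) * rGamma (\<psi> - 1 + s + of_nat n)) sums f s"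
      by simp
  qed
qed

lemma inv_fact_repr_shift_iter:
  assumes R: "inv_fact_repr \<alpha> l \<psi> g f"
  shows "\<exists>g'. inv_fact_repr \<alpha> l (\<psi> - of_nat m) g' f"
proof (induction m)
  case (Suc m)
  thus ?case using inv_fact_repr_shift[of \<alpha> l "\<psi> - of_nat m" _ f] by (fastforce simp: algebra_simps)
qed (use R in auto)

section \<open>Uniqueness of the coefficients\<close>

lemma inv_fact_repr_zero_tail:
  assumes R: "inv_fact_repr \<alpha> l \<psi> g (\<lambda>_. 0)"
  shows "g 0 = 0" "inv_fact_repr \<alpha> l (\<psi> + 1) (\<lambda>n. g (Suc n)) (\<lambda>_. 0)"
proof -
  define e where "e = Re \<psi> - 2 - \<alpha>"
  obtain C where C: "C > 0" "\<And>n. norm (g n) \<le> C * (fpow e n * logp n ^ l)"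
    using inv_fact_reprD_bound[OF R] by (auto simp: e_def)
  have "(\<lambda>m. (\<Sum>n. g n * rGamma (\<psi> + of_nat m + of_nat n)) * Gamma (\<psi> + of_nat m)) \<longlonglongrightarrow> g 0"
    by (rule inv_fact_limit[OF C(2)])
  moreover have "eventually (\<lambda>m. (\<Sum>n. g n * rGamma (\<psi> + of_nat m + of_nat n)) * Gamma (\<psi> + of_nat m) = 0) sequentially"
  proof -
    have "eventually (\<lambda>m. real m > - \<alpha>) sequentially" by real_asymp
    thus ?thesis
    proof eventually_elim
      case (elim m)
      thus ?case using inv_fact_reprD_sums[OF R, of "of_nat m"] by (simp add: sums_iff)
    qed
  qed
  ultimately have "(\<lambda>m. 0) \<longlonglongrightarrow> g 0" by (rule Lim_transform_eventually)
  thus g0: "g 0 = 0" by (simp add: LIMSEQ_const_iff)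
  define K where "K = 2 powr \<bar>e\<bar>"
  have K: "K > 0" by (simp add: K_def)
  define L where "L = (1 + ln (2::real)) ^ l"
  have L: "logp (Suc n) ^ l \<le> L * logp n ^ l" for n
  proof -
    have "logp (Suc n) \<le> 1 + ln (2 * (real n + 1))" by simp
    also have "\<dots> = 1 + (ln 2 + ln (real n + 1))" by (subst ln_mult) auto
    also have "\<dots> \<le> (1 + ln 2) * logp n" by (simp add: algebra_simps)
    finally have "logp (Suc n) ^ l \<le> ((1 + ln 2) * logp n) ^ l" by (intro power_mono) auto
    thus ?thesis by (simp add: L_def power_mult_distrib)
  qed
  show "inv_fact_repr \<alpha> l (\<psi> + 1) (\<lambda>n. g (Suc n)) (\<lambda>_. 0)"
  proof (rule inv_fact_reprI)
    fix n
    have "norm (g (Suc n)) \<le> C * (fpow e (Suc n) * logp (Suc n) ^ l)" by (rule C)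
    also have "\<dots> \<le> C * ((K * fpow (e + 1) n) * (L * logp n ^ l))"
      using C(1) fpow_Suc_le[of e n] by (intro mult_left_mono mult_mono L) (auto simp: K_def)
    also have "\<dots> = (C * K * L) * (fpow (Re (\<psi> + 1) - 2 - \<alpha>) n * logp n ^ l)"
      by (simp add: e_def algebra_simps)
    finally show "norm (g (Suc n)) \<le> (C * K * L) * (fpow (Re (\<psi> + 1) - 2 - \<alpha>) n * logp n ^ l)" .
  next
    fix s assume s: "Re s > - \<alpha>"
    have "(\<lambda>n. g (Suc n) * rGamma (\<psi> + s + of_nat (Suc n))) sums 0"
      using inv_fact_reprD_sums[OF R s] g0
      by (subst sums_Suc_iff[of "\<lambda>n. g n * rGamma (\<psi> + s + of_nat n)"]) simp
    thus "(\<lambda>n. g (Suc n) * rGamma (\<psi> + 1 + s + of_nat n)) sums 0"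
      by (simp add: add_ac)
  qed
qed

text \<open>Dropping a vanishing leading coefficient turns the series at psi into one at psi + 1
  that still represents 0, so the coefficients vanish one after another.\<close>

lemma inv_fact_repr_zero:
  assumes "inv_fact_repr \<alpha> l \<psi> g (\<lambda>_. 0)"
  shows "g n = 0"
  using assms
proof (induction n arbitrary: \<psi> g)
  case 0
  thus ?case by (rule inv_fact_repr_zero_tail)
next
  case (Suc n)
  thus ?case using inv_fact_repr_zero_tail(2)[OF Suc.prems] by blast
qed

lemma inv_fact_repr_unique:
  assumes R: "inv_fact_repr \<alpha> l \<psi> g f" and R': "inv_fact_repr \<alpha>' l' \<psi> g' f'"
    and eq: "\<And>s. Re s > B \<Longrightarrow> f s = f' s"
  shows "g = g'"
proof
  fix n
  \<comment> \<open>Strictly below both exponents, so that both logarithms disappear and the series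
    can be subtracted; moreover Re s > - beta implies Re s > B, where the functions agree.\<close>
  define \<beta> where "\<beta> = min (min \<alpha> \<alpha>') (- B) - 1"
  have "inv_fact_repr \<beta> 0 \<psi> g f"
    by (rule inv_fact_repr_weaken[OF R]) (auto simp: \<beta>_def min_def)
  moreover have "inv_fact_repr \<beta> 0 \<psi> g' f'"
    by (rule inv_fact_repr_weaken[OF R']) (auto simp: \<beta>_def min_def)
  ultimately have "inv_fact_repr \<beta> 0 \<psi> (\<lambda>n. 1 * g n + (-1) * g' n) (\<lambda>s. 1 * f s + (-1) * f' s)"
    by (rule inv_fact_repr_lincomb)
  hence "inv_fact_repr \<beta> 0 \<psi> (\<lambda>n. 1 * g n + (-1) * g' n) (\<lambda>_. 0)"
    by (rule inv_fact_repr_cong) (use eq in \<open>auto simp: \<beta>_def\<close>)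
  from inv_fact_repr_zero[OF this, of n] show "g n = g' n" by simp
qed

section \<open>Multiplication and division by a linear factor\<close>

lemma inv_fact_repr_mult_linear:
  assumes R: "inv_fact_repr \<alpha> l \<psi> g f"
  shows "\<exists>g'. inv_fact_repr (\<alpha> - 1) l (\<psi> - 1) g' (\<lambda>s. (s + \<mu>) * f s)"
proof -
  define e where "e = Re \<psi> - 2 - \<alpha>"
  obtain C where C: "C > 0" "\<And>n. norm (g n) \<le> C * (fpow e n * logp n ^ l)"
    using inv_fact_reprD_bound[OF R] by (auto simp: e_def)
  \<comment> \<open>From s + mu = (psi - 1 + s + n) - (psi + n - 1 - mu), whose first bracket turns
    1/Gamma(psi + s + n) into 1/Gamma(psi - 1 + s + n).\<close>
  define h where "h n = - (\<psi> + of_nat n - 1 - \<mu>) * g n" for n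
  have "inv_fact_repr (\<alpha> - 1) l (\<psi> - 1) g (\<lambda>s. \<Sum>n. g n * rGamma (\<psi> - 1 + s + of_nat n))"
  proof (rule inv_fact_reprI)
    show "norm (g n) \<le> C * (fpow (Re (\<psi> - 1) - 2 - (\<alpha> - 1)) n * logp n ^ l)" for n
      using C(2)[of n] by (simp add: e_def algebra_simps)
    show "(\<lambda>n. g n * rGamma (\<psi> - 1 + s + of_nat n)) sums (\<Sum>n. g n * rGamma (\<psi> - 1 + s + of_nat n))"
      if "Re s > - (\<alpha> - 1)" for s
      using that by (intro summable_sums summable_norm_cancel[OF inv_fact_summable[OF C(2)]]) (simp add: e_def)
  qed
  moreover have "inv_fact_repr (\<alpha> - 1) l \<psi> h (\<lambda>s. \<Sum>n. h n * rGamma (\<psi> + s + of_nat n))"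
  proof -
    define D where "D = norm (\<psi> - 1 - \<mu>) + 1"
    have b: "norm (h n) \<le> (D * C) * (fpow (e + 1) n * logp n ^ l)" for n
    proof -
      have "norm (\<psi> + of_nat n - 1 - \<mu>) \<le> norm (\<psi> - 1 - \<mu>) + real n"
        using norm_triangle_ineq[of "\<psi> - 1 - \<mu>" "of_nat n"] by (simp add: algebra_simps)
      also have "\<dots> \<le> D * (real n + 1)" by (simp add: D_def algebra_simps)
      finally have "norm (h n) \<le> (D * (real n + 1)) * (C * (fpow e n * logp n ^ l))"
        unfolding h_def norm_mult norm_minus_cancel by (intro mult_mono C) (auto simp: D_def)
      thus ?thesis by (simp add: fpow_def powr_add mult_ac)
    qed
    show ?thesis
    proof (rule inv_fact_reprI)
      show "norm (h n) \<le> (D * C) * (fpow (Re \<psi> - 2 - (\<alpha> - 1)) n * logp n ^ l)" for n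
        using b[of n] by (simp add: e_def algebra_simps)
      show "(\<lambda>n. h n * rGamma (\<psi> + s + of_nat n)) sums (\<Sum>n. h n * rGamma (\<psi> + s + of_nat n))"
        if "Re s > - (\<alpha> - 1)" for s
        using that by (intro summable_sums summable_norm_cancel[OF inv_fact_summable[OF b]]) (simp add: e_def)
    qed
  qed
  note h = this
  note inv_fact_repr_lincomb[OF calculation inv_fact_repr_shift[OF h], of 1 1]
  then have *: "inv_fact_repr (\<alpha> - 1) l (\<psi> - 1) (\<lambda>n. 1 * g n + 1 * (if n = 0 then 0 else h (n - 1)))
       (\<lambda>s. 1 * (\<Sum>n. g n * rGamma (\<psi> - 1 + s + of_nat n)) + 1 * (\<Sum>n. h n * rGamma (\<psi> + s + of_nat n)))"
    (is "inv_fact_repr _ _ _ ?g' _") .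
  have "inv_fact_repr (\<alpha> - 1) l (\<psi> - 1) ?g' (\<lambda>s. (s + \<mu>) * f s)"
  proof (rule inv_fact_repr_cong[OF *])
    fix s assume s: "Re s > - (\<alpha> - 1)"
    have "(\<lambda>n. g n * rGamma (\<psi> - 1 + s + of_nat n)) sums (\<Sum>n. g n * rGamma (\<psi> - 1 + s + of_nat n))"
      using s by (intro summable_sums summable_norm_cancel[OF inv_fact_summable[OF C(2)]]) (simp add: e_def)
    moreover have "(\<lambda>n. h n * rGamma (\<psi> + s + of_nat n)) sums (\<Sum>n. h n * rGamma (\<psi> + s + of_nat n))"
      by (rule inv_fact_reprD_sums[OF h s])
    ultimately have "(\<lambda>n. g n * rGamma (\<psi> - 1 + s + of_nat n) + h n * rGamma (\<psi> + s + of_nat n)) sums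
       ((\<Sum>n. g n * rGamma (\<psi> - 1 + s + of_nat n)) + (\<Sum>n. h n * rGamma (\<psi> + s + of_nat n)))"
      by (rule sums_add)
    moreover have "g n * rGamma (\<psi> - 1 + s + of_nat n) + h n * rGamma (\<psi> + s + of_nat n) = (s + \<mu>) * (g n * rGamma (\<psi> + s + of_nat n))" for n
    proof -
      have 1: "rGamma (\<psi> - 1 + s + of_nat n) = (\<psi> - 1 + s + of_nat n) * rGamma (\<psi> + s + of_nat n)"
        using rGamma_plus1[of "\<psi> - 1 + s + of_nat n"] by (simp add: algebra_simps)
      show ?thesis unfolding 1 h_def by (simp add: algebra_simps)
    qed
    moreover have "(\<lambda>n. (s + \<mu>) * (g n * rGamma (\<psi> + s + of_nat n))) sums ((s + \<mu>) * f s)"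
      using s by (intro sums_mult inv_fact_reprD_sums[OF R]) auto
    ultimately show "1 * (\<Sum>n. g n * rGamma (\<psi> - 1 + s + of_nat n)) + 1 * (\<Sum>n. h n * rGamma (\<psi> + s + of_nat n)) = (s + \<mu>) * f s"
      by (simp add: sums_iff)
  qed
  thus ?thesis by blast
qed

lemma powr_diff_mvt:
  fixes a r :: real
  assumes "a > 0"
  obtains \<xi> where "a < \<xi>" "\<xi> < a + 1" "(a + 1) powr r - a powr r = r * \<xi> powr (r - 1)"
proof -
  have "\<exists>\<xi>>a. \<xi> < a + 1 \<and> (a + 1) powr r - a powr r = (a + 1 - a) * (r * \<xi> powr (r - 1))"
    using assms by (intro MVT2) (auto intro!: has_real_derivative_powr)
  thus ?thesis using that by auto
qed

text \<open>For delta >= 1 the last term is the largest; otherwise the terms decrease and are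
  compared with the increments of x^delta / delta.\<close>

lemma sum_powr_le:
  fixes \<delta> :: real
  assumes "\<delta> > 0"
  shows "(\<Sum>j\<le>n. (real j + 1) powr (\<delta> - 1)) \<le> max 1 (1 / \<delta>) * (real n + 1) powr \<delta>"
proof (cases "\<delta> \<ge> 1")
  case True
  have "(\<Sum>j\<le>n. (real j + 1) powr (\<delta> - 1)) \<le> (\<Sum>j\<le>n. (real n + 1) powr (\<delta> - 1))"
    using True by (intro sum_mono powr_mono2) auto
  also have "\<dots> = 1 * (real n + 1) powr \<delta>" by (simp add: powr_diff add.commute)
  also have "\<dots> \<le> max 1 (1 / \<delta>) * (real n + 1) powr \<delta>" by (intro mult_right_mono) auto
  finally show ?thesis .
next
  case False
  have "(\<Sum>j\<le>n. (real j + 1) powr (\<delta> - 1)) \<le> (1 / \<delta>) * (real n + 1) powr \<delta>"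
  proof (induction n)
    case 0
    show ?case using False assms by simp
  next
    case (Suc n)
    obtain \<xi> where \<xi>: "real n + 1 < \<xi>" "\<xi> < real n + 1 + 1" "(real n + 1 + 1) powr \<delta> - (real n + 1) powr \<delta> = \<delta> * \<xi> powr (\<delta> - 1)"
      using powr_diff_mvt[of "real n + 1" \<delta>] by auto
    have "(real (Suc n) + 1) powr (\<delta> - 1) \<le> \<xi> powr (\<delta> - 1)"
      using \<xi> False by (intro powr_mono2') auto
    also have "\<dots> = (1 / \<delta>) * ((real (Suc n) + 1) powr \<delta> - (real n + 1) powr \<delta>)"
      using \<xi>(3) assms by (simp add: field_simps)
    finally show ?case using Suc by (simp add: algebra_simps)
  qed
  also have "\<dots> \<le> max 1 (1 / \<delta>) * (real n + 1) powr \<delta>" by (intro mult_right_mono) auto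
  finally show ?thesis .
qed

text \<open>Away from poles the new coefficients are Gamma(psi - mu + n) times the partial sums of
  g_j / Gamma(psi - mu + j), whose terms have size j^(Re mu - alpha - 1) log^l j. For Re mu < alpha
  these sums converge and the logarithms disappear; at equality they gain one logarithm; for Re mu >
  alpha they grow by just the power that preserves alpha.\<close>

lemma inv_fact_repr_divide_linear:
  assumes R: "inv_fact_repr \<alpha> l \<psi> g f"
    and l': "Re \<mu> < \<alpha> \<and> \<beta> = Re \<mu> \<and> l' = 0 \<or> Re \<mu> = \<alpha> \<and> \<beta> = \<alpha> \<and> l' = Suc l \<or> Re \<mu> > \<alpha> \<and> \<beta> = \<alpha> \<and> l' = l"
  shows "\<exists>g'. inv_fact_repr \<beta> l' (\<psi> + 1) g' (\<lambda>s. f s / (s + \<mu>))"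
proof -
  define e where "e = Re \<psi> - 2 - \<alpha>"
  define x where "x = Re (\<psi> - \<mu>)"
  obtain C where C: "C > 0" "\<And>n. norm (g n) \<le> C * (fpow e n * logp n ^ l)"
    using inv_fact_reprD_bound[OF R] by (auto simp: e_def)
  obtain D where D: "D > 0" "\<And>j k. norm (pochhammer (\<psi> - \<mu> + of_nat j) k) \<le> D * (fpow (x - 1) (j + k) / fpow (x - 1) j)"
    using norm_pochhammer_shift_le[of "\<psi> - \<mu>"] unfolding x_def by blast
  \<comment> \<open>Solves u_(n+1) = g_(n+1) + (psi - mu + n) u_n. Pochhammer symbols replace the
    Gamma quotients, so poles of Gamma(psi - mu + j) do no harm.\<close>
  define u where "u n = (\<Sum>j\<le>n. g j * pochhammer (\<psi> - \<mu> + of_nat j) (n - j))" for n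
  have u0: "u 0 = g 0" by (simp add: u_def)
  have uS: "u (Suc n) = g (Suc n) + (\<psi> - \<mu> + of_nat n) * u n" for n
  proof -
    have "pochhammer (\<psi> - \<mu> + of_nat j) (Suc n - j) = (\<psi> - \<mu> + of_nat n) * pochhammer (\<psi> - \<mu> + of_nat j) (n - j)" if "j \<le> n" for j
      using that by (simp add: Suc_diff_le pochhammer_Suc of_nat_diff)
    hence "(\<Sum>j\<le>n. g j * pochhammer (\<psi> - \<mu> + of_nat j) (Suc n - j)) = (\<psi> - \<mu> + of_nat n) * u n"
      by (simp add: u_def sum_distrib_left mult_ac)
    thus ?thesis by (simp add: u_def)
  qed
  have "\<exists>K>0. \<forall>n. (\<Sum>j\<le>n. (real j + 1) powr (Re \<mu> - \<alpha> - 1) * logp j ^ l) \<le> K * ((real n + 1) powr (Re \<mu> - \<beta>) * logp n ^ l')"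
    using l'
  proof (elim disjE)
    assume *: "Re \<mu> < \<alpha> \<and> \<beta> = Re \<mu> \<and> l' = 0"
    have s: "summable (\<lambda>j. (real j + 1) powr (Re \<mu> - \<alpha> - 1) * logp j ^ l)"
      using * by (intro summable_powr_logp) auto
    have "(\<Sum>j\<le>n. (real j + 1) powr (Re \<mu> - \<alpha> - 1) * logp j ^ l) \<le> max 1 (\<Sum>j. (real j + 1) powr (Re \<mu> - \<alpha> - 1) * logp j ^ l) * ((real n + 1) powr (Re \<mu> - \<beta>) * logp n ^ l')" for n
      using sum_le_suminf[OF s, of "{..n}"] * by auto
    thus ?thesis by (intro exI[of _ "max 1 (\<Sum>j. (real j + 1) powr (Re \<mu> - \<alpha> - 1) * logp j ^ l)"]) auto
  next
    assume *: "Re \<mu> > \<alpha> \<and> \<beta> = \<alpha> \<and> l' = l"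
    have "(\<Sum>j\<le>n. (real j + 1) powr (Re \<mu> - \<alpha> - 1) * logp j ^ l) \<le> max 1 (1 / (Re \<mu> - \<alpha>)) * ((real n + 1) powr (Re \<mu> - \<beta>) * logp n ^ l')" for n
    proof -
      have "(\<Sum>j\<le>n. (real j + 1) powr (Re \<mu> - \<alpha> - 1) * logp j ^ l) \<le> (\<Sum>j\<le>n. (real j + 1) powr (Re \<mu> - \<alpha> - 1) * logp n ^ l)"
        by (intro sum_mono mult_mono power_mono) auto
      also have "\<dots> = (\<Sum>j\<le>n. (real j + 1) powr (Re \<mu> - \<alpha> - 1)) * logp n ^ l" by (simp add: sum_distrib_right)
      also have "\<dots> \<le> (max 1 (1 / (Re \<mu> - \<alpha>)) * (real n + 1) powr (Re \<mu> - \<alpha>)) * logp n ^ l"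
        using * by (intro mult_right_mono sum_powr_le) auto
      finally show ?thesis using * by (simp add: mult_ac)
    qed
    thus ?thesis by (intro exI[of _ "max 1 (1 / (Re \<mu> - \<alpha>))"]) auto
  next
    assume *: "Re \<mu> = \<alpha> \<and> \<beta> = \<alpha> \<and> l' = Suc l"
    have harm: "(\<Sum>j\<le>n. 1 / (real j + 1)) \<le> logp n" for n
    proof (induction n)
      case (Suc n)
      have "1 / (real (Suc n) + 1) \<le> ln (real (Suc n) + 1) - ln (real n + 1)"
      proof -
        have "ln ((real n + 1) / (real n + 2)) \<le> (real n + 1) / (real n + 2) - 1"
          by (intro ln_le_minus_one) auto
        also have "(real n + 1) / (real n + 2) - 1 = - (1 / (real n + 2))" by (simp add: field_simps)
        finally show ?thesis by (simp add: ln_div add_ac)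
      qed
      thus ?case using Suc by simp
    qed auto
    have "(\<Sum>j\<le>n. (real j + 1) powr (Re \<mu> - \<alpha> - 1) * logp j ^ l) \<le> 1 * ((real n + 1) powr (Re \<mu> - \<beta>) * logp n ^ l')" for n
    proof -
      have "(\<Sum>j\<le>n. (real j + 1) powr (Re \<mu> - \<alpha> - 1) * logp j ^ l) \<le> (\<Sum>j\<le>n. 1 / (real j + 1) * logp n ^ l)"
        using * by (intro sum_mono mult_mono power_mono) (auto simp: powr_minus field_simps)
      also have "\<dots> = (\<Sum>j\<le>n. 1 / (real j + 1)) * logp n ^ l" by (simp add: sum_distrib_right)
      also have "\<dots> \<le> logp n * logp n ^ l" by (intro mult_right_mono harm) auto
      finally show ?thesis using * by simp
    qed
    thus ?thesis by (intro exI[of _ 1]) auto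
  qed
  then obtain K where K: "K > 0" "\<And>n. (\<Sum>j\<le>n. (real j + 1) powr (Re \<mu> - \<alpha> - 1) * logp j ^ l) \<le> K * ((real n + 1) powr (Re \<mu> - \<beta>) * logp n ^ l')"
    by blast
  have ub: "norm (u n) \<le> (C * D * K) * (fpow (x - 1 + (Re \<mu> - \<beta>)) n * logp n ^ l')" for n
  proof -
    have "norm (u n) \<le> (\<Sum>j\<le>n. norm (g j) * norm (pochhammer (\<psi> - \<mu> + of_nat j) (n - j)))"
      unfolding u_def by (rule order_trans[OF norm_sum]) (simp add: norm_mult)
    also have "\<dots> \<le> (\<Sum>j\<le>n. (C * (fpow e j * logp j ^ l)) * (D * (fpow (x - 1) n / fpow (x - 1) j)))"
    proof (intro sum_mono mult_mono C)
      fix j assume "j \<in> {..n}"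
      thus "norm (pochhammer (\<psi> - \<mu> + of_nat j) (n - j)) \<le> D * (fpow (x - 1) n / fpow (x - 1) j)"
        using D(2)[of j "n - j"] by simp
    qed (use C D in auto)
    also have "\<dots> = (\<Sum>j\<le>n. (C * D * fpow (x - 1) n) * ((fpow e j / fpow (x - 1) j) * logp j ^ l))"
      by (intro sum.cong) auto
    also have "\<dots> = (C * D * fpow (x - 1) n) * (\<Sum>j\<le>n. (real j + 1) powr (Re \<mu> - \<alpha> - 1) * logp j ^ l)"
      unfolding fpow_divide sum_distrib_left by (simp add: e_def x_def algebra_simps)
    also have "\<dots> \<le> (C * D * fpow (x - 1) n) * (K * ((real n + 1) powr (Re \<mu> - \<beta>) * logp n ^ l'))"
      using C D by (intro mult_left_mono K) auto
    finally show ?thesis by (simp add: fpow_mult_powr [symmetric] mult_ac)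
  qed
  have "inv_fact_repr \<beta> l' (\<psi> + 1) u (\<lambda>s. f s / (s + \<mu>))"
  proof (rule inv_fact_reprI)
    show "norm (u n) \<le> (C * D * K) * (fpow (Re (\<psi> + 1) - 2 - \<beta>) n * logp n ^ l')" for n
      using ub[of n] by (simp add: x_def algebra_simps)
  next
    fix s assume s: "Re s > - \<beta>"
    have nz: "s + \<mu> \<noteq> 0" using s l' by (auto simp: complex_eq_iff)
    \<comment> \<open>Summation by parts: with s + mu = (psi + s + n) - (psi - mu + n) the
      recurrence for \<open>u\<close> returns the partial sums for g up to one boundary
      term.\<close>
    have part: "(s + \<mu>) * (\<Sum>n<N. u n * rGamma (\<psi> + 1 + s + of_nat n)) = 
             (\<Sum>n<Suc N. g n * rGamma (\<psi> + s + of_nat n)) - u N * rGamma (\<psi> + s + of_nat N)" for N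
    proof (induction N)
      case (Suc N)
      have 1: "rGamma (\<psi> + s + of_nat N) = (\<psi> + s + of_nat N) * rGamma (\<psi> + 1 + s + of_nat N)"
        using rGamma_plus1[of "\<psi> + s + of_nat N"] by (simp add: algebra_simps)
      have "(s + \<mu>) * (\<Sum>n<Suc N. u n * rGamma (\<psi> + 1 + s + of_nat n)) = 
            (\<Sum>n<Suc N. g n * rGamma (\<psi> + s + of_nat n)) - u N * rGamma (\<psi> + s + of_nat N) +
              (s + \<mu>) * (u N * rGamma (\<psi> + 1 + s + of_nat N))"
        using Suc by (simp add: algebra_simps)
      also have "\<dots> = (\<Sum>n<Suc N. g n * rGamma (\<psi> + s + of_nat n)) - (\<psi> - \<mu> + of_nat N) * u N * rGamma (\<psi> + 1 + s + of_nat N)"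
        unfolding 1 by (simp add: algebra_simps)
      also have "\<dots> = (\<Sum>n<Suc (Suc N). g n * rGamma (\<psi> + s + of_nat n)) - u (Suc N) * rGamma (\<psi> + s + of_nat (Suc N))"
        unfolding uS by (simp add: algebra_simps)
      finally show ?case .
    qed (simp add: u0)
    have "(\<lambda>N. u N * rGamma (\<psi> + s + of_nat N)) \<longlonglongrightarrow> 0"
    proof -
      obtain M where M: "\<And>n. norm (u n * rGamma (\<psi> + s + of_nat n)) \<le> M * ((real n + 1) powr (x - 1 + (Re \<mu> - \<beta>) + 1 - Re (\<psi> + s)) * logp n ^ l')"
        using inv_fact_term_bound[OF ub] by blast
      \<comment> \<open>The boundary term decays like N^(-epsilon) up to logarithms; half of epsilon
        pays for them.\<close>
      define \<epsilon> where "\<epsilon> = Re s + \<beta>"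
      have \<epsilon>: "\<epsilon> > 0" using s by (simp add: \<epsilon>_def)
      obtain K1 where K1: "K1 > 0" "\<And>y. y \<ge> 1 \<Longrightarrow> (1 + ln y) ^ l' \<le> K1 * y powr (\<epsilon> / 2)"
        using logp_power_le[of "\<epsilon> / 2" l'] \<epsilon> by auto
      have "norm (u n * rGamma (\<psi> + s + of_nat n)) \<le> (\<bar>M\<bar> * K1) * (real n + 1) powr (- (\<epsilon> / 2))" for n
      proof -
        have "norm (u n * rGamma (\<psi> + s + of_nat n)) \<le> \<bar>M\<bar> * ((real n + 1) powr (- \<epsilon>) * logp n ^ l')"
          using M[of n] by (rule order_trans) (auto simp: x_def \<epsilon>_def algebra_simps intro!: mult_right_mono)
        also have "\<dots> \<le> \<bar>M\<bar> * ((real n + 1) powr (- \<epsilon>) * (K1 * (real n + 1) powr (\<epsilon> / 2)))"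
          using K1(2)[of "real n + 1"] by (intro mult_left_mono) auto
        also have "\<dots> = (\<bar>M\<bar> * K1) * ((real n + 1) powr (- \<epsilon>) * (real n + 1) powr (\<epsilon> / 2))" by simp
        also have "(real n + 1) powr (- \<epsilon>) * (real n + 1) powr (\<epsilon> / 2) = (real n + 1) powr (- (\<epsilon> / 2))"
          unfolding powr_add [symmetric] by simp
        finally show ?thesis .
      qed
      moreover have "(\<lambda>n. (\<bar>M\<bar> * K1) * (real n + 1) powr (- (\<epsilon> / 2))) \<longlonglongrightarrow> (\<bar>M\<bar> * K1) * 0"
        using \<epsilon> by (intro tendsto_mult tendsto_const tendsto_neg_powr) (auto intro!: filterlim_tendsto_add_at_top filterlim_real_sequentially simp: add.commute[of _ 1])
      ultimately show ?thesis
        by (intro Lim_null_comparison[of "\<lambda>N. u N * rGamma (\<psi> + s + of_nat N)"]) auto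
    qed
    moreover have "(\<lambda>N. \<Sum>n<Suc N. g n * rGamma (\<psi> + s + of_nat n)) \<longlonglongrightarrow> f s"
    proof -
      have "(\<lambda>n. g n * rGamma (\<psi> + s + of_nat n)) sums f s"
        using s l' by (intro inv_fact_reprD_sums[OF R]) auto
      thus ?thesis unfolding sums_def by (rule LIMSEQ_Suc)
    qed
    ultimately have "(\<lambda>N. inverse (s + \<mu>) * ((\<Sum>n<Suc N. g n * rGamma (\<psi> + s + of_nat n)) - u N * rGamma (\<psi> + s + of_nat N))) \<longlonglongrightarrow> inverse (s + \<mu>) * (f s - 0)"
      by (intro tendsto_intros)
    thus "(\<lambda>n. u n * rGamma (\<psi> + 1 + s + of_nat n)) sums (f s / (s + \<mu>))"
      unfolding part[symmetric] sums_def mult.assoc[symmetric] using nz by (simp add: divide_inverse mult.commute)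
  qed
  thus ?thesis by blast
qed

section \<open>Norlund's coefficients\<close>

lemma inv_fact_repr_rGamma:
  "inv_fact_repr \<alpha> l \<beta> (\<lambda>n. if n = 0 then 1 else 0) (\<lambda>s. rGamma (\<beta> + s))"
proof (rule inv_fact_reprI)
  show "norm (if n = 0 then 1 else 0 :: complex) \<le> 1 * (fpow (Re \<beta> - 2 - \<alpha>) n * logp n ^ l)" for n
    by (auto simp: fpow_def)
  show "(\<lambda>n. (if n = 0 then 1 else 0) * rGamma (\<beta> + s + of_nat n)) sums rGamma (\<beta> + s)" for s
    using sums_If_finite_set[of "{0}" "\<lambda>n. rGamma (\<beta> + s + of_nat n)"] by (simp add: if_distrib if_distribR cong: if_cong)
qed

text \<open>
  The loss in \<open>\<alpha>\<close> depends on \<open>b\<close> and \<open>c\<close> only through \<open>c - b\<close>, so it does not grow when both are shifted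
  by the same large integer.
\<close>

lemma inv_fact_repr_Gamma_quotient:
  fixes b c \<psi> :: complex
  assumes R: "inv_fact_repr \<alpha>' 0 \<psi> g f"
  defines "\<tau> \<equiv> \<psi> - c"
  defines "h \<equiv> \<lambda>n. \<Sum>j\<le>n. g j * (pochhammer (\<tau> + of_nat j) (n - j) / fact (n - j) * pochhammer (b - c) (n - j))"
  defines "\<alpha> \<equiv> min \<alpha>' (Re c - 1) - 1 - max 0 (Re (c - b))"
  shows "inv_fact_repr \<alpha> 0 (\<tau> + b) h (\<lambda>s. f s * Gamma (c + s) * rGamma (b + s))"
proof -
  define x where "x = Re \<tau>"
  define e where "e = Re \<psi> - 2 - \<alpha>'"
  define u where "u = max 0 (Re c - 1 - \<alpha>')"
  define v where "v = max 0 (Re (b - c))"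
  \<comment> \<open>Here \<open>u\<close> is the loss due to g and \<open>v\<close> that due to the
    Pochhammer symbol of b - c. Both are cut off at 0, which makes the powers below monotone, so
    that j and k may be replaced by j + k.\<close>
  have \<alpha>_eq: "\<alpha> = Re b - 2 - u - v" by (auto simp: \<alpha>_def u_def v_def max_def min_def)
  obtain C0 where C0: "C0 > 0" "\<And>n. norm (g n) \<le> C0 * fpow e n"
    using inv_fact_reprD_bound[OF R] by (auto simp: e_def)
  obtain C1 where C1: "C1 > 0" "\<And>j k. norm (pochhammer (\<tau> + of_nat j) k) \<le> C1 * (fpow (x - 1) (j + k) / fpow (x - 1) j)"
    using norm_pochhammer_shift_le[of \<tau>] unfolding x_def by blast
  obtain C2 where C2: "C2 > 0" "\<And>k. norm (pochhammer (b - c) k) \<le> C2 * fpow (Re (b - c) - 1) k"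
    using norm_pochhammer_le[of "b - c"] by blast
  define t where "t j k = g j * (pochhammer (\<tau> + of_nat j) k / fact k * pochhammer (b - c) k)" for j k
  define K where "K = C0 * C1 * C2"
  have K: "K > 0" using C0 C1 C2 by (simp add: K_def)
  have tb: "norm (t j k) \<le> K * fpow (x - 1 + u + v) (j + k)" for j k
  proof -
    have "norm (t j k) \<le> (C0 * fpow e j) * ((C1 * (fpow (x - 1) (j + k) / fpow (x - 1) j)) / fact k * (C2 * fpow (Re (b - c) - 1) k))"
      unfolding t_def norm_mult norm_divide norm_fact using C0 C1 C2
      by (intro mult_mono divide_right_mono) auto
    also have "\<dots> = K * ((fpow e j / fpow (x - 1) j) * (fpow (Re (b - c) - 1) k / fact k) * fpow (x - 1) (j + k))"
      by (simp add: K_def)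
    also have "fpow e j / fpow (x - 1) j = (real j + 1) powr (Re c - 1 - \<alpha>')"
      unfolding fpow_divide by (simp add: e_def x_def \<tau>_def algebra_simps)
    also have "fpow (Re (b - c) - 1) k / fact k = (real k + 1) powr (Re (b - c) - 1)"
      by (simp add: fpow_def)
    also have "K * ((real j + 1) powr (Re c - 1 - \<alpha>') * (real k + 1) powr (Re (b - c) - 1) * fpow (x - 1) (j + k))
       \<le> K * ((real (j + k) + 1) powr u * (real (j + k) + 1) powr v * fpow (x - 1) (j + k))"
    proof (intro mult_left_mono mult_right_mono mult_mono)
      have "(real j + 1) powr (Re c - 1 - \<alpha>') \<le> (real j + 1) powr u"
        by (intro powr_mono) (auto simp: u_def)
      also have "\<dots> \<le> (real (j + k) + 1) powr u"
        by (intro powr_mono2) (auto simp: u_def)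
      finally show "(real j + 1) powr (Re c - 1 - \<alpha>') \<le> (real (j + k) + 1) powr u" .
      have "(real k + 1) powr (Re (b - c) - 1) \<le> (real k + 1) powr v"
        by (intro powr_mono) (auto simp: v_def)
      also have "\<dots> \<le> (real (j + k) + 1) powr v"
        by (intro powr_mono2) (auto simp: v_def)
      finally show "(real k + 1) powr (Re (b - c) - 1) \<le> (real (j + k) + 1) powr v" .
    qed (use K in auto)
    also have "(real (j + k) + 1) powr u * (real (j + k) + 1) powr v * fpow (x - 1) (j + k) = fpow (x - 1 + u + v) (j + k)"
      by (simp add: fpow_def powr_add mult_ac)
    finally show ?thesis .
  qed
  have h_eq: "h n = (\<Sum>j\<le>n. t j (n - j))" for n by (simp add: h_def t_def)
  show ?thesis
  proof (rule inv_fact_reprI)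
    fix n
    have "norm (h n) \<le> (\<Sum>j\<le>n. norm (t j (n - j)))" unfolding h_eq by (rule norm_sum)
    also have "\<dots> \<le> (\<Sum>j\<le>n. K * fpow (x - 1 + u + v) n)"
    proof (intro sum_mono)
      fix j assume "j \<in> {..n}"
      thus "norm (t j (n - j)) \<le> K * fpow (x - 1 + u + v) n" using tb[of j "n - j"] by simp
    qed
    also have "\<dots> = K * fpow (x - 1 + u + v + 1) n"
      by (subst fpow_plus1) (simp add: add_ac)
    also have "x - 1 + u + v + 1 = Re (\<tau> + b) - 2 - \<alpha>" by (simp add: \<alpha>_eq x_def)
    finally show "norm (h n) \<le> K * (fpow (Re (\<tau> + b) - 2 - \<alpha>) n * logp n ^ 0)" by simp
  next
    fix s assume s: "Re s > - \<alpha>"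
    define w where "w = \<tau> + b + s"
    obtain D where D: "D > 0" "\<And>n. norm (rGamma (w + of_nat n)) * fpow (Re w - 1) n \<le> D"
      using norm_rGamma_le[of w] by blast
    define T where "T j k = t j k * rGamma (w + of_nat (j + k))" for j k
    define Q where "Q = - 1 - \<alpha> - Re s"
    have Tb: "norm (T j k) \<le> K * D * (real (j + k) + 1) powr (Q - 1)" for j k
    proof -
      have "norm (T j k) \<le> (K * fpow (x - 1 + u + v) (j + k)) * (D / fpow (Re w - 1) (j + k))"
        unfolding T_def norm_mult using D(2)[of "j + k"] K
        by (intro mult_mono tb) (auto simp: pos_le_divide_eq)
      also have "\<dots> = K * D * (fpow (x - 1 + u + v) (j + k) / fpow (Re w - 1) (j + k))" by simp
      also have "fpow (x - 1 + u + v) (j + k) / fpow (Re w - 1) (j + k) = (real (j + k) + 1) powr (Q - 1)"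
        unfolding fpow_divide by (simp add: Q_def \<alpha>_eq w_def x_def algebra_simps)
      finally show ?thesis .
    qed
    \<comment> \<open>The diagonals j + k = n give h n, the rows of fixed j give Gauss series. The
      two sums agree by absolute convergence: diagonal n has n + 1 terms of size (n + 1)^(Q - 1),
      and Q < -1.\<close>
    define F where "F = (\<lambda>(n, j). T j (n - j))"
    have "(\<lambda>x. norm (F x)) summable_on Sigma UNIV (\<lambda>n. {..n})"
      unfolding Infinite_Sum.abs_summable_on_Sigma_iff
    proof (intro conjI ballI)
      have "summable (\<lambda>n. \<Sum>j\<le>n. norm (F (n, j)))"
      proof (rule summable_comparison_test')
        show "summable (\<lambda>n. K * D * (real n + 1) powr Q)"
          using s by (intro summable_mult summable_powr_Suc) (simp add: Q_def)
        fix n :: nat assume "n \<ge> 0"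
        have "(\<Sum>j\<le>n. norm (F (n, j))) \<le> (\<Sum>j\<le>n. K * D * (real n + 1) powr (Q - 1))"
        proof (intro sum_mono)
          fix j assume "j \<in> {..n}"
          thus "norm (F (n, j)) \<le> K * D * (real n + 1) powr (Q - 1)" using Tb[of j "n - j"] by (simp add: F_def)
        qed
        also have "\<dots> = K * D * (real n + 1) powr Q" by (simp add: powr_diff add.commute)
        finally show "norm (\<Sum>j\<le>n. norm (F (n, j))) \<le> K * D * (real n + 1) powr Q" by (simp add: sum_nonneg)
      qed
      thus "(\<lambda>n. norm (\<Sum>\<^sub>\<infinity>j\<in>{..n}. norm (F (n, j)))) summable_on UNIV"
        by (subst summable_on_UNIV_nonneg_real_iff) (auto simp: sum_nonneg)
    qed auto
    hence "F summable_on Sigma UNIV (\<lambda>n. {..n})" by (rule Infinite_Sum.abs_summable_summable)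
    then obtain S where S: "(F has_sum S) (Sigma UNIV (\<lambda>n. {..n}))" by (auto simp: summable_on_def)
    have "((\<lambda>n. h n * rGamma (w + of_nat n)) has_sum S) UNIV"
    proof (rule has_sum_SigmaD[OF S])
      show "((\<lambda>j. F (n, j)) has_sum h n * rGamma (w + of_nat n)) {..n}" for n
        by (intro has_sum_finiteI) (auto simp: F_def h_eq sum_distrib_right T_def intro!: sum.cong)
    qed
    hence sums_S: "(\<lambda>n. h n * rGamma (w + of_nat n)) sums S" by (rule has_sum_imp_sums)
    have S': "((\<lambda>(j, k). T j k) has_sum S) (UNIV \<times> UNIV)"
    proof -
      have "(F has_sum S) (Sigma UNIV (\<lambda>n. {..n})) = ((\<lambda>(j, k). T j k) has_sum S) (UNIV \<times> UNIV)"
        by (rule has_sum_reindex_bij_witness[of _ "\<lambda>(j, k). (j + k, j)" "\<lambda>(n, j). (j, n - j)"]) (auto simp: F_def)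
      thus ?thesis using S by simp
    qed
    have inner: "((\<lambda>k. T j k) has_sum (g j * rGamma (\<psi> + s + of_nat j)) * (Gamma (c + s) * rGamma (b + s))) UNIV" for j
    proof -
      have "(\<lambda>(j, k). T j k) summable_on (UNIV \<times> UNIV)" using S' by (rule has_sum_imp_summable)
      hence "T j summable_on UNIV" by (rule summable_on_SigmaD1) auto
      then obtain V where V: "(T j has_sum V) UNIV" by (auto simp: summable_on_def)
      define A where "A = \<tau> + of_nat j"
      \<comment> \<open>With Gauss parameters A, b - c and w + j the three Gamma arguments are c +
        s, b + s and psi + s + j. The first two are free of j, so the new factor comes out of the
        sum.\<close>
      have eqs: "w + of_nat j - A - (b - c) = c + s" "w + of_nat j - A = b + s" "w + of_nat j - (b - c) = \<psi> + s + of_nat j"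
        by (simp_all add: w_def A_def \<tau>_def)
      have "Re (c + s) > 0" using s by (auto simp: \<alpha>_def max_def min_def split: if_splits)
      hence "(\<lambda>k. pochhammer A k * pochhammer (b - c) k / fact k * rGamma (w + of_nat j + of_nat k)) sums
           (Gamma (c + s) * rGamma (b + s) * rGamma (\<psi> + s + of_nat j))"
        using gauss_sums[of "w + of_nat j" A "b - c"] unfolding eqs by (simp add: add.commute[of s c])
      from sums_mult[OF this, of "g j"] 
      have "T j sums (g j * (Gamma (c + s) * rGamma (b + s) * rGamma (\<psi> + s + of_nat j)))"
        by (simp add: T_def[abs_def] t_def A_def mult_ac add_ac)
      moreover have "T j sums V" using V by (rule has_sum_imp_sums)
      ultimately have "V = g j * (Gamma (c + s) * rGamma (b + s) * rGamma (\<psi> + s + of_nat j))"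
        by (rule sums_unique2[symmetric])
      thus ?thesis using V by (simp add: mult_ac)
    qed
    have "((\<lambda>j. (g j * rGamma (\<psi> + s + of_nat j)) * (Gamma (c + s) * rGamma (b + s))) has_sum S) UNIV"
      by (rule has_sum_SigmaD[OF S']) (use inner in auto)
    hence "(\<lambda>j. (g j * rGamma (\<psi> + s + of_nat j)) * (Gamma (c + s) * rGamma (b + s))) sums S"
      by (rule has_sum_imp_sums)
    moreover have "(\<lambda>j. (g j * rGamma (\<psi> + s + of_nat j)) * (Gamma (c + s) * rGamma (b + s))) sums (f s * (Gamma (c + s) * rGamma (b + s)))"
      using s by (intro sums_mult2 inv_fact_reprD_sums[OF R]) (auto simp: \<alpha>_def max_def min_def split: if_splits)
    ultimately have "S = f s * (Gamma (c + s) * rGamma (b + s))" by (rule sums_unique2)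
    thus "(\<lambda>n. h n * rGamma (\<tau> + b + s + of_nat n)) sums (f s * Gamma (c + s) * rGamma (b + s))"
      using sums_S by (simp add: w_def mult_ac)
  qed
qed

text \<open>At p = 1 the entries j_0 and j_(p-1) coincide and have to be 0 and n at once, so the
  index set is a singleton for n = 0 and empty otherwise. This matches the separate clause of the
  definition.\<close>

lemma norlund_g_eq_sum:
  assumes "p \<ge> 1"
  shows "norlund_g p c b n = (\<Sum>j\<in>norlund_indices p n. \<Prod>m=1..p-1.
              pochhammer ((\<Sum>i=1..m. b i - c i) + of_nat (j (m - 1))) (j m - j (m - 1))
                / fact (j m - j (m - 1))
              * pochhammer (b (m + 1) - c m) (j m - j (m - 1)))"
proof (cases "p = 1")
  case True
  have "norlund_indices 1 n = (if n = 0 then {\<lambda>i\<in>{0}. 0} else {})"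
    by (auto simp: norlund_indices_def PiE_iff extensional_def fun_eq_iff restrict_def)
  thus ?thesis using True by (simp add: norlund_g_def)
qed (simp add: norlund_g_def)

text \<open>Splitting by the last free index k leaves a convolution whose kernel is the one that
  attaches Gamma(c_p + s) / Gamma(b_(p+1) + s).\<close>

lemma norlund_g_Suc:
  assumes p: "p \<ge> 1"
  shows "norlund_g (Suc p) c b n = (\<Sum>k\<le>n. norlund_g p c b k *
     (pochhammer ((\<Sum>i=1..p. b i - c i) + of_nat k) (n - k) / fact (n - k) * pochhammer (b (Suc p) - c p) (n - k)))"
proof -
  define trm where "trm j m = pochhammer ((\<Sum>i=1..m. b i - c i) + of_nat (j (m - 1))) (j m - j (m - 1))
                / fact (j m - j (m - 1)) * pochhammer (b (m + 1) - c m) (j m - j (m - 1))" for j :: "nat \<Rightarrow> nat" and m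
  have fin: "finite (norlund_indices p k)" for p k
    unfolding norlund_indices_def by (rule finite_subset[of _ "{0..p-1} \<rightarrow>\<^sub>E {0..k}"]) (auto intro!: finite_PiE)
  have "(\<Sum>k\<le>n. norlund_g p c b k *
     (pochhammer ((\<Sum>i=1..p. b i - c i) + of_nat k) (n - k) / fact (n - k) * pochhammer (b (Suc p) - c p) (n - k))) =
     (\<Sum>k\<le>n. \<Sum>j\<in>norlund_indices p k. (\<Prod>m=1..p-1. trm j m) *
     (pochhammer ((\<Sum>i=1..p. b i - c i) + of_nat k) (n - k) / fact (n - k) * pochhammer (b (Suc p) - c p) (n - k)))"
    by (simp only: norlund_g_eq_sum[OF p] trm_def sum_distrib_right)
  also have "\<dots> = (\<Sum>(k, j)\<in>Sigma {..n} (norlund_indices p). (\<Prod>m=1..p-1. trm j m) *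
     (pochhammer ((\<Sum>i=1..p. b i - c i) + of_nat k) (n - k) / fact (n - k) * pochhammer (b (Suc p) - c p) (n - k)))"
    by (intro sum.Sigma) (auto simp: fin)
  also have "\<dots> = (\<Sum>j\<in>norlund_indices (Suc p) n. \<Prod>m=1..p. trm j m)"
  \<comment> \<open>Tuples are extensional functions, so appending n is an update at p, and its
    inverse has to restrict.\<close>
  proof (rule sum.reindex_bij_witness[of _ "\<lambda>j. (j (p - 1), restrict j {0..p-1})" "\<lambda>(k, j). j(p := n)"])
    fix kj assume "kj \<in> Sigma {..n} (norlund_indices p)"
    then obtain k j where kj: "kj = (k, j)" "k \<le> n" "j \<in> norlund_indices p k" by auto
    have j: "j \<in> {0..p-1} \<rightarrow>\<^sub>E {0..k}" "j 0 = 0" "j (p - 1) = k" "\<And>m. m \<in> {1..p-1} \<Longrightarrow> j (m - 1) \<le> j m"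
      using kj by (auto simp: norlund_indices_def)
    have ext: "j i = undefined" if "i > p - 1" for i using j(1) that by (auto simp: PiE_iff extensional_def)
    obtain q where q: "p = Suc q" using p by (cases p) auto
    have "j(p := n) \<in> {0..p} \<rightarrow>\<^sub>E {0..n}"
    proof (rule PiE_I)
      fix i assume i: "i \<in> {0..p}"
      show "(j(p := n)) i \<in> {0..n}"
      proof (cases "i = p")
        case False
        hence "j i \<in> {0..k}" using i j(1) q by (intro PiE_mem[of j "{0..p-1}"]) auto
        thus ?thesis using False kj(2) by simp
      qed simp
    qed (use ext q in auto)
    moreover have "(j(p := n)) (m - 1) \<le> (j(p := n)) m" if "m \<in> {1..p}" for m
    proof (cases "m = p")
      case True
      thus ?thesis using j(3) kj(2) p by simp
    next
      case False
      hence "m \<le> p - 1" "m - 1 \<noteq> p" using that by auto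
      thus ?thesis using j(4)[of m] that False by simp
    qed
    ultimately show "(case kj of (k, j) \<Rightarrow> j(p := n)) \<in> norlund_indices (Suc p) n"
      using p j(2) by (simp add: norlund_indices_def kj(1))
    show "((case kj of (k, j) \<Rightarrow> j(p := n)) (p - 1), restrict (case kj of (k, j) \<Rightarrow> j(p := n)) {0..p-1}) = kj"
      using j(3) ext by (auto simp: fun_eq_iff restrict_def kj(1) q)
    have "(\<Prod>m=1..p. trm (j(p := n)) m) = (\<Prod>m=1..p-1. trm (j(p := n)) m) * trm (j(p := n)) p"
      by (simp add: q)
    also have "(\<Prod>m=1..p-1. trm (j(p := n)) m) = (\<Prod>m=1..p-1. trm j m)"
      by (intro prod.cong) (auto simp: trm_def)
    also have "trm (j(p := n)) p = pochhammer ((\<Sum>i=1..p. b i - c i) + of_nat k) (n - k) / fact (n - k) * pochhammer (b (Suc p) - c p) (n - k)"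
      using j(3) by (simp add: trm_def q)
    finally show "(\<Prod>m=1..p. trm (case kj of (k, j) \<Rightarrow> j(p := n)) m) = (case kj of (k, j) \<Rightarrow> (\<Prod>m=1..p-1. trm j m) *
     (pochhammer ((\<Sum>i=1..p. b i - c i) + of_nat k) (n - k) / fact (n - k) * pochhammer (b (Suc p) - c p) (n - k)))"
      by (simp only: kj(1) prod.case)
  next
    fix j assume "j \<in> norlund_indices (Suc p) n"
    hence j: "j \<in> {0..p} \<rightarrow>\<^sub>E {0..n}" "j 0 = 0" "j p = n" "\<And>m. m \<in> {1..p} \<Longrightarrow> j (m - 1) \<le> j m"
      by (auto simp: norlund_indices_def)
    obtain q where q: "p = Suc q" using p by (cases p) auto
    have ext: "j i = undefined" if "i > p" for i using j(1) that by (auto simp: PiE_iff extensional_def)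
    have mono: "j i \<le> j (p - 1)" if "i \<le> p - 1" for i
      using that
    proof (induction rule: inc_induct)
      case (step m)
      hence "Suc m \<le> p" by linarith
      thus ?case using j(4)[of "Suc m"] step by simp
    qed auto
    show "(case (j (p - 1), restrict j {0..p-1}) of (k, j) \<Rightarrow> j(p := n)) = j"
      using j(3) ext by (auto simp: fun_eq_iff restrict_def q)
    have "j (p - 1) \<le> n" using j(3) j(4)[of p] p by auto
    moreover have "restrict j {0..p-1} \<in> norlund_indices p (j (p - 1))"
      using j(2,4) mono unfolding norlund_indices_def by (auto simp: q)
    ultimately show "(j (p - 1), restrict j {0..p-1}) \<in> Sigma {..n} (norlund_indices p)" by auto
  qed
  also have "\<dots> = norlund_g (Suc p) c b n"
    by (subst norlund_g_eq_sum) (auto simp: trm_def)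
  finally show ?thesis ..
qed

text \<open>As K lies below all Re c_m - 1, the minimum in the loss of a single factor is always the
  exponent reached so far, and the losses simply add up.\<close>

lemma norlund_repr:
  assumes "p \<ge> 1" and "\<And>m. m \<in> {1..p-1} \<Longrightarrow> K \<le> Re (c m) - 1"
  shows "inv_fact_repr (K - (\<Sum>m=1..p-1. 1 + max 0 (Re (c m - b (Suc m))))) 0 (psi (p - 1) p c b) (norlund_g p c b)
           (\<lambda>s. (\<Prod>k=1..p-1. Gamma (c k + s)) * (\<Prod>k=1..p. rGamma (b k + s)))"
  using assms
proof (induction p rule: nat_induct_at_least)
  case base
  have "norlund_g 1 c b = (\<lambda>n. if n = 0 then 1 else 0)" by (simp add: norlund_g_def fun_eq_iff)
  thus ?case using inv_fact_repr_rGamma[of K 0 "b 1"] by (simp add: psi_def)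
next
  case (Suc p)
  then obtain q where q: "p = Suc q" by (cases p) auto
  define A where "A = K - (\<Sum>m=1..p-1. 1 + max 0 (Re (c m - b (Suc m))))"
  have AK: "A \<le> K" unfolding A_def by (auto intro!: sum_nonneg)
  have IH: "inv_fact_repr A 0 (psi (p - 1) p c b) (norlund_g p c b)
           (\<lambda>s. (\<Prod>k=1..p-1. Gamma (c k + s)) * (\<Prod>k=1..p. rGamma (b k + s)))"
    unfolding A_def using Suc.prems by (intro Suc.IH) auto
  have cp: "K \<le> Re (c p) - 1" using Suc.prems[of p] Suc.hyps by auto
  have tau: "psi (p - 1) p c b - c p = (\<Sum>i=1..p. b i - c i)"
    by (simp add: psi_def q sum_subtractf)
  have psi: "psi p (Suc p) c b = psi (p - 1) p c b - c p + b (Suc p)"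
    by (simp add: psi_def q)
  have g: "norlund_g (Suc p) c b = (\<lambda>n. \<Sum>j\<le>n. norlund_g p c b j * 
     (pochhammer (psi (p - 1) p c b - c p + of_nat j) (n - j) / fact (n - j) * pochhammer (b (Suc p) - c p) (n - j)))"
    unfolding tau using norlund_g_Suc[of p c b] Suc.hyps by (intro ext) auto
  have R: "inv_fact_repr (min A (Re (c p) - 1) - 1 - max 0 (Re (c p - b (Suc p)))) 0
     (psi p (Suc p) c b) (norlund_g (Suc p) c b)
      (\<lambda>s. ((\<Prod>k=1..p-1. Gamma (c k + s)) * (\<Prod>k=1..p. rGamma (b k + s))) * Gamma (c p + s) * rGamma (b (Suc p) + s))"
    unfolding psi g by (rule inv_fact_repr_Gamma_quotient[OF IH])
  have eq: "min A (Re (c p) - 1) - 1 - max 0 (Re (c p - b (Suc p))) = K - (\<Sum>m=1..Suc p-1. 1 + max 0 (Re (c m - b (Suc m))))"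
    using AK cp by (simp add: A_def q)
  show ?case using R[unfolded eq] by (simp add: q mult_ac)
qed

section \<open>Sharp growth of the coefficients\<close>

lemma inv_fact_repr_mult_prod:
  assumes R: "inv_fact_repr \<alpha> l \<psi> g f"
  shows "\<exists>g'. inv_fact_repr (\<alpha> - real (size B)) l (\<psi> - of_nat (size B)) g' (\<lambda>s. f s * (\<Prod>\<beta>\<in>#B. s + \<beta>))"
proof (induction B)
  case empty
  thus ?case using R by auto
next
  case (add \<beta> B)
  then obtain g' where "inv_fact_repr (\<alpha> - real (size B)) l (\<psi> - of_nat (size B)) g' (\<lambda>s. f s * (\<Prod>\<beta>\<in>#B. s + \<beta>))" by blast
  from inv_fact_repr_mult_linear[OF this, of \<beta>] show ?case
    by (simp add: algebra_simps)
qed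

text \<open>The first division lowers the exponent to Re mu without a logarithm; every further one
  is the borderline case. So a pole of order m + 1 costs log^m.\<close>

lemma inv_fact_repr_divide_power:
  assumes R: "inv_fact_repr A 0 \<psi> g f" and "Re \<mu> < A"
  shows "\<exists>g'. inv_fact_repr (Re \<mu>) m (\<psi> + of_nat (Suc m)) g' (\<lambda>s. f s / (s + \<mu>) ^ Suc m)"
proof (induction m)
  case 0
  thus ?case using inv_fact_repr_divide_linear[OF R, of \<mu> "Re \<mu>" 0] assms by simp
next
  case (Suc m)
  then obtain g' where "inv_fact_repr (Re \<mu>) m (\<psi> + of_nat (Suc m)) g' (\<lambda>s. f s / (s + \<mu>) ^ Suc m)" by blast
  from inv_fact_repr_divide_linear[OF this, of \<mu> "Re \<mu>" "Suc m"]
  show ?case by (simp add: mult_ac add_ac)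
qed

lemma inv_fact_repr_divide_power':
  assumes R: "inv_fact_repr \<alpha> l \<psi> g f" and "Re \<mu> > \<alpha>"
  shows "\<exists>g'. inv_fact_repr \<alpha> l (\<psi> + of_nat m) g' (\<lambda>s. f s / (s + \<mu>) ^ m)"
proof (induction m)
  case 0
  thus ?case using R by auto
next
  case (Suc m)
  then obtain g' where "inv_fact_repr \<alpha> l (\<psi> + of_nat m) g' (\<lambda>s. f s / (s + \<mu>) ^ m)" by blast
  from inv_fact_repr_divide_linear[OF this, of \<mu> \<alpha> l]
  show ?case using assms by (simp add: mult_ac add_ac)
qed

text \<open>
  \<open>F\<close> only tolerates multiplication by \<open>D\<close> linear factors. As long as the numerator has more than \<open>D\<close> of
  them, one is removed by \<open>(s + \<beta>) / (s + \<gamma>) = 1 + (\<beta> - \<gamma>) / (s + \<gamma>)\<close>; afterwards partial fractions separate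
  the distinct roots of the denominator.
\<close>

lemma inv_fact_repr_rational:
  assumes F: "inv_fact_repr A 0 \<psi> g F" and \<alpha>: "\<alpha> < A - real D"
    and size: "size B \<le> size C + D"
    and C: "\<And>\<gamma>. \<gamma> \<in># C \<Longrightarrow> \<alpha> \<le> Re \<gamma>" "\<And>\<gamma>. \<gamma> \<in># C \<Longrightarrow> Re \<gamma> = \<alpha> \<Longrightarrow> count C \<gamma> \<le> Suc l"
  shows "\<exists>g'. inv_fact_repr \<alpha> l (\<psi> - of_nat D) g' (\<lambda>s. F s * (\<Prod>\<beta>\<in>#B. s + \<beta>) / (\<Prod>\<gamma>\<in>#C. s + \<gamma>))"
  using size C
proof (induction "size B + size C" arbitrary: B C rule: less_induct)
  case less
  note C = less.prems(2,3)
  have nz: "s + \<gamma> \<noteq> 0" if "Re s > - \<alpha>" "\<gamma> \<in># C" for s \<gamma>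
    using C(1)[OF that(2)] that(1) by (auto simp: complex_eq_iff)
  \<comment> \<open>Too many numerator factors, two distinct roots to separate, or at most one
    distinct root. In the first two cases both subproblems are smaller and still satisfy the bound
    on \<open>size B\<close>; only the last works with the coefficients of F.\<close>
  consider "size B > D" | "size B \<le> D" "\<exists>x y. x \<in># C \<and> y \<in># C \<and> x \<noteq> y" 
    | "size B \<le> D" "\<And>x y. x \<in># C \<Longrightarrow> y \<in># C \<Longrightarrow> x = y"
    by fastforce
  thus ?case
  proof cases
    case 1
    obtain \<beta> B' where B': "B = add_mset \<beta> B'" using 1 by (cases B) auto
    obtain \<gamma> C' where C': "C = add_mset \<gamma> C'" using 1 less.prems(1) by (cases C) auto
    have "\<exists>g'. inv_fact_repr \<alpha> l (\<psi> - of_nat D) g' (\<lambda>s. F s * (\<Prod>\<beta>\<in>#B'. s + \<beta>) / (\<Prod>\<gamma>\<in>#C'. s + \<gamma>))"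
    proof (rule less.hyps)
      show "count C' x \<le> Suc l" if "x \<in># C'" "Re x = \<alpha>" for x
        using C(2)[of x] that by (auto simp: C' split: if_splits)
    qed (use less.prems B' C' in auto)
    then obtain g1 where g1: "inv_fact_repr \<alpha> l (\<psi> - of_nat D) g1 (\<lambda>s. F s * (\<Prod>\<beta>\<in>#B'. s + \<beta>) / (\<Prod>\<gamma>\<in>#C'. s + \<gamma>))" by blast
    have "\<exists>g'. inv_fact_repr \<alpha> l (\<psi> - of_nat D) g' (\<lambda>s. F s * (\<Prod>\<beta>\<in>#B'. s + \<beta>) / (\<Prod>\<gamma>\<in>#C. s + \<gamma>))"
      by (rule less.hyps) (use less.prems B' in auto)
    then obtain g2 where g2: "inv_fact_repr \<alpha> l (\<psi> - of_nat D) g2 (\<lambda>s. F s * (\<Prod>\<beta>\<in>#B'. s + \<beta>) / (\<Prod>\<gamma>\<in>#C. s + \<gamma>))" by blast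
    show ?thesis
    proof (intro exI, rule inv_fact_repr_cong[OF inv_fact_repr_lincomb[OF g1 g2, of 1 "\<beta> - \<gamma>"]])
      fix s assume s: "Re s > - \<alpha>"
      have "s + \<gamma> \<noteq> 0" using nz[OF s, of \<gamma>] by (simp add: C')
      moreover have "(\<Prod>\<gamma>\<in>#C'. s + \<gamma>) \<noteq> 0" using nz[OF s] by (auto simp: C' prod_mset_zero_iff)
      ultimately show "1 * (F s * (\<Prod>\<beta>\<in>#B'. s + \<beta>) / (\<Prod>\<gamma>\<in>#C'. s + \<gamma>)) + (\<beta> - \<gamma>) * (F s * (\<Prod>\<beta>\<in>#B'. s + \<beta>) / (\<Prod>\<gamma>\<in>#C. s + \<gamma>)) = 
          F s * (\<Prod>\<beta>\<in>#B. s + \<beta>) / (\<Prod>\<gamma>\<in>#C. s + \<gamma>)"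
        by (simp add: B' C' divide_simps) (simp add: algebra_simps)
    qed
  next
    case 2
    then obtain x y where xy: "x \<in># C" "y \<in># C" "x \<noteq> y" by blast
    obtain C' where C': "C = add_mset x (add_mset y C')"
      using xy by (metis insert_noteq_member mset_add)
    have ex: "\<exists>g'. inv_fact_repr \<alpha> l (\<psi> - of_nat D) g' (\<lambda>s. F s * (\<Prod>\<beta>\<in>#B. s + \<beta>) / (\<Prod>\<gamma>\<in>#add_mset v C'. s + \<gamma>))"
      if "v = x \<or> v = y" for v
    proof (rule less.hyps)
      show "count (add_mset v C') w \<le> Suc l" if "w \<in># add_mset v C'" "Re w = \<alpha>" for w
        using C(2)[of w] that \<open>v = x \<or> v = y\<close> by (auto simp: C' split: if_splits)
    qed (use less.prems C' that 2 in auto)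
    obtain g1 where g1: "inv_fact_repr \<alpha> l (\<psi> - of_nat D) g1 (\<lambda>s. F s * (\<Prod>\<beta>\<in>#B. s + \<beta>) / (\<Prod>\<gamma>\<in>#add_mset x C'. s + \<gamma>))"
      using ex[of x] by blast
    obtain g2 where g2: "inv_fact_repr \<alpha> l (\<psi> - of_nat D) g2 (\<lambda>s. F s * (\<Prod>\<beta>\<in>#B. s + \<beta>) / (\<Prod>\<gamma>\<in>#add_mset y C'. s + \<gamma>))"
      using ex[of y] by blast
    show ?thesis
    proof (intro exI, rule inv_fact_repr_cong[OF inv_fact_repr_lincomb[OF g1 g2, of "1 / (y - x)" "- 1 / (y - x)"]])
      fix s assume s: "Re s > - \<alpha>"
      define P where "P = F s * (\<Prod>\<beta>\<in>#B. s + \<beta>)"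
      define Q where "Q = (\<Prod>\<gamma>\<in>#C'. s + \<gamma>)"
      have 0: "s + x \<noteq> 0" "s + y \<noteq> 0" using nz[OF s] xy by blast+
      moreover have "Q \<noteq> 0" using nz[OF s] by (auto simp: Q_def C' prod_mset_zero_iff)
      moreover have "y - x \<noteq> 0" using xy by simp
      moreover have "1 / (y - x) * (P / ((s + x) * Q)) + - 1 / (y - x) * (P / ((s + y) * Q)) = 
          P / Q / (y - x) * (1 / (s + x) - 1 / (s + y))"
        by (simp add: algebra_simps)
      moreover have "1 / (s + x) - 1 / (s + y) = (y - x) / ((s + x) * (s + y))"
        using 0 by (simp add: field_simps)
      ultimately have "1 / (y - x) * (P / ((s + x) * Q)) + - 1 / (y - x) * (P / ((s + y) * Q)) = P / ((s + x) * ((s + y) * Q))"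
        by simp
      thus "1 / (y - x) * (F s * (\<Prod>\<beta>\<in>#B. s + \<beta>) / (\<Prod>\<gamma>\<in>#add_mset x C'. s + \<gamma>)) + 
             - 1 / (y - x) * (F s * (\<Prod>\<beta>\<in>#B. s + \<beta>) / (\<Prod>\<gamma>\<in>#add_mset y C'. s + \<gamma>)) = 
          F s * (\<Prod>\<beta>\<in>#B. s + \<beta>) / (\<Prod>\<gamma>\<in>#C. s + \<gamma>)"
        by (simp add: C' P_def Q_def)
    qed
  next
    case 3
    define f where "f = (\<lambda>s. F s * (\<Prod>\<beta>\<in>#B. s + \<beta>))"
    define m where "m = size C"
    obtain g1 where g1: "inv_fact_repr (A - real (size B)) 0 (\<psi> - of_nat (size B)) g1 f"
      using inv_fact_repr_mult_prod[OF F, of B] unfolding f_def by blast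
    have \<alpha>': "\<alpha> < A - real (size B)" using \<alpha> 3(1) by linarith
    obtain \<mu> where \<mu>: "set_mset C \<subseteq> {\<mu>}" "m > 0 \<Longrightarrow> \<mu> \<in># C"
    proof (cases "C = {#}")
      case False
      then obtain \<mu> where "\<mu> \<in># C" by (meson multiset_nonemptyE)
      thus ?thesis using that[of \<mu>] 3(2) by blast
    qed (use that in \<open>auto simp: m_def\<close>)
    have Cm: "C = replicate_mset m \<mu>"
      unfolding m_def using \<mu>(1) by (rule set_mset_subset_singletonD)
    \<comment> \<open>A root on the line Re s = - alpha turns its multiplicity into logarithms; a
      root strictly to the left of it changes neither alpha nor l.\<close>
    have "\<exists>g2. inv_fact_repr \<alpha> l (\<psi> - of_nat (size B) + of_nat m) g2 (\<lambda>s. f s / (s + \<mu>) ^ m)"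
    proof (cases "m > 0 \<and> Re \<mu> = \<alpha>")
      case True
      then obtain m' where m': "m = Suc m'" by (cases m) auto
      obtain g2 where g2: "inv_fact_repr (Re \<mu>) m' (\<psi> - of_nat (size B) + of_nat m) g2 (\<lambda>s. f s / (s + \<mu>) ^ m)"
        using inv_fact_repr_divide_power[OF g1, of \<mu> m'] True \<alpha>' unfolding m' by auto
      have "m' \<le> l" using C(2)[of \<mu>] \<mu>(2) True by (simp add: Cm m')
      thus ?thesis using inv_fact_repr_weaken[OF g2, of \<alpha> l] True by auto
    next
      case False
      have "inv_fact_repr \<alpha> l (\<psi> - of_nat (size B)) g1 f"
        using \<alpha>' by (intro inv_fact_repr_weaken[OF g1]) auto
      show ?thesis
      proof (cases "m = 0")
        case True
        thus ?thesis using \<open>inv_fact_repr \<alpha> l (\<psi> - of_nat (size B)) g1 f\<close> by auto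
      next
        case m: False
        hence "Re \<mu> > \<alpha>" using False C(1)[of \<mu>] \<mu>(2) by auto
        thus ?thesis using inv_fact_repr_divide_power'[OF \<open>inv_fact_repr \<alpha> l (\<psi> - of_nat (size B)) g1 f\<close>] by blast
      qed
    qed
    then obtain g2 where "inv_fact_repr \<alpha> l (\<psi> - of_nat (size B) + of_nat m) g2 (\<lambda>s. f s / (s + \<mu>) ^ m)" by blast
    \<comment> \<open>Multiplication lowered psi by \<open>size B\<close> and division raised it by
      m. The shift ends at psi - D for every subproblem, as the linear combinations require.\<close>
    from inv_fact_repr_shift_iter[OF this, of "D - size B + m"]
    show ?thesis using 3(1) by (simp add: Cm f_def of_nat_diff algebra_simps)
  qed
qed

section \<open>Cancellation and poles of the shifted quotient\<close>

text \<open>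
  True without exception: at the poles both sides are \<open>0\<close> by the conventions for \<^const>\<open>Gamma\<close> and division.
\<close>

lemma Gamma_eq_shift_divide: "Gamma (z::complex) = Gamma (z + of_nat n) / pochhammer z n"
proof -
  have "rGamma z = pochhammer z n * rGamma (z + of_nat n)" by (rule pochhammer_rGamma)
  hence "inverse (rGamma z) = inverse (pochhammer z n * rGamma (z + of_nat n))" by simp
  thus ?thesis by (simp add: rGamma_inverse_Gamma divide_inverse mult_ac)
qed

text \<open>The negated zeros in s of the Pochhammer factors that a shift creates. As a multiset it
  records pole orders, and multiset difference performs the cancellation.\<close>

definition shift_mset :: "nat set \<Rightarrow> (nat \<Rightarrow> complex) \<Rightarrow> (nat \<Rightarrow> nat) \<Rightarrow> complex multiset" where
  "shift_mset K c L = (\<Sum>k\<in>K. image_mset (\<lambda>i. c k + of_nat i) (mset_set {..<L k}))"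

lemma size_shift_mset: "finite K \<Longrightarrow> size (shift_mset K c L) = (\<Sum>k\<in>K. L k)"
  unfolding shift_mset_def by (induction K rule: finite_induct) auto

lemma in_shift_mset:
  "finite K \<Longrightarrow> \<gamma> \<in># shift_mset K c L \<longleftrightarrow> (\<exists>k\<in>K. \<exists>i<L k. \<gamma> = c k + of_nat i)"
  by (auto simp: shift_mset_def set_mset_sum image_iff)

lemma prod_shift_mset:
  "finite K \<Longrightarrow> (\<Prod>\<gamma>\<in>#shift_mset K c L. s + \<gamma>) = (\<Prod>k\<in>K. pochhammer (c k + s) (L k))"
proof (induction K rule: finite_induct)
  case (insert k K)
  have "(\<Prod>\<gamma>\<in>#image_mset (\<lambda>i. c k + of_nat i) (mset_set {..<L k}). s + \<gamma>) = pochhammer (c k + s) (L k)"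
    by (simp add: pochhammer_prod image_mset.compositionality o_def atLeast0LessThan prod_unfold_prod_mset[symmetric] add_ac)
  thus ?case using insert by (simp add: shift_mset_def)
qed (simp add: shift_mset_def)

lemma Gamma_vec_quotient_eq:
  "Gamma_vec q c s / Gamma_vec p b s = (\<Prod>k=1..q. Gamma (c k + s)) * (\<Prod>k=1..p. rGamma (b k + s))"
  by (simp add: Gamma_vec_def rGamma_inverse_Gamma divide_inverse prod_inversef[symmetric] o_def)

lemma Gamma_quotient_eq_shift:
  "Gamma_vec q c s / Gamma_vec p b s =
    (\<Prod>k=1..q. Gamma (c k + of_nat (L k) + s)) * (\<Prod>k=1..p. rGamma (b k + of_nat (M k) + s)) * (\<Prod>\<beta>\<in>#shift_mset {1..p} b M. s + \<beta>) / (\<Prod>\<gamma>\<in>#shift_mset {1..q} c L. s + \<gamma>)"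
proof -
  have "(\<Prod>k=1..q. Gamma (c k + s)) = (\<Prod>k=1..q. Gamma (c k + of_nat (L k) + s)) / (\<Prod>k=1..q. pochhammer (c k + s) (L k))"
    unfolding prod_dividef[symmetric] by (intro prod.cong refl) (metis Gamma_eq_shift_divide add.assoc add.commute)
  moreover have "(\<Prod>k=1..p. rGamma (b k + s)) = (\<Prod>k=1..p. rGamma (b k + of_nat (M k) + s)) * (\<Prod>k=1..p. pochhammer (b k + s) (M k))"
    unfolding prod.distrib[symmetric] by (intro prod.cong refl) (metis pochhammer_rGamma mult.commute add.assoc add.commute)
  ultimately show ?thesis unfolding Gamma_vec_quotient_eq by (simp add: prod_shift_mset)
qed

text \<open>Both sides lose the common part of B and C. If that part vanished at s, the left side
  would be 0/0 = 0 and the equation could fail.\<close>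

lemma prod_mset_cancel:
  fixes B C :: "complex multiset"
  assumes "\<And>\<gamma>. \<gamma> \<in># C \<Longrightarrow> s + \<gamma> \<noteq> 0"
  shows "(\<Prod>\<beta>\<in>#B. s + \<beta>) / (\<Prod>\<gamma>\<in>#C. s + \<gamma>) = (\<Prod>\<beta>\<in>#B - C. s + \<beta>) / (\<Prod>\<gamma>\<in>#C - B. s + \<gamma>)"
proof -
  have B: "B = (B \<inter># C) + (B - C)" and C: "C = (B \<inter># C) + (C - B)"
    by (auto simp: multiset_eq_iff)
  have "(\<Prod>\<gamma>\<in>#B \<inter># C. s + \<gamma>) \<noteq> 0" using assms by (auto simp: prod_mset_zero_iff)
  moreover have "(\<Prod>\<beta>\<in>#B. s + \<beta>) = (\<Prod>\<beta>\<in>#B \<inter># C. s + \<beta>) * (\<Prod>\<beta>\<in>#B - C. s + \<beta>)"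
    by (subst B) simp
  moreover have "(\<Prod>\<beta>\<in>#C. s + \<beta>) = (\<Prod>\<beta>\<in>#B \<inter># C. s + \<beta>) * (\<Prod>\<beta>\<in>#C - B. s + \<beta>)"
    by (subst C) simp
  ultimately show ?thesis by simp
qed

text \<open>A root that survives in C - B is absent from B - C, and F does not vanish there, so
  nothing lowers the order of the pole below the multiplicity.\<close>

lemma pole_of_shift_quotient:
  fixes F f :: "complex \<Rightarrow> complex" and B C :: "complex multiset"
  assumes f: "\<And>s. f s = F s * (\<Prod>\<beta>\<in>#B. s + \<beta>) / (\<Prod>\<gamma>\<in>#C. s + \<gamma>)"
    and U: "open U" "F holomorphic_on U" "- \<gamma> \<in> U" "F (- \<gamma>) \<noteq> 0"
    and \<gamma>: "\<gamma> \<in># C - B"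
  shows "is_pole f (- \<gamma>)" "zorder f (- \<gamma>) = - int (count (C - B) \<gamma>)"
proof -
  define m where "m = count (C - B) \<gamma>"
  have m: "m > 0" using \<gamma> by (simp only: m_def count_greater_zero_iff)
  define E where "E = filter_mset (\<lambda>x. x \<noteq> \<gamma>) (C - B)"
  have CE: "C - B = replicate_mset m \<gamma> + E"
    by (auto simp: E_def m_def multiset_eq_iff)
  \<comment> \<open>All other roots of C are removed, also those that cancel: there f has the
    conventional value 0 instead of its limit.\<close>
  define S where "S = U - (uminus ` set_mset C - {- \<gamma>})"
  have S: "open S" "- \<gamma> \<in> S" "S \<subseteq> U"
    using U by (auto simp: S_def intro!: open_Diff finite_imp_closed)
  define G where "G s = F s * (\<Prod>\<beta>\<in>#B - C. s + \<beta>) / (\<Prod>\<gamma>\<in>#E. s + \<gamma>)" for s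
  have hol: "(\<lambda>s. \<Prod>\<beta>\<in>#X. s + \<beta>) holomorphic_on T" for X :: "complex multiset" and T
    by (induction X) (auto intro!: holomorphic_intros)
  have Enz: "(\<Prod>\<gamma>\<in>#E. s + \<gamma>) \<noteq> 0" if "s \<in> S" for s
  proof
    assume "(\<Prod>\<gamma>\<in>#E. s + \<gamma>) = 0"
    then obtain x where x: "x \<in># E" "s + x = 0" by (auto simp: prod_mset_zero_iff)
    hence "x \<in># C" "x \<noteq> \<gamma>" by (auto simp: E_def dest: in_diffD)
    moreover have "s = - x" using x(2) by (simp add: eq_neg_iff_add_eq_0)
    ultimately show False using that by (auto simp: S_def)
  qed
  have Ghol: "G holomorphic_on S" unfolding G_def
    using U S Enz by (intro holomorphic_intros hol) (auto intro: holomorphic_on_subset)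
  have "(\<Prod>\<beta>\<in>#B - C. - \<gamma> + \<beta>) \<noteq> 0"
  proof
    assume "(\<Prod>\<beta>\<in>#B - C. - \<gamma> + \<beta>) = 0"
    hence "\<gamma> \<in># B - C" by (auto simp: prod_mset_zero_iff)
    thus False using \<gamma> by (auto simp: in_diff_count)
  qed
  hence Gnz: "G (- \<gamma>) \<noteq> 0" using U(4) Enz[OF S(2)] by (simp add: G_def)
  have fG: "f w = G w / (w - (- \<gamma>)) ^ m" if "w \<in> S" "w \<noteq> - \<gamma>" for w
  proof -
    have "f w = F w * ((\<Prod>\<beta>\<in>#B. w + \<beta>) / (\<Prod>\<gamma>\<in>#C. w + \<gamma>))" by (simp add: f)
    also have "(\<Prod>\<beta>\<in>#B. w + \<beta>) / (\<Prod>\<gamma>\<in>#C. w + \<gamma>) = (\<Prod>\<beta>\<in>#B - C. w + \<beta>) / (\<Prod>\<gamma>\<in>#C - B. w + \<gamma>)"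
    proof (rule prod_mset_cancel)
      fix x assume "x \<in># C"
      show "w + x \<noteq> 0"
      proof
        assume "w + x = 0"
        hence "w = - x" by (simp add: eq_neg_iff_add_eq_0)
        thus False using that \<open>x \<in># C\<close> by (auto simp: S_def)
      qed
    qed
    finally show ?thesis by (simp add: CE G_def add.commute mult_ac)
  qed
  have ev: "eventually (\<lambda>w. G w / (w - (- \<gamma>)) ^ m = f w) (at (- \<gamma>))"
    using eventually_at_in_open[OF S(1,2)] by eventually_elim (use fG in auto)
  show "is_pole f (- \<gamma>)"
    by (rule is_pole_transform[OF is_pole_basic[OF Ghol S(1,2) Gnz m] ev]) simp
  show "zorder f (- \<gamma>) = - int (count (C - B) \<gamma>)"
    using S Ghol Gnz fG unfolding m_def[symmetric] by (intro zorder_eqI[of S _ G]) (auto simp: power_int_minus divide_inverse)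
qed

text \<open>
  Shifting \<open>b\<^sub>1\<close> costs \<open>D\<close> numerator factors that are not balanced by the denominator. Hence \<open>b\<^sub>1\<close> is
  shifted by a \<open>D\<close> that is fixed first, and all other parameters by a much larger \<open>N\<close>.
\<close>

lemma norlund_sharp_repr:
  fixes c b :: "nat \<Rightarrow> complex" and \<alpha> :: real
  assumes p: "p \<ge> 1"
  defines "f \<equiv> (\<lambda>s. Gamma_vec (p - 1) c s / Gamma_vec p b s)"
  assumes poles: "\<And>s. is_pole f s \<Longrightarrow> Re s \<le> - \<alpha>"
      "\<And>s. is_pole f s \<Longrightarrow> Re s = - \<alpha> \<Longrightarrow> - zorder f s \<le> int (Suc l)"
  obtains f' where "inv_fact_repr \<alpha> l (psi (p - 1) p c b) (norlund_g p c b) f'"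
    "\<And>s. Re s > - \<alpha> \<Longrightarrow> (\<And>k. k \<in> {1..p-1} \<Longrightarrow> Re (c k + s) > 0) \<Longrightarrow> f' s = f s"
proof -
  \<comment> \<open>Ensures Re (b_1 + D) > alpha, so that 1/Gamma(b_1 + D + s) has no zero with Re s
    >= - alpha.\<close>
  obtain D :: nat where D: "real D > \<alpha> - Re (b 1)" using reals_Archimedean2 by blast
  \<comment> \<open>The crude loss, the cost of D extra numerator factors, and room for alpha.
    \<open>W\<close> bounds all real parts, and N > V + W then yields alpha < A - D.\<close>
  define V where "V = (\<Sum>m=1..p-1. 1 + max 0 (Re (c m - b (Suc m)))) + real D + \<bar>\<alpha>\<bar> + 2"
  define W where "W = (\<Sum>k=1..p. \<bar>Re (c k)\<bar> + \<bar>Re (b k)\<bar>)"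
  have Wk: "\<bar>Re (c k)\<bar> \<le> W" "\<bar>Re (b k)\<bar> \<le> W" if "k \<in> {1..p}" for k
    using member_le_sum[OF that, of "\<lambda>k. \<bar>Re (c k)\<bar> + \<bar>Re (b k)\<bar>"] by (auto simp: W_def)
  have Wc: "\<bar>Re (c k)\<bar> \<le> W" if "k \<in> {1..p-1}" for k
    using that by (intro Wk(1)) auto
  have V: "V \<ge> \<bar>\<alpha>\<bar>" unfolding V_def by (auto intro!: add_nonneg_nonneg sum_nonneg)
  obtain N :: nat where N: "real N > V + W" using reals_Archimedean2 by blast
  define M where "M k = (if k = 1 then D else N)" for k :: nat
  define c' where "c' k = c k + of_nat N" for k
  define b' where "b' k = b k + of_nat (M k)" for k
  define F where "F s = (\<Prod>k=1..p-1. Gamma (c' k + s)) * (\<Prod>k=1..p. rGamma (b' k + s))" for s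
  define B where "B = shift_mset {1..p} b M"
  define C where "C = shift_mset {1..p-1} c (\<lambda>_. N)"
  have f_eq: "f s = F s * (\<Prod>\<beta>\<in>#B. s + \<beta>) / (\<Prod>\<gamma>\<in>#C. s + \<gamma>)" for s
    unfolding f_def Gamma_quotient_eq_shift[where L = "\<lambda>_. N" and M = M] by (simp add: F_def B_def C_def c'_def b'_def)
  define A where "A = (real N - W - 1) - (\<Sum>m=1..p-1. 1 + max 0 (Re (c' m - b' (Suc m))))"
  \<comment> \<open>The loss pairs c_m with b_(m+1): the common shift N cancels in each difference,
    and b_1, shifted only by D, does not occur.\<close>
  have "A = (real N - W - 1) - (\<Sum>m=1..p-1. 1 + max 0 (Re (c m - b (Suc m))))"
    unfolding A_def c'_def b'_def M_def by (intro arg_cong2[where f = minus] sum.cong refl) auto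
  hence A: "\<alpha> < A - real D" using N unfolding V_def by linarith
  have FR: "inv_fact_repr A 0 (psi (p - 1) p c' b') (norlund_g p c' b') F"
    unfolding A_def F_def
  proof (rule norlund_repr[OF p])
    show "real N - W - 1 \<le> Re (c' m) - 1" if "m \<in> {1..p-1}" for m
      using Wc[OF that] by (auto simp: c'_def)
  qed
  have psi_eq: "psi (p - 1) p c' b' - of_nat D = psi (p - 1) p c b"
  proof -
    have "(\<Sum>k=1..p. of_nat (M k)) = of_nat D + (\<Sum>k=1..p-1. of_nat N :: complex)"
    proof -
      have "{1..p} = insert 1 {2..p}" using p by auto
      hence "(\<Sum>k=1..p. of_nat (M k)) = of_nat (M 1) + (\<Sum>k=2..p. of_nat (M k) :: complex)" by simp
      also have "(\<Sum>k=2..p. of_nat (M k)) = (\<Sum>k=2..p. of_nat N :: complex)" by (intro sum.cong) (auto simp: M_def)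
      finally show ?thesis by (simp add: M_def)
    qed
    thus ?thesis by (simp add: psi_def b'_def c'_def sum.distrib)
  qed
  have sz: "size (B - C) \<le> size (C - B) + D"
  proof -
    have "size B = size C + D"
    proof -
      have "{1..p} = insert 1 {2..p}" using p by auto
      hence "(\<Sum>k=1..p. M k) = M 1 + (\<Sum>k=2..p. M k)" by simp
      also have "(\<Sum>k=2..p. M k) = (\<Sum>k=2..p. N)" by (intro sum.cong) (auto simp: M_def)
      finally show ?thesis by (simp add: B_def C_def size_shift_mset M_def)
    qed
    moreover have "B = (B \<inter># C) + (B - C)" "C = (B \<inter># C) + (C - B)"
      by (auto simp: multiset_eq_iff)
    hence "size B = size (B \<inter># C) + size (B - C)" "size C = size (B \<inter># C) + size (C - B)"
      by (metis size_union)+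
    ultimately show ?thesis by linarith
  qed
  define U where "U = {s. \<forall>k\<in>{1..p-1}. Re (c' k + s) > 0}"
  have U: "open U"
  proof -
    have "Re (c' k + s) > 0 \<longleftrightarrow> Re s > - Re (c' k)" for k s by auto
    hence "U = (\<Inter>k\<in>{1..p-1}. {s. Re s > - Re (c' k)})" unfolding U_def by blast
    thus ?thesis by (auto intro!: open_INT open_halfspace_Re_gt)
  qed
  have notnp: "z \<notin> \<int>\<^sub>\<le>\<^sub>0" if "Re z > 0" for z :: complex
    using that by (auto elim!: nonpos_Ints_cases)
  have Fhol: "F holomorphic_on U"
    unfolding F_def by (intro holomorphic_intros) (use notnp in \<open>auto simp: U_def\<close>)
  have pole: "is_pole f (- \<gamma>)" "zorder f (- \<gamma>) = - int (count (C - B) \<gamma>)" if "\<gamma> \<in># C - B" "Re \<gamma> \<le> \<alpha>" for \<gamma>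
  proof -
    have cpos: "Re (c' k - \<gamma>) > 0" if "k \<in> {1..p-1}" for k
      using Wc[OF that] N V \<open>Re \<gamma> \<le> \<alpha>\<close> by (auto simp: c'_def)
    have bpos: "Re (b' k - \<gamma>) > 0" if "k \<in> {1..p}" for k
      using Wk[of k] that N V D \<open>Re \<gamma> \<le> \<alpha>\<close> by (auto simp: b'_def M_def)
    have "- \<gamma> \<in> U" using cpos by (auto simp: U_def)
    moreover have "F (- \<gamma>) \<noteq> 0"
      using notnp[OF cpos] notnp[OF bpos] by (auto simp: F_def Gamma_eq_zero_iff rGamma_eq_zero_iff)
    ultimately show "is_pole f (- \<gamma>)" "zorder f (- \<gamma>) = - int (count (C - B) \<gamma>)"
      using pole_of_shift_quotient[OF f_eq U Fhol _ _ that(1)] by auto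
  qed
  have "\<exists>g'. inv_fact_repr \<alpha> l (psi (p - 1) p c' b' - of_nat D) g' (\<lambda>s. F s * (\<Prod>\<beta>\<in>#B - C. s + \<beta>) / (\<Prod>\<gamma>\<in>#C - B. s + \<gamma>))"
  proof (rule inv_fact_repr_rational[OF FR A sz])
    \<comment> \<open>A surviving root with Re gamma < alpha would be a pole of f to the right of Re
      s = - alpha.\<close>
    show *: "\<alpha> \<le> Re \<gamma>" if "\<gamma> \<in># C - B" for \<gamma>
    proof (rule ccontr)
      assume "\<not> \<alpha> \<le> Re \<gamma>"
      with pole(1)[OF that] poles(1)[of "- \<gamma>"] show False by auto
    qed
    show "count (C - B) \<gamma> \<le> Suc l" if "\<gamma> \<in># C - B" "Re \<gamma> = \<alpha>" for \<gamma>
      using pole[OF that(1)] poles(2)[of "- \<gamma>"] that(2) by auto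
  qed
  then obtain g' where g': "inv_fact_repr \<alpha> l (psi (p - 1) p c b) g' (\<lambda>s. F s * (\<Prod>\<beta>\<in>#B - C. s + \<beta>) / (\<Prod>\<gamma>\<in>#C - B. s + \<gamma>))"
    unfolding psi_eq by blast
  \<comment> \<open>Where a pole of some Gamma(c_k + s) is cancelled, f has the conventional value 0
    and may differ from the reduced quotient. The comparison therefore stays where all Re (c_k + s)
    > 0.\<close>
  have eq: "F s * (\<Prod>\<beta>\<in>#B - C. s + \<beta>) / (\<Prod>\<gamma>\<in>#C - B. s + \<gamma>) = f s" if "\<And>k. k \<in> {1..p-1} \<Longrightarrow> Re (c k + s) > 0" for s
  proof -
    have "s + \<gamma> \<noteq> 0" if "\<gamma> \<in># C" for \<gamma>
    proof -
      obtain k i where "k \<in> {1..p-1}" "\<gamma> = c k + of_nat i" using \<open>\<gamma> \<in># C\<close> by (auto simp: C_def in_shift_mset)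
      thus ?thesis using \<open>\<And>k. k \<in> {1..p-1} \<Longrightarrow> Re (c k + s) > 0\<close>[of k] by (auto simp: complex_eq_iff)
    qed
    from prod_mset_cancel[of C s B, OF this] show ?thesis
      by (simp add: f_eq times_divide_eq_right[symmetric] del: times_divide_eq_right)
  qed
  \<comment> \<open>The crude representation of the Norlund coefficients suffices: agreement on some
    right half-plane identifies them with g', and the sharp bound carries over.\<close>
  have geq: "norlund_g p c b = g'"
  proof (rule inv_fact_repr_unique[OF norlund_repr g'])
    show "p \<ge> 1" by (rule p)
    show "- W - 1 \<le> Re (c m) - 1" if "m \<in> {1..p-1}" for m using Wc[OF that] by auto
    show "(\<Prod>k=1..p-1. Gamma (c k + s)) * (\<Prod>k=1..p. rGamma (b k + s)) = F s * (\<Prod>\<beta>\<in>#B - C. s + \<beta>) / (\<Prod>\<gamma>\<in>#C - B. s + \<gamma>)"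
      if "Re s > W" for s
    proof -
      have "Re (c k + s) > 0" if "k \<in> {1..p-1}" for k using Wc[OF that] \<open>Re s > W\<close> by auto
      from eq[OF this] show ?thesis by (simp add: f_def Gamma_vec_quotient_eq)
    qed
  qed
  show ?thesis by (rule that[OF g'[folded geq] eq])
qed

section \<open>Euler's integral for the Kummer function\<close>

abbreviation unit_lborel :: "real measure" where
  "unit_lborel \<equiv> restrict_space lborel {0<..<1}"

lemma unit_lborel_integrableI:
  fixes f :: "real \<Rightarrow> complex"
  assumes f: "continuous_on {0<..<1} f" and xy: "x > 0" "y > 0"
    and le: "\<And>t. 0 < t \<Longrightarrow> t < 1 \<Longrightarrow> norm (f t) \<le> K * (t powr (x - 1) * (1 - t) powr (y - 1))"
  shows "integrable unit_lborel f"
proof -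
  have "set_integrable lborel {0<..<1} (\<lambda>t. t powr (x - 1) * (1 - t) powr (y - 1))"
    by (rule set_integrable_subset[OF integrable_Beta[OF xy]]) auto
  hence "integrable unit_lborel (\<lambda>t. t powr (x - 1) * (1 - t) powr (y - 1))"
    by (simp add: integrable_restrict_space set_integrable_def)
  hence "integrable unit_lborel (\<lambda>t. K * (t powr (x - 1) * (1 - t) powr (y - 1)))"
    by (rule integrable_mult_right)
  moreover have "f \<in> borel_measurable (restrict_space borel {0<..<1})"
    using f by (rule borel_measurable_continuous_on_restrict)
  hence "f \<in> borel_measurable unit_lborel"
    by (subst measurable_cong_sets[OF sets_restrict_space_cong[OF sets_lborel] refl])
  ultimately show ?thesis
    by (rule Bochner_Integration.integrable_bound) (auto simp: space_restrict_space intro!: AE_I2 order_trans[OF le])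
qed

lemma unit_lborel_integral_eq:
  fixes f :: "real \<Rightarrow> 'a :: euclidean_space"
  assumes "integrable unit_lborel f" "(f has_integral I) {0..1}"
  shows "integral\<^sup>L unit_lborel f = I"
proof -
  have "set_integrable lborel {0<..<1} f"
    using assms(1) by (simp add: integrable_restrict_space set_integrable_def)
  hence "(LINT x : {0<..<1} | lborel. f x) = integral {0<..<1} f"
    by (rule set_borel_integral_eq_integral)
  also have "\<dots> = I"
    using assms(2) by (simp add: has_integral_Icc_iff_Ioo integral_unique)
  finally show ?thesis
    by (simp add: integral_restrict_space set_lebesgue_integral_def)
qed

lemma unit_lborel_Beta_real:
  assumes "x > 0" "y > 0"
  shows "integrable unit_lborel (\<lambda>t. t powr (x - 1) * (1 - t) powr (y - 1))"
    and "(\<integral>t. t powr (x - 1) * (1 - t) powr (y - 1) \<partial>unit_lborel) = Beta x y"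
proof -
  have "set_integrable lborel {0<..<1} (\<lambda>t. t powr (x - 1) * (1 - t) powr (y - 1))"
    by (rule set_integrable_subset[OF integrable_Beta[OF assms]]) auto
  thus *: "integrable unit_lborel (\<lambda>t. t powr (x - 1) * (1 - t) powr (y - 1))"
    by (simp add: integrable_restrict_space set_integrable_def)
  show "(\<integral>t. t powr (x - 1) * (1 - t) powr (y - 1) \<partial>unit_lborel) = Beta x y"
    using * has_integral_Beta_real[OF assms] by (rule unit_lborel_integral_eq)
qed

lemma unit_lborel_powr:
  assumes "Re a > 0"
  shows "integrable unit_lborel (\<lambda>t. complex_of_real t powr (a - 1))"
    and "(\<integral>t. complex_of_real t powr (a - 1) \<partial>unit_lborel) = 1 / a"
proof -
  show *: "integrable unit_lborel (\<lambda>t. complex_of_real t powr (a - 1))"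
    by (rule unit_lborel_integrableI[of _ "Re a" 1 1])
       (use assms in \<open>auto intro!: continuous_intros simp: norm_powr_real_powr\<close>)
  have "((\<lambda>t. complex_of_real t powr (a - 1)) has_integral
            (of_real 1 powr a / a - of_real 0 powr a / a)) {0..1}" using assms
    by (intro fundamental_theorem_of_calculus_interior)
       (auto intro!: continuous_intros derivative_eq_intros has_vector_derivative_real_field)
  hence "((\<lambda>t. complex_of_real t powr (a - 1)) has_integral (1 / a)) {0..1}" by simp
  with * show "(\<integral>t. complex_of_real t powr (a - 1) \<partial>unit_lborel) = 1 / a"
    by (rule unit_lborel_integral_eq)
qed

lemma powr_mult_power: "t > 0 \<Longrightarrow> complex_of_real t powr (a - 1) * of_real t ^ k = of_real t powr (a + of_nat k - 1)"
  using powr_add[of "complex_of_real t" "a - 1" "of_nat k"] powr_nat'[of "complex_of_real t" k]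
  by (simp add: algebra_simps)

lemma Beta_kernel_bound:
  "0 < t \<Longrightarrow> t < 1 \<Longrightarrow> norm (complex_of_real t powr (a - 1) * of_real (1 - t) powr (c - 1)) = t powr (Re a - 1) * (1 - t) powr (Re c - 1)"
  by (simp add: norm_mult norm_powr_real_powr del: of_real_diff)

text \<open>
  Expanding \<open>(1 - t)\<^sup>c\<^sup>-\<^sup>1\<close> binomially turns the Beta integral into a case of Gauss' theorem.
\<close>

lemma unit_lborel_Beta_complex:
  assumes a: "Re a > 0" and c: "Re c > 0"
  shows "integrable unit_lborel (\<lambda>t. complex_of_real t powr (a - 1) * of_real (1 - t) powr (c - 1))"
    and "(\<integral>t. complex_of_real t powr (a - 1) * of_real (1 - t) powr (c - 1) \<partial>unit_lborel) = Gamma a * Gamma c * rGamma (a + c)"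
proof -
  show "integrable unit_lborel (\<lambda>t. complex_of_real t powr (a - 1) * of_real (1 - t) powr (c - 1))"
    by (rule unit_lborel_integrableI[of _ "Re a" "Re c" 1])
       (use a c Beta_kernel_bound[of _ a c] in \<open>auto intro!: continuous_intros simp del: of_real_diff\<close>)
  define u where "u k = pochhammer (1 - c) k / fact k" for k
  define h where "h k t = u k * complex_of_real t powr (a + of_nat k - 1)" for k t
  have ak: "Re (a + of_nat k) > 0" for k using a by simp
  have ana: "a \<notin> \<int>\<^sub>\<le>\<^sub>0" using a by (auto elim!: nonpos_Ints_cases)
  have int: "integrable unit_lborel (h k)" for k
    unfolding h_def using unit_lborel_powr(1)[OF ak] by (intro integrable_mult_right)
  have inth: "integral\<^sup>L unit_lborel (h k) = u k / (a + of_nat k)" for k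
    unfolding h_def using unit_lborel_powr(2)[OF ak] by simp
  \<comment> \<open>The sign of (-t)^n turns the binomial coefficients of c - 1 into (1 - c)_n /
    n!.\<close>
  have binom: "(\<lambda>k. u k * of_real t ^ k) sums (of_real (1 - t) powr (c - 1))" if "0 < t" "t < 1" for t :: real
  proof -
    have "(\<lambda>n. ((c - 1) gchoose n) * (- of_real t) ^ n) sums (1 + (- complex_of_real t)) powr (c - 1)"
      using that by (intro gen_binomial_complex) auto
    moreover have "((c - 1) gchoose n) * (- of_real t) ^ n = u n * of_real t ^ n" for n
    proof -
      have "((c - 1) gchoose n) * (- of_real t) ^ n = u n * ((-1) ^ n * (- of_real t) ^ n)"
        by (simp add: gbinomial_pochhammer u_def)
      also have "(-1) ^ n * (- complex_of_real t) ^ n = ((-1) * (- complex_of_real t)) ^ n"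
        by (simp only: power_mult_distrib)
      also have "\<dots> = of_real t ^ n" by simp
      finally show ?thesis .
    qed
    ultimately show ?thesis by simp
  qed
  have hs: "(\<lambda>k. h k t) sums (of_real t powr (a - 1) * of_real (1 - t) powr (c - 1))" if "0 < t" "t < 1" for t
    using sums_mult[OF binom[OF that], of "of_real t powr (a - 1)"] powr_mult_power[of t a] that
    by (simp add: h_def mult_ac)
  obtain C where C: "C > 0" "\<And>k. norm (pochhammer (1 - c) k) \<le> C * fpow (Re (1 - c) - 1) k"
    using norm_pochhammer_le[of "1 - c"] by blast
  have ub: "norm (u k) \<le> C * (real k + 1) powr (- Re c)" for k
    using C(2)[of k] by (simp add: u_def norm_divide fpow_def field_simps)
  have normh: "norm (h k t) = norm (u k) * (t powr (Re a - 1) * t ^ k)" if "0 < t" "t < 1" for k t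
    using that by (simp add: h_def norm_mult norm_powr_real_powr powr_add [symmetric] algebra_simps flip: powr_realpow)
  \<comment> \<open>Termwise integration: the integrals of the norms are of size k^(- Re c) / (Re a
    + k), which is summable as Re c > 0.\<close>
  have "(\<lambda>k. integral\<^sup>L unit_lborel (h k)) sums (\<integral>t. (\<Sum>k. h k t) \<partial>unit_lborel)"
  proof (rule sums_integral[OF int])
    show "AE t in unit_lborel. summable (\<lambda>k. norm (h k t))"
    proof (rule AE_I2)
      fix t assume "t \<in> space unit_lborel"
      hence t: "0 < t" "t < 1" by (auto simp: space_restrict_space)
      have "summable (\<lambda>k. t powr (Re a - 1) * (C * t ^ k))"
        using t by (intro summable_mult summable_geometric) auto
      thus "summable (\<lambda>k. norm (h k t))"
      proof (rule summable_comparison_test'[of _ 0])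
        fix k :: nat
        have "norm (u k) \<le> C * 1"
        proof -
          have "(real k + 1) powr (- Re c) \<le> (real k + 1) powr 0"
            using c by (intro powr_mono) auto
          hence "C * (real k + 1) powr (- Re c) \<le> C * 1" using C(1) by (intro mult_left_mono) auto
          thus ?thesis using ub[of k] by simp
        qed
        hence "norm (u k) * (t powr (Re a - 1) * t ^ k) \<le> C * (t powr (Re a - 1) * t ^ k)"
          using t by (intro mult_right_mono) auto
        hence "norm (h k t) \<le> t powr (Re a - 1) * (C * t ^ k)"
          unfolding normh[OF t] by (simp only: mult_ac)
        thus "norm (norm (h k t)) \<le> t powr (Re a - 1) * (C * t ^ k)"
          by simp
      qed
    qed
    have nint: "(\<integral>t. norm (h k t) \<partial>unit_lborel) = norm (u k) / (Re a + real k)" for k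
    proof -
      have "(\<integral>t. norm (h k t) \<partial>unit_lborel) = (\<integral>t. norm (u k) * (t powr (Re a + real k - 1) * (1 - t) powr (1 - 1)) \<partial>unit_lborel)"
        by (intro Bochner_Integration.integral_cong refl)
           (auto simp: space_restrict_space normh powr_add [symmetric] algebra_simps simp flip: powr_realpow)
      also have "\<dots> = norm (u k) * Beta (Re a + real k) 1"
        using a unit_lborel_Beta_real(2)[of "Re a + real k" 1] by simp
      also have "Beta (Re a + real k) 1 = 1 / (Re a + real k)"
      proof -
        define y where "y = Re a + real k"
        have y: "y > 0" "y \<notin> \<int>\<^sub>\<le>\<^sub>0" using a by (auto simp: y_def elim!: nonpos_Ints_cases)
        have "Beta y 1 = 1 / y"
          using y by (simp add: Beta_def Gamma_plus1 Gamma_eq_zero_iff)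
        thus ?thesis by (simp add: y_def)
      qed
      finally show ?thesis by simp
    qed
    show "summable (\<lambda>k. \<integral>t. norm (h k t) \<partial>unit_lborel)"
    proof (rule summable_comparison_test')
      show "summable (\<lambda>k. C * (max 1 (1 / Re a) * (real k + 1) powr (- Re c - 1)))"
        using c by (intro summable_mult summable_powr_Suc) auto
      fix k :: nat
      have "1 / (Re a + real k) \<le> max 1 (1 / Re a) * (1 / (real k + 1))"
      proof (cases "Re a \<ge> 1")
        case True
        hence "1 / (Re a + real k) \<le> 1 * (1 / (real k + 1))" by (auto intro!: divide_left_mono)
        also have "\<dots> \<le> max 1 (1 / Re a) * (1 / (real k + 1))" by (intro mult_right_mono) auto
        finally show ?thesis .
      next
        case False
        hence "Re a * (real k + 1) \<le> Re a + real k" using a mult_right_mono[of "Re a" 1 "real k"] by (auto simp: algebra_simps)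
        hence "1 / (Re a + real k) \<le> 1 / (Re a * (real k + 1))" using a by (intro divide_left_mono) auto
        also have "\<dots> = 1 / Re a * (1 / (real k + 1))" by simp
        also have "\<dots> \<le> max 1 (1 / Re a) * (1 / (real k + 1))" by (intro mult_right_mono) auto
        finally show ?thesis .
      qed
      hence "norm (u k) * (1 / (Re a + real k)) \<le> (C * (real k + 1) powr (- Re c)) * (max 1 (1 / Re a) * (1 / (real k + 1)))"
        using a C(1) by (intro mult_mono ub) auto
      also have "\<dots> = C * (max 1 (1 / Re a) * (real k + 1) powr (- Re c - 1))"
        by (simp add: powr_diff)
      finally show "norm (\<integral>t. norm (h k t) \<partial>unit_lborel) \<le> C * (max 1 (1 / Re a) * (real k + 1) powr (- Re c - 1))"
        unfolding nint using a by simp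
    qed
  qed
  also have "(\<integral>t. (\<Sum>k. h k t) \<partial>unit_lborel) = (\<integral>t. complex_of_real t powr (a - 1) * of_real (1 - t) powr (c - 1) \<partial>unit_lborel)"
    by (intro Bochner_Integration.integral_cong refl) (use hs in \<open>auto simp: space_restrict_space sums_iff\<close>)
  finally have "(\<lambda>k. u k / (a + of_nat k)) sums (\<integral>t. complex_of_real t powr (a - 1) * of_real (1 - t) powr (c - 1) \<partial>unit_lborel)"
    unfolding inth .
  \<comment> \<open>The factor 1/Gamma(a) turns 1/(a + k) into (a)_k / Gamma(a + 1 + k), which gives
    the Gauss series with parameters 1 - c, a and a + 1.\<close>
  hence "(\<lambda>k. rGamma a * (u k / (a + of_nat k))) sums (rGamma a * (\<integral>t. complex_of_real t powr (a - 1) * of_real (1 - t) powr (c - 1) \<partial>unit_lborel))"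
    by (rule sums_mult)
  moreover have "(\<lambda>k. rGamma a * (u k / (a + of_nat k))) sums (Gamma c * rGamma (a + c))"
  proof -
    have "rGamma a * (u k / (a + of_nat k)) = pochhammer (1 - c) k * pochhammer a k / fact k * rGamma (a + 1 + of_nat k)" for k
    proof -
      have "rGamma a = pochhammer a k * ((a + of_nat k) * rGamma (a + 1 + of_nat k))"
        using pochhammer_rGamma[of a k] rGamma_plus1[of "a + of_nat k"] by (simp add: add_ac)
      moreover have "a + of_nat k \<noteq> 0" using ak[of k] by (metis order_less_irrefl zero_complex.sel(1))
      ultimately show ?thesis by (simp add: u_def)
    qed
    moreover have "(\<lambda>k. pochhammer (1 - c) k * pochhammer a k / fact k * rGamma (a + 1 + of_nat k)) sums
        (Gamma (a + 1 - (1 - c) - a) * rGamma (a + 1 - (1 - c)) * rGamma (a + 1 - a))"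
      using c by (intro gauss_sums) simp
    ultimately show ?thesis by simp
  qed
  ultimately have "rGamma a * (\<integral>t. complex_of_real t powr (a - 1) * of_real (1 - t) powr (c - 1) \<partial>unit_lborel) = Gamma c * rGamma (a + c)"
    by (rule sums_unique2)
  thus "(\<integral>t. complex_of_real t powr (a - 1) * of_real (1 - t) powr (c - 1) \<partial>unit_lborel) = Gamma a * Gamma c * rGamma (a + c)"
    using ana by (simp add: rGamma_inverse_Gamma Gamma_eq_zero_iff field_simps)
qed

text \<open>The origin of H(z): the exponent - t Re z lies between 0 and - Re z.\<close>

lemma norm_exp_le_halfplane:
  assumes "0 < t" "t < 1"
  shows "norm (exp (- z * complex_of_real t)) \<le> max 1 (exp (- Re z))"
proof (cases "Re z \<ge> 0")
  case True
  thus ?thesis using assms by simp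
next
  case False
  hence "- Re z * t \<le> - Re z * 1" using assms by (intro mult_left_mono) auto
  thus ?thesis by (simp add: max_def)
qed

text \<open>Beta integrals for a + k, weighted by (-z)^k / k!, add up to an exponential under the
  integral. The series is M(a, a + c, -z) / Gamma(a + c), written without division.\<close>

lemma Kummer_integral:
  assumes a: "Re a > 0" and c: "Re c > 0"
  shows "(\<lambda>k. pochhammer a k * rGamma (a + c + of_nat k) * ((- z) ^ k / fact k)) sums
     (rGamma a * rGamma c * (\<integral>t. exp (- z * of_real t) * (complex_of_real t powr (a - 1) * of_real (1 - t) powr (c - 1)) \<partial>unit_lborel))"
proof -
  define h where "h k t = (- z) ^ k / fact k * (complex_of_real t powr (a + of_nat k - 1) * of_real (1 - t) powr (c - 1))" for k t
  have ak: "Re (a + of_nat k) > 0" for k using a by simp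
  have ana: "a \<notin> \<int>\<^sub>\<le>\<^sub>0" "c \<notin> \<int>\<^sub>\<le>\<^sub>0" using a c by (auto elim!: nonpos_Ints_cases)
  have int: "integrable unit_lborel (h k)" for k
    unfolding h_def using unit_lborel_Beta_complex(1)[OF ak c] by (intro integrable_mult_right)
  have inth: "integral\<^sup>L unit_lborel (h k) = (- z) ^ k / fact k * (Gamma (a + of_nat k) * Gamma c * rGamma (a + c + of_nat k))" for k
    unfolding h_def using unit_lborel_Beta_complex(2)[OF ak c] by (simp add: add_ac)
  have h_eq: "h k t = (- z * of_real t) ^ k / fact k * (complex_of_real t powr (a - 1) * of_real (1 - t) powr (c - 1))" if "0 < t" for k t
    unfolding h_def powr_mult_power[OF that, of a k, symmetric] power_mult_distrib[of "- z"]
    by (simp only: mult_ac times_divide_eq_left times_divide_eq_right)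
  have hs: "(\<lambda>k. h k t) sums (exp (- z * of_real t) * (complex_of_real t powr (a - 1) * of_real (1 - t) powr (c - 1)))" if "0 < t" for t
  proof -
    have "(\<lambda>k. (- z * of_real t) ^ k / fact k) sums exp (- z * of_real t)"
      using exp_converges[of "- z * of_real t"] by (simp add: scaleR_conv_of_real divide_inverse mult_ac)
    from sums_mult2[OF this] show ?thesis unfolding h_eq[OF that] .
  qed
  have normh: "norm (h k t) = norm z ^ k / fact k * (t powr (Re a + real k - 1) * (1 - t) powr (Re c - 1))" if "0 < t" "t < 1" for k t
    using Beta_kernel_bound[OF that, of "a + of_nat k" c] unfolding h_def norm_mult by (simp add: norm_divide norm_power)
  have "(\<lambda>k. integral\<^sup>L unit_lborel (h k)) sums (\<integral>t. (\<Sum>k. h k t) \<partial>unit_lborel)"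
  proof (rule sums_integral[OF int])
    show "AE t in unit_lborel. summable (\<lambda>k. norm (h k t))"
    proof (rule AE_I2)
      fix t assume "t \<in> space unit_lborel"
      hence t: "0 < t" "t < 1" by (auto simp: space_restrict_space)
      have "summable (\<lambda>k. norm ((- z * of_real t) ^ k /\<^sub>R fact k) * norm (complex_of_real t powr (a - 1) * of_real (1 - t) powr (c - 1)))"
        by (intro summable_mult2 summable_norm_exp)
      thus "summable (\<lambda>k. norm (h k t))"
        unfolding h_eq[OF t(1)] norm_mult[symmetric] by (simp add: scaleR_conv_of_real divide_inverse mult_ac norm_mult)
    qed
    have nint: "(\<integral>t. norm (h k t) \<partial>unit_lborel) = norm z ^ k / fact k * Beta (Re a + real k) (Re c)" for k
    proof -
      have "(\<integral>t. norm (h k t) \<partial>unit_lborel) = (\<integral>t. norm z ^ k / fact k * (t powr (Re a + real k - 1) * (1 - t) powr (Re c - 1)) \<partial>unit_lborel)"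
        by (intro Bochner_Integration.integral_cong refl) (auto simp: space_restrict_space normh)
      thus ?thesis using a c unit_lborel_Beta_real(2)[of "Re a + real k" "Re c"] by simp
    qed
    show "summable (\<lambda>k. \<integral>t. norm (h k t) \<partial>unit_lborel)"
    proof (rule summable_comparison_test')
      show "summable (\<lambda>k. norm z ^ k / fact k * Beta (Re a) (Re c))"
        using summable_exp[of "norm z"] by (intro summable_mult2) (simp add: divide_inverse mult_ac)
      fix k :: nat
      have "0 \<le> Beta (Re a + real k) (Re c)"
        using a c by (auto simp: Beta_def intro!: divide_nonneg_pos mult_nonneg_nonneg Gamma_real_pos less_imp_le[OF Gamma_real_pos])
      \<comment> \<open>As t < 1, a larger first parameter lowers the integral, so a multiple of the
        exponential series is a majorant.\<close>
      moreover have "Beta (Re a + real k) (Re c) \<le> Beta (Re a) (Re c)"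
      proof -
        have "(\<integral>t. t powr (Re a + real k - 1) * (1 - t) powr (Re c - 1) \<partial>unit_lborel) \<le> (\<integral>t. t powr (Re a - 1) * (1 - t) powr (Re c - 1) \<partial>unit_lborel)"
          using a c by (intro integral_mono unit_lborel_Beta_real) (auto simp: space_restrict_space intro!: mult_right_mono powr_mono')
        thus ?thesis using a c by (simp add: unit_lborel_Beta_real)
      qed
      ultimately show "norm (\<integral>t. norm (h k t) \<partial>unit_lborel) \<le> norm z ^ k / fact k * Beta (Re a) (Re c)"
        unfolding nint by (auto simp: abs_mult intro!: divide_right_mono mult_left_mono)
    qed
  qed
  also have "(\<integral>t. (\<Sum>k. h k t) \<partial>unit_lborel) = (\<integral>t. exp (- z * of_real t) * (complex_of_real t powr (a - 1) * of_real (1 - t) powr (c - 1)) \<partial>unit_lborel)"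
    by (intro Bochner_Integration.integral_cong refl) (use hs in \<open>auto simp: space_restrict_space sums_iff\<close>)
  finally have "(\<lambda>k. rGamma a * rGamma c * integral\<^sup>L unit_lborel (h k)) sums 
     (rGamma a * rGamma c * (\<integral>t. exp (- z * of_real t) * (complex_of_real t powr (a - 1) * of_real (1 - t) powr (c - 1)) \<partial>unit_lborel))"
    by (rule sums_mult)
  moreover have "rGamma a * rGamma c * integral\<^sup>L unit_lborel (h k) = pochhammer a k * rGamma (a + c + of_nat k) * ((- z) ^ k / fact k)" for k
  proof -
    have "rGamma a * Gamma (a + of_nat k) = pochhammer a k"
      using pochhammer_Gamma[OF ana(1), of k] by (simp add: rGamma_inverse_Gamma divide_inverse mult_ac)
    moreover have "rGamma c * Gamma c = 1" using ana(2) by (simp add: rGamma_inverse_Gamma Gamma_eq_zero_iff)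
    moreover have "rGamma a * rGamma c * integral\<^sup>L unit_lborel (h k) = (rGamma a * Gamma (a + of_nat k)) * (rGamma c * Gamma c) * rGamma (a + c + of_nat k) * ((- z) ^ k / fact k)"
      unfolding inth by (simp only: mult_ac)
    ultimately show ?thesis by simp
  qed
  ultimately show ?thesis by simp
qed

text \<open>Norms inside Euler's integral leave a real Beta value, so with c_n = psi + n - a the
  quantity Gamma(Re c_n) / |Gamma(c_n)| has to be bounded. Since n changes only the real part,
  numerator and denominator have the same growth \<open>fpow (x - 1) n\<close>.\<close>

lemma Kummer_bound:
  assumes a: "Re a > 0" and \<psi>: "Re \<psi> > Re a"
  obtains K where "K > 0"
    "\<And>n z. norm (\<Sum>k. pochhammer a k * rGamma (\<psi> + of_nat n + of_nat k) * ((- z) ^ k / fact k)) * fpow (Re \<psi> - 1) n \<le> K * max 1 (exp (- Re z))"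
proof -
  define x where "x = Re \<psi> - Re a"
  have x: "x > 0" using \<psi> by (simp add: x_def)
  define c where "c n = \<psi> + of_nat n - a" for n :: nat
  have c: "Re (c n) = x + real n" for n by (simp add: c_def x_def)
  obtain C1 where C1: "C1 > 0" "\<And>n. norm (rGamma (\<psi> - a + of_nat n)) * fpow (Re (\<psi> - a) - 1) n \<le> C1"
    using norm_rGamma_le[of "\<psi> - a"] by blast
  obtain C2 where C2: "C2 > 0" "\<And>n. norm (pochhammer (complex_of_real x) n) \<le> C2 * fpow (Re (complex_of_real x) - 1) n"
    using norm_pochhammer_le[of "complex_of_real x"] by blast
  obtain C3 where C3: "C3 > 0" "\<And>n. norm (rGamma (complex_of_real (Re \<psi>) + of_nat n)) * fpow (Re (complex_of_real (Re \<psi>)) - 1) n \<le> C3"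
    using norm_rGamma_le[of "complex_of_real (Re \<psi>)"] by blast
  define K where "K = norm (rGamma a) * Gamma (Re a) * Gamma x * C1 * C2 * C3"
  have Gx: "Gamma x > 0" "Gamma (Re a) > 0" using x a by (auto intro!: Gamma_real_pos)
  have G1: "Gamma (x + real n) \<le> Gamma x * (C2 * fpow (x - 1) n)" for n
  proof -
    have "pochhammer x n = Gamma (x + real n) / Gamma x" using x by (intro pochhammer_Gamma) (auto elim!: nonpos_Ints_cases)
    moreover have "pochhammer x n \<le> C2 * fpow (x - 1) n"
      using C2(2)[of n] x by (simp add: pochhammer_of_real)
    hence "Gamma x * pochhammer x n \<le> Gamma x * (C2 * fpow (x - 1) n)"
      using Gx by (intro mult_left_mono) auto
    ultimately show ?thesis using Gx by (simp add: field_simps)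
  qed
  have G2: "rGamma (Re \<psi> + real n) * fpow (Re \<psi> - 1) n \<le> C3" for n
  proof -
    have "rGamma (complex_of_real (Re \<psi>) + of_nat n) = of_real (rGamma (Re \<psi> + real n))"
      by (metis of_real_add of_real_of_nat_eq rGamma_complex_of_real)
    hence "\<bar>rGamma (Re \<psi> + real n)\<bar> * fpow (Re \<psi> - 1) n \<le> C3" using C3(2)[of n] by simp
    thus ?thesis by (rule order_trans[rotated]) (intro mult_right_mono, auto)
  qed
  have rpos: "rGamma (Re \<psi> + real n) \<ge> 0" for n
    using a \<psi> by (auto simp: rGamma_inverse_Gamma intro!: less_imp_le[OF Gamma_real_pos])
  have main: "norm (\<Sum>k. pochhammer a k * rGamma (\<psi> + of_nat n + of_nat k) * ((- z) ^ k / fact k)) * fpow (Re \<psi> - 1) n \<le> K * max 1 (exp (- Re z))" for n z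
  proof -
    define I where "I = (\<integral>t. exp (- z * of_real t) * (complex_of_real t powr (a - 1) * of_real (1 - t) powr (c n - 1)) \<partial>unit_lborel)"
    have cn: "Re (c n) > 0" using x by (simp add: c)
    have "(\<lambda>k. pochhammer a k * rGamma (\<psi> + of_nat n + of_nat k) * ((- z) ^ k / fact k)) sums (rGamma a * rGamma (c n) * I)"
      using Kummer_integral[OF a cn, of z] by (simp add: c_def I_def)
    hence eq: "(\<Sum>k. pochhammer a k * rGamma (\<psi> + of_nat n + of_nat k) * ((- z) ^ k / fact k)) = rGamma a * rGamma (c n) * I"
      by (simp add: sums_iff)
    define H where "H = max 1 (exp (- Re z))"
    have H: "H > 0" by (simp add: H_def)
    have "norm I \<le> (\<integral>t. H * (t powr (Re a - 1) * (1 - t) powr (x + real n - 1)) \<partial>unit_lborel)"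
      unfolding I_def
    proof (rule order_trans[OF integral_norm_bound integral_mono'])
      show "integrable unit_lborel (\<lambda>t. H * (t powr (Re a - 1) * (1 - t) powr (x + real n - 1)))"
        using a x by (intro integrable_mult_right unit_lborel_Beta_real) auto
      fix t assume "t \<in> space unit_lborel"
      hence t: "0 < t" "t < 1" by (auto simp: space_restrict_space)
      show "norm (exp (- z * of_real t) * (complex_of_real t powr (a - 1) * of_real (1 - t) powr (c n - 1))) \<le> H * (t powr (Re a - 1) * (1 - t) powr (x + real n - 1))"
        unfolding norm_mult[of "exp _"] Beta_kernel_bound[OF t] c H_def
        by (intro mult_right_mono norm_exp_le_halfplane t) auto
    qed (use H in auto)
    also have "\<dots> = H * Beta (Re a) (x + real n)"
      using unit_lborel_Beta_real(2)[of "Re a" "x + real n"] a x by simp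
    also have "Beta (Re a) (x + real n) = Gamma (Re a) * Gamma (x + real n) * rGamma (Re \<psi> + real n)"
      by (simp add: Beta_altdef x_def)
    finally have I: "norm I \<le> H * (Gamma (Re a) * Gamma (x + real n) * rGamma (Re \<psi> + real n))" .
    have "norm (rGamma a * rGamma (c n) * I) * fpow (Re \<psi> - 1) n \<le>
       norm (rGamma a) * norm (rGamma (c n)) * (H * (Gamma (Re a) * (Gamma x * (C2 * fpow (x - 1) n)) * rGamma (Re \<psi> + real n))) * fpow (Re \<psi> - 1) n"
    proof -
      have "norm I \<le> H * (Gamma (Re a) * (Gamma x * (C2 * fpow (x - 1) n)) * rGamma (Re \<psi> + real n))"
        using H Gx by (intro order_trans[OF I] mult_left_mono mult_right_mono G1 rpos) auto
      thus ?thesis unfolding norm_mult by (intro mult_right_mono mult_left_mono) auto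
    qed
    also have "\<dots> = (norm (rGamma a) * Gamma (Re a) * Gamma x * C2 * H) * (norm (rGamma (c n)) * fpow (x - 1) n) * (rGamma (Re \<psi> + real n) * fpow (Re \<psi> - 1) n)"
      by (simp only: mult_ac)
    also have "\<dots> \<le> (norm (rGamma a) * Gamma (Re a) * Gamma x * C2 * H) * C1 * C3"
    proof (intro mult_mono mult_left_mono)
      show "norm (rGamma (c n)) * fpow (x - 1) n \<le> C1"
        using C1(2)[of n] by (simp add: c_def x_def algebra_simps)
    qed (use H Gx C1 C2 rpos G2 in auto)
    also have "\<dots> = K * H" by (simp add: K_def)
    finally show ?thesis unfolding eq H_def .
  qed
  have "rGamma a \<noteq> 0" using a by (auto simp: rGamma_eq_zero_iff elim!: nonpos_Ints_cases)
  hence "K > 0" unfolding K_def using Gx C1 C2 C3 by auto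
  from that[OF this main] show ?thesis .
qed

section \<open>The expansion and its remainder\<close>

lemma sums_swap_product_bound:
  fixes T :: "nat \<Rightarrow> nat \<Rightarrow> complex"
  assumes A: "summable A" and B: "summable B" and le: "\<And>n k. norm (T n k) \<le> A n * B k"
    and A0: "\<And>n. A n \<ge> 0" and B0: "\<And>n. B n \<ge> 0"
    and row: "\<And>n. T n sums u n" and col: "\<And>k. (\<lambda>n. T n k) sums v k"
  shows "summable u" "summable v" "suminf u = suminf v"
proof -
  have "(\<lambda>(n, k). A n * B k) summable_on UNIV \<times> UNIV"
  proof (rule summable_on_SigmaI)
    have "(B has_sum suminf B) UNIV" using B B0 by (intro norm_summable_imp_has_sum) auto
    thus "((\<lambda>k. case (n, k) of (n, k) \<Rightarrow> A n * B k) has_sum A n * suminf B) UNIV" for n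
      using has_sum_cmult_right[of B UNIV "suminf B" "A n"] by simp
    have "summable (\<lambda>n. A n * suminf B)" using A by (rule summable_mult2)
    thus "(\<lambda>n. A n * suminf B) summable_on UNIV"
      by (subst summable_on_UNIV_nonneg_real_iff) (auto intro!: mult_nonneg_nonneg A0 suminf_nonneg B B0)
  qed (auto intro!: mult_nonneg_nonneg A0 B0)
  hence "(\<lambda>x. norm (case x of (n, k) \<Rightarrow> T n k)) summable_on UNIV \<times> UNIV"
    by (rule Infinite_Sum.abs_summable_on_comparison_test') (use le in auto)
  hence "(\<lambda>(n, k). T n k) summable_on UNIV \<times> UNIV"
    by (rule Infinite_Sum.abs_summable_summable)
  then obtain S where S: "((\<lambda>(n, k). T n k) has_sum S) (UNIV \<times> UNIV)" by (auto simp: summable_on_def)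
  hence S': "((\<lambda>(k, n). T n k) has_sum S) (UNIV \<times> UNIV)" by (subst (asm) has_sum_swap) simp
  have "(T n has_sum u n) UNIV" for n
  proof -
    have "T n summable_on UNIV" using summable_on_SigmaD1[OF has_sum_imp_summable[OF S], of n] by simp
    then obtain w where "(T n has_sum w) UNIV" by (auto simp: summable_on_def)
    moreover from this row[of n] have "w = u n" by (blast intro: sums_unique2 has_sum_imp_sums)
    ultimately show ?thesis by simp
  qed
  hence "(u has_sum S) UNIV" using has_sum_SigmaD[OF S, of u] by simp
  moreover have "((\<lambda>n. T n k) has_sum v k) UNIV" for k
  proof -
    have "(\<lambda>n. T n k) summable_on UNIV" using summable_on_SigmaD1[OF has_sum_imp_summable[OF S'], of k] by simp
    then obtain w where "((\<lambda>n. T n k) has_sum w) UNIV" by (auto simp: summable_on_def)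
    moreover from this col[of k] have "w = v k" by (blast intro: sums_unique2 has_sum_imp_sums)
    ultimately show ?thesis by simp
  qed
  hence "(v has_sum S) UNIV" using has_sum_SigmaD[OF S', of v] by simp
  ultimately have "u sums S" "v sums S" by (auto intro: has_sum_imp_sums)
  thus "summable u" "summable v" "suminf u = suminf v" by (auto simp: sums_iff)
qed

text \<open>Separates n from k by n! k! <= (n + k)! and n + 1 <= n + k + 1 <= (n + 1)(k + 1), which
  supplies the product majorant for interchanging the sums.\<close>

lemma inverse_fpow_add_le: "1 / fpow e (n + k) \<le> (1 / fpow e n) * ((real k + 1) powr \<bar>e\<bar> / fact k)"
proof -
  have "fact n * fact k \<le> (fact (n + k) :: nat)"
    by (rule dvd_imp_le[OF fact_fact_dvd_fact]) auto
  hence 1: "fact n * fact k \<le> (fact (n + k) :: real)" by (metis of_nat_fact of_nat_le_iff of_nat_mult)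
  have 2: "(real n + 1) powr e \<le> (real (n + k) + 1) powr e * (real k + 1) powr \<bar>e\<bar>"
  proof (cases "e \<ge> 0")
    case True
    have "(real n + 1) powr e * 1 \<le> (real (n + k) + 1) powr e * (real k + 1) powr \<bar>e\<bar>"
      using True by (intro mult_mono powr_mono2) (auto simp: ge_one_powr_ge_zero)
    thus ?thesis by simp
  next
    case False
    have "(real n + 1) powr e = ((real n + 1) * (real k + 1)) powr e * (real k + 1) powr \<bar>e\<bar>"
      using False by (simp add: powr_mult powr_minus)
    also have "\<dots> \<le> (real (n + k) + 1) powr e * (real k + 1) powr \<bar>e\<bar>"
      using False by (intro mult_right_mono powr_mono2') (auto simp: algebra_simps)
    finally show ?thesis .
  qed
  have "(fact n * fact k) * (real n + 1) powr e \<le> fact (n + k) * ((real (n + k) + 1) powr e * (real k + 1) powr \<bar>e\<bar>)"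
    by (intro mult_mono 1 2) auto
  hence "fpow e n * fact k \<le> fpow e (n + k) * (real k + 1) powr \<bar>e\<bar>"
    by (simp add: fpow_def mult_ac)
  thus ?thesis by (simp add: field_simps)
qed

lemma summable_powr_exp: "summable (\<lambda>k. (real k + 1) powr E * (y ^ k / fact k))" if "y \<ge> 0" for y :: real
proof -
  define m where "m = nat \<lceil>max 0 E\<rceil>"
  have m: "E \<le> real m" by (simp add: m_def) linarith
  show ?thesis
  proof (rule summable_comparison_test')
    show "summable (\<lambda>k. (2 ^ m * y) ^ k / fact k)"
      using summable_exp[of "2 ^ m * y"] by (simp add: divide_inverse mult_ac)
    fix k :: nat
    have "(real k + 1) powr E \<le> (real k + 1) powr real m" using m by (intro powr_mono) auto
    also have "\<dots> = (real k + 1) ^ m" by (simp add: powr_realpow)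
    \<comment> \<open>By k + 1 <= 2^k the power of k + 1 becomes a geometric factor.\<close>
    also have "\<dots> \<le> (2 ^ k) ^ m"
    proof (intro power_mono)
      have "Suc k \<le> 2 ^ k" by (induction k) auto
      thus "real k + 1 \<le> 2 ^ k" by (metis Suc_eq_plus1 of_nat_1 of_nat_add of_nat_le_iff of_nat_numeral of_nat_power)
    qed auto
    also have "\<dots> = (2 ^ m) ^ k" by (simp flip: power_mult add: mult.commute)
    finally have "(real k + 1) powr E * (y ^ k / fact k) \<le> (2 ^ m) ^ k * (y ^ k / fact k)"
      using that by (intro mult_right_mono) auto
    thus "norm ((real k + 1) powr E * (y ^ k / fact k)) \<le> (2 ^ m * y) ^ k / fact k"
      using that by (simp add: power_mult_distrib)
  qed
qed

text \<open>With y = (n + N + 1) / (N + 1) one has logp (n + N) <= logp N * (1 + ln y). So log^l N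
  leaves the sum without loss, and half of the exponent absorbs the powers of 1 + ln y.\<close>

lemma tail_sum_bound:
  fixes \<alpha> :: real
  assumes \<alpha>: "\<alpha> > 0"
  shows "\<exists>K>0. \<forall>N\<ge>1. (\<Sum>n. (real (n + N) + 1) powr (- 1 - \<alpha>) * logp (n + N) ^ l) \<le> K * (logp N ^ l / real N powr \<alpha>)"
proof -
  define \<beta> where "\<beta> = \<alpha> / 2"
  have \<beta>: "\<beta> > 0" using \<alpha> by (simp add: \<beta>_def)
  obtain K where K: "K > 0" "\<And>y. y \<ge> 1 \<Longrightarrow> (1 + ln y) ^ l \<le> K * y powr \<beta>"
    using logp_power_le[OF \<beta>, of l] by auto
  have "(\<Sum>n. (real (n + N) + 1) powr (- 1 - \<alpha>) * logp (n + N) ^ l) \<le> (K / \<beta>) * (logp N ^ l / real N powr \<alpha>)" if N: "N \<ge> 1" for N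
  proof (rule suminf_le_const)
    have "summable (\<lambda>n. (real n + 1) powr (- 1 - \<alpha>) * logp n ^ l)"
      using \<alpha> by (intro summable_powr_logp) auto
    thus "summable (\<lambda>n. (real (n + N) + 1) powr (- 1 - \<alpha>) * logp (n + N) ^ l)"
      by (rule summable_ignore_initial_segment)
    fix J
    have term_le: "(real (n + N) + 1) powr (- 1 - \<alpha>) * logp (n + N) ^ l \<le>
        K * logp N ^ l * real N powr (- \<beta>) * (real (n + N) + 1) powr (- \<beta> - 1)" for n
    proof -
      define y where "y = (real (n + N) + 1) / (real N + 1)"
      have y: "y \<ge> 1" by (simp add: y_def)
      have "logp (n + N) = 1 + ln (real N + 1) + ln y" using y by (simp add: y_def ln_div)
      also have "\<dots> \<le> logp N * (1 + ln y)" using y by (simp add: algebra_simps)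
      finally have "logp (n + N) ^ l \<le> (logp N * (1 + ln y)) ^ l" by (intro power_mono) auto
      also have "\<dots> \<le> logp N ^ l * (K * y powr \<beta>)"
        unfolding power_mult_distrib by (intro mult_left_mono K(2) y) auto
      finally have "(real (n + N) + 1) powr (- 1 - \<alpha>) * logp (n + N) ^ l \<le> (real (n + N) + 1) powr (- 1 - \<alpha>) * (logp N ^ l * (K * y powr \<beta>))"
        by (intro mult_left_mono) auto
      also have "\<dots> = K * logp N ^ l * ((real (n + N) + 1) powr (- 1 - \<alpha>) * y powr \<beta>)" by (simp only: mult_ac)
      also have "(real (n + N) + 1) powr (- 1 - \<alpha>) * y powr \<beta> = (real N + 1) powr (- \<beta>) * (real (n + N) + 1) powr (- \<beta> - 1)"
      proof -
        have "y powr \<beta> = (real (n + N) + 1) powr \<beta> * (real N + 1) powr (- \<beta>)"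
          unfolding y_def by (subst powr_divide) (auto simp: powr_minus divide_inverse)
        moreover have "(real (n + N) + 1) powr (- 1 - \<alpha>) * (real (n + N) + 1) powr \<beta> = (real (n + N) + 1) powr (- \<beta> - 1)"
          unfolding powr_add[symmetric] by (simp add: \<beta>_def)
        ultimately show ?thesis by (simp add: mult_ac)
      qed
      also have "K * logp N ^ l * ((real N + 1) powr (- \<beta>) * (real (n + N) + 1) powr (- \<beta> - 1)) \<le> K * logp N ^ l * (real N powr (- \<beta>) * (real (n + N) + 1) powr (- \<beta> - 1))"
        using K(1) \<beta> N by (intro mult_left_mono mult_right_mono powr_mono2') auto
      finally show ?thesis by (simp add: mult_ac)
    qed
    \<comment> \<open>Integral comparison in telescoping form: by the mean value theorem each term
      is below an increment of - x^(- beta) / beta.\<close>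
    have tel: "(\<Sum>n<J. (real (n + N) + 1) powr (- \<beta> - 1)) \<le> (1 / \<beta>) * (real N powr (- \<beta>) - real (J + N) powr (- \<beta>))" for J
    proof (induction J)
      case (Suc J)
      obtain \<xi> where \<xi>: "real (J + N) < \<xi>" "\<xi> < real (J + N) + 1" "(real (J + N) + 1) powr (- \<beta>) - real (J + N) powr (- \<beta>) = - \<beta> * \<xi> powr (- \<beta> - 1)"
        using powr_diff_mvt[of "real (J + N)" "- \<beta>"] N by auto
      have "(real (J + N) + 1) powr (- \<beta> - 1) \<le> \<xi> powr (- \<beta> - 1)"
        using \<xi> \<beta> N by (intro powr_mono2') auto
      also have "\<dots> = (1 / \<beta>) * (real (J + N) powr (- \<beta>) - (real (J + N) + 1) powr (- \<beta>))"
        using \<xi>(3) \<beta> by (simp add: field_simps)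
      finally show ?case using Suc by (simp add: algebra_simps)
    qed simp
    have "(\<Sum>n<J. (real (n + N) + 1) powr (- 1 - \<alpha>) * logp (n + N) ^ l) \<le> (\<Sum>n<J. K * logp N ^ l * real N powr (- \<beta>) * (real (n + N) + 1) powr (- \<beta> - 1))"
      by (intro sum_mono term_le)
    also have "\<dots> = K * logp N ^ l * real N powr (- \<beta>) * (\<Sum>n<J. (real (n + N) + 1) powr (- \<beta> - 1))"
      by (simp only: sum_distrib_left)
    also have "\<dots> \<le> K * logp N ^ l * real N powr (- \<beta>) * ((1 / \<beta>) * real N powr (- \<beta>))"
    proof (intro mult_left_mono)
      have "(\<Sum>n<J. (real (n + N) + 1) powr (- \<beta> - 1)) \<le> (1 / \<beta>) * (real N powr (- \<beta>) - real (J + N) powr (- \<beta>))" by (rule tel)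
      also have "\<dots> \<le> (1 / \<beta>) * real N powr (- \<beta>)" using \<beta> by (intro mult_left_mono) auto
      finally show "(\<Sum>n<J. (real (n + N) + 1) powr (- \<beta> - 1)) \<le> (1 / \<beta>) * real N powr (- \<beta>)" .
    qed (use K in auto)
    also have "\<dots> = (K / \<beta>) * (logp N ^ l * (real N powr (- \<beta>) * real N powr (- \<beta>)))" by simp
    also have "real N powr (- \<beta>) * real N powr (- \<beta>) = 1 / real N powr \<alpha>"
      unfolding powr_add[symmetric] by (simp add: \<beta>_def powr_minus_divide)
    finally show "(\<Sum>n<J. (real (n + N) + 1) powr (- 1 - \<alpha>) * logp (n + N) ^ l) \<le> (K / \<beta>) * (logp N ^ l / real N powr \<alpha>)"
      by simp
  qed
  thus ?thesis using K \<beta> by (intro exI[of _ "K / \<beta>"]) auto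
qed

section \<open>Interchange of summation and the remainder\<close>

lemma hypergeom_eq_Gamma_quotient:
  assumes p: "p \<ge> 1" and a: "\<And>k. k \<in> {1..p} \<Longrightarrow> Re (a k) > 0" and b: "\<And>j. j \<in> {1..p} \<Longrightarrow> - b j \<notin> \<nat>"
    and v: "summable (\<lambda>k. pochhammer (a p) k * (Gamma_vec (p - 1) a (of_nat k) / Gamma_vec p b (of_nat k)) * (w ^ k / fact k))"
  shows "hypergeom p p a b w = Gamma_vec p b 0 / Gamma_vec (p - 1) a 0 *
     (\<Sum>k. pochhammer (a p) k * (Gamma_vec (p - 1) a (of_nat k) / Gamma_vec p b (of_nat k)) * (w ^ k / fact k))"
proof -
  have b': "b j \<notin> \<int>\<^sub>\<le>\<^sub>0" if "j \<in> {1..p}" for j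
  proof
    assume "b j \<in> \<int>\<^sub>\<le>\<^sub>0"
    then obtain n where "b j = - of_nat n" by (elim nonpos_Ints_cases')
    thus False using b[OF that] by simp
  qed
  have a': "a k \<notin> \<int>\<^sub>\<le>\<^sub>0" if "k \<in> {1..p}" for k
    using a[OF that] by (auto elim!: nonpos_Ints_cases)
  have Pa: "(\<Prod>i=1..p. pochhammer (a i) k) = Gamma_vec (p - 1) a (of_nat k) / Gamma_vec (p - 1) a 0 * pochhammer (a p) k" for k
  proof -
    obtain q where q: "p = Suc q" using p by (cases p) auto
    have "(\<Prod>i=1..p. pochhammer (a i) k) = (\<Prod>i=1..q. pochhammer (a i) k) * pochhammer (a p) k" by (simp add: q)
    also have "(\<Prod>i=1..q. pochhammer (a i) k) = (\<Prod>i=1..q. Gamma (a i + of_nat k) / Gamma (a i))"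
      by (intro prod.cong refl pochhammer_Gamma a') (auto simp: q)
    finally show ?thesis by (simp add: q Gamma_vec_def prod_dividef)
  qed
  have Pb: "(\<Prod>i=1..p. pochhammer (b i) k) = Gamma_vec p b (of_nat k) / Gamma_vec p b 0" for k
  proof -
    have "(\<Prod>i=1..p. pochhammer (b i) k) = (\<Prod>i=1..p. Gamma (b i + of_nat k) / Gamma (b i))"
      by (intro prod.cong refl pochhammer_Gamma b')
    thus ?thesis by (simp add: Gamma_vec_def prod_dividef)
  qed
  have "hypergeom p p a b w = (\<Sum>k. Gamma_vec p b 0 / Gamma_vec (p - 1) a 0 *
     (pochhammer (a p) k * (Gamma_vec (p - 1) a (of_nat k) / Gamma_vec p b (of_nat k)) * (w ^ k / fact k)))"
    unfolding hypergeom_def Pa Pb by (intro arg_cong[where f = suminf] ext) (simp add: divide_simps)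
  thus ?thesis by (simp only: suminf_mult[OF v])
qed

lemma Kummer_M_div_Gamma:
  assumes a: "Re a > 0" and \<psi>: "Re \<psi> > Re a"
  shows "(\<lambda>k. pochhammer a k * rGamma (\<psi> + of_nat k) * ((- z) ^ k / fact k)) sums (Kummer_M a \<psi> (- z) / Gamma \<psi>)"
proof -
  have np: "\<psi> \<notin> \<int>\<^sub>\<le>\<^sub>0" using a \<psi> by (auto elim!: nonpos_Ints_cases)
  have s: "summable (\<lambda>k. pochhammer a k * rGamma (\<psi> + of_nat k) * ((- z) ^ k / fact k))"
    using Kummer_integral[of a "\<psi> - a" z] a \<psi> by (auto simp: sums_iff)
  have "Kummer_M a \<psi> (- z) = (\<Sum>k. Gamma \<psi> * (pochhammer a k * rGamma (\<psi> + of_nat k) * ((- z) ^ k / fact k)))"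
    unfolding Kummer_M_def hypergeom_def
    by (intro arg_cong[where f = suminf] ext)
       (simp add: pochhammer_Gamma[OF np] rGamma_inverse_Gamma divide_inverse)
  also have "\<dots> = Gamma \<psi> * (\<Sum>k. pochhammer a k * rGamma (\<psi> + of_nat k) * ((- z) ^ k / fact k))"
    by (rule suminf_mult[OF s])
  finally show ?thesis using s np by (simp add: sums_iff Gamma_eq_zero_iff)
qed

text \<open>The expansion samples the series for f at s = k only, so f' has to agree with f just at
  the natural numbers. The remainder is the tail of a series with terms of size H(z) n^(-1 - alpha)
  log^l n.\<close>

lemma expansion_remainder_bound:
  fixes a b :: "nat \<Rightarrow> complex"
  assumes p: "p \<ge> 1" and a: "\<And>k. k \<in> {1..p} \<Longrightarrow> Re (a k) > 0" and b: "\<And>j. j \<in> {1..p} \<Longrightarrow> - b j \<notin> \<nat>"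
    and psi_pos: "Re (psi p p a b) > 0" and \<alpha>: "\<alpha> > 0"
  defines "f \<equiv> (\<lambda>s. Gamma_vec (p - 1) a s / Gamma_vec p b s)"
  assumes R: "inv_fact_repr \<alpha> l (psi (p - 1) p a b) (norlund_g p a b) f'"
    and f': "\<And>k. f' (of_nat k) = f (of_nat k)"
  shows "\<exists>K>0. \<forall>N\<ge>1. \<forall>z. norm (hypergeom p p a b (- z) - expansion_sum p a b N z) \<le>
            K * max 1 (exp (- Re z)) * (logp N ^ l / real N powr \<alpha>)"
proof -
  define \<psi> where "\<psi> = psi (p - 1) p a b"
  define g where "g = norlund_g p a b"
  define x where "x = a p"
  obtain q where q: "p = Suc q" using p by (cases p) auto
  have x: "Re x > 0" using a[of p] p by (simp add: x_def)
  have \<psi>: "Re \<psi> > Re x" using psi_pos by (simp add: \<psi>_def psi_def x_def q)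
  have \<psi>n: "Re (\<psi> + of_nat n) > Re x" for n using \<psi> by simp
  define \<kappa> where "\<kappa> n z = Kummer_M x (\<psi> + of_nat n) (- z) / Gamma (\<psi> + of_nat n)" for n z
  have \<kappa>_sums: "(\<lambda>k. pochhammer x k * rGamma (\<psi> + of_nat n + of_nat k) * ((- z) ^ k / fact k)) sums \<kappa> n z" for n z
    unfolding \<kappa>_def by (rule Kummer_M_div_Gamma[OF x \<psi>n])
  obtain K1 where K1: "K1 > 0" "\<And>n z. norm (\<kappa> n z) * fpow (Re \<psi> - 1) n \<le> K1 * max 1 (exp (- Re z))"
    using Kummer_bound[OF x \<psi>] \<kappa>_sums by (auto simp: sums_iff)
  obtain C where C: "C > 0" "\<And>n. norm (g n) \<le> C * (fpow (Re \<psi> - 2 - \<alpha>) n * logp n ^ l)"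
    using inv_fact_reprD_bound[OF R] unfolding \<psi>_def g_def by blast
  have gd: "norm (g n) / fpow (Re \<psi> - 1) n \<le> C * ((real n + 1) powr (- 1 - \<alpha>) * logp n ^ l)" for n
  proof -
    have "norm (g n) / fpow (Re \<psi> - 1) n \<le> C * (fpow (Re \<psi> - 2 - \<alpha>) n * logp n ^ l) / fpow (Re \<psi> - 1) n"
      by (intro divide_right_mono C) auto
    also have "\<dots> = C * ((fpow (Re \<psi> - 2 - \<alpha>) n / fpow (Re \<psi> - 1) n) * logp n ^ l)" by simp
    also have "fpow (Re \<psi> - 2 - \<alpha>) n / fpow (Re \<psi> - 1) n = (real n + 1) powr (- 1 - \<alpha>)"
      unfolding fpow_divide by simp
    finally show ?thesis .
  qed
  have sum_A: "summable (\<lambda>n. C * ((real n + 1) powr (- 1 - \<alpha>) * logp n ^ l))"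
    using \<alpha> by (intro summable_mult summable_powr_logp) auto
  obtain D where D: "D > 0" "\<And>n. norm (rGamma (\<psi> + of_nat n)) * fpow (Re \<psi> - 1) n \<le> D"
    using norm_rGamma_le[of \<psi>] by blast
  obtain C' where C': "C' > 0" "\<And>n. norm (pochhammer x n) \<le> C' * fpow (Re x - 1) n"
    using norm_pochhammer_le[of x] by blast
  have swap: "summable (\<lambda>n. g n * \<kappa> n z)" 
      "summable (\<lambda>k. pochhammer x k * f (of_nat k) * ((- z) ^ k / fact k))"
      "(\<Sum>n. g n * \<kappa> n z) = (\<Sum>k. pochhammer x k * f (of_nat k) * ((- z) ^ k / fact k))" for z
  proof -
    \<comment> \<open>Majorant A n * B k: A is the decay of g_n / Gamma(psi + n), and B collects
      (x)_k, the power of k + 1 from separating n and k, and |z|^k / k!.\<close>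
    define A where "A n = C * ((real n + 1) powr (- 1 - \<alpha>) * logp n ^ l)" for n
    define E where "E = Re x - 1 + \<bar>Re \<psi> - 1\<bar>"
    define B where "B k = D * C' * ((real k + 1) powr E * (norm z ^ k / fact k))" for k
    define T where "T n k = g n * (pochhammer x k * rGamma (\<psi> + of_nat n + of_nat k) * ((- z) ^ k / fact k))" for n k
    have le: "norm (T n k) \<le> A n * B k" for n k
    proof -
      have "norm (rGamma (\<psi> + of_nat n + of_nat k)) \<le> D * (1 / fpow (Re \<psi> - 1) (n + k))"
        using D(2)[of "n + k"] by (simp add: field_simps)
      also have "\<dots> \<le> D * ((1 / fpow (Re \<psi> - 1) n) * ((real k + 1) powr \<bar>Re \<psi> - 1\<bar> / fact k))"
        using D(1) by (intro mult_left_mono inverse_fpow_add_le) auto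
      finally have rG: "norm (rGamma (\<psi> + of_nat n + of_nat k)) \<le> D * ((1 / fpow (Re \<psi> - 1) n) * ((real k + 1) powr \<bar>Re \<psi> - 1\<bar> / fact k))" .
      have "norm (T n k) = norm (g n) * (norm (pochhammer x k) * norm (rGamma (\<psi> + of_nat n + of_nat k)) * (norm z ^ k / fact k))"
        by (simp add: T_def norm_mult norm_divide norm_power)
      also have "\<dots> \<le> norm (g n) * ((C' * fpow (Re x - 1) k) * (D * ((1 / fpow (Re \<psi> - 1) n) * ((real k + 1) powr \<bar>Re \<psi> - 1\<bar> / fact k))) * (norm z ^ k / fact k))"
        using C' by (intro mult_left_mono mult_right_mono mult_mono rG) auto
      also have "\<dots> = (norm (g n) / fpow (Re \<psi> - 1) n) * B k"
        by (simp add: B_def E_def fpow_def powr_add)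
      also have "\<dots> \<le> A n * B k"
        unfolding A_def using C' D by (intro mult_right_mono gd) (auto simp: B_def)
      finally show ?thesis .
    qed
    have 1: "T n sums (g n * \<kappa> n z)" for n
      unfolding T_def by (intro sums_mult \<kappa>_sums)
    have 2: "(\<lambda>n. T n k) sums (pochhammer x k * f (of_nat k) * ((- z) ^ k / fact k))" for k
    proof -
      have "(\<lambda>n. g n * rGamma (\<psi> + of_nat k + of_nat n)) sums f (of_nat k)"
        using inv_fact_reprD_sums[OF R, of "of_nat k"] \<alpha> f' by (simp add: \<psi>_def g_def)
      from sums_mult2[OF this, of "pochhammer x k * ((- z) ^ k / fact k)"] show ?thesis
        by (simp add: T_def mult_ac add_ac)
    qed
    have A0: "A n \<ge> 0" for n using C(1) by (simp add: A_def)
    have B0: "B k \<ge> 0" for k using C'(1) D(1) by (simp add: B_def)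
    have sB: "summable B" unfolding B_def by (intro summable_mult summable_powr_exp) auto
    have sA: "summable A" unfolding A_def by (rule sum_A)
    show "summable (\<lambda>n. g n * \<kappa> n z)"
      by (rule sums_swap_product_bound(1)[OF sA sB le A0 B0 1 2])
    show "summable (\<lambda>k. pochhammer x k * f (of_nat k) * ((- z) ^ k / fact k))"
      by (rule sums_swap_product_bound(2)[OF sA sB le A0 B0 1 2])
    show "(\<Sum>n. g n * \<kappa> n z) = (\<Sum>k. pochhammer x k * f (of_nat k) * ((- z) ^ k / fact k))"
      by (rule sums_swap_product_bound(3)[OF sA sB le A0 B0 1 2])
  qed
  define Q where "Q = Gamma_vec p b 0 / Gamma_vec (p - 1) a 0"
  have rem: "hypergeom p p a b (- z) - expansion_sum p a b N z = Q * (\<Sum>n. g (n + N) * \<kappa> (n + N) z)" for N z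
  proof -
    have "hypergeom p p a b (- z) = Q * (\<Sum>n. g n * \<kappa> n z)"
      unfolding Q_def swap(3) x_def f_def
      using swap(2)[of z] by (intro hypergeom_eq_Gamma_quotient p a b) (simp_all add: x_def f_def)
    moreover have "expansion_sum p a b N z = Q * (\<Sum>n<N. g n * \<kappa> n z)"
      by (simp add: expansion_sum_def Q_def g_def \<kappa>_def \<psi>_def x_def)
    moreover have "(\<Sum>n. g n * \<kappa> n z) = (\<Sum>n. g (n + N) * \<kappa> (n + N) z) + (\<Sum>n<N. g n * \<kappa> n z)"
      by (rule suminf_split_initial_segment[OF swap(1)])
    ultimately show ?thesis by (simp add: algebra_simps)
  qed
  obtain K2 where K2: "K2 > 0" "\<And>N. N \<ge> 1 \<Longrightarrow> (\<Sum>n. (real (n + N) + 1) powr (- 1 - \<alpha>) * logp (n + N) ^ l) \<le> K2 * (logp N ^ l / real N powr \<alpha>)"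
    using tail_sum_bound[OF \<alpha>, of l] by blast
  \<comment> \<open>The summand 1 makes K positive whatever Q is.\<close>
  define K where "K = (norm Q + 1) * K1 * C * K2"
  have "norm (hypergeom p p a b (- z) - expansion_sum p a b N z) \<le> K * max 1 (exp (- Re z)) * (logp N ^ l / real N powr \<alpha>)" if N: "N \<ge> 1" for N z
  proof -
    define H where "H = max 1 (exp (- Re z))"
    have H: "H > 0" by (simp add: H_def)
    have t: "norm (g n * \<kappa> n z) \<le> (K1 * H * C) * ((real n + 1) powr (- 1 - \<alpha>) * logp n ^ l)" for n
    proof -
      have "norm (g n * \<kappa> n z) = (norm (g n) / fpow (Re \<psi> - 1) n) * (norm (\<kappa> n z) * fpow (Re \<psi> - 1) n)"
        by (simp add: norm_mult less_imp_neq[OF fpow_pos, symmetric])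
      also have "\<dots> \<le> (C * ((real n + 1) powr (- 1 - \<alpha>) * logp n ^ l)) * (K1 * H)"
        unfolding H_def using C(1) by (intro mult_mono gd K1) auto
      finally show ?thesis by (simp add: mult_ac)
    qed
    have s: "summable (\<lambda>n. (real (n + N) + 1) powr (- 1 - \<alpha>) * logp (n + N) ^ l)"
      using \<alpha> by (intro summable_ignore_initial_segment[of "\<lambda>n. (real n + 1) powr (- 1 - \<alpha>) * logp n ^ l"] summable_powr_logp) auto
    have "norm (\<Sum>n. g (n + N) * \<kappa> (n + N) z) \<le> (\<Sum>n. (K1 * H * C) * ((real (n + N) + 1) powr (- 1 - \<alpha>) * logp (n + N) ^ l))"
      by (intro norm_suminf_le t summable_mult s)
    also have "\<dots> = (K1 * H * C) * (\<Sum>n. (real (n + N) + 1) powr (- 1 - \<alpha>) * logp (n + N) ^ l)"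
      by (rule suminf_mult[OF s])
    also have "\<dots> \<le> (K1 * H * C) * (K2 * (logp N ^ l / real N powr \<alpha>))"
      using K1 H C by (intro mult_left_mono K2 N) auto
    finally have "norm Q * norm (\<Sum>n. g (n + N) * \<kappa> (n + N) z) \<le> (norm Q + 1) * ((K1 * H * C) * (K2 * (logp N ^ l / real N powr \<alpha>)))"
      by (intro mult_mono) auto
    thus ?thesis unfolding rem norm_mult by (simp add: K_def H_def mult_ac)
  qed
  moreover have "K > 0" unfolding K_def using K1 C K2 by (auto intro!: mult_pos_pos add_nonneg_pos)
  ultimately show ?thesis by blast
qed

text \<open>1/Gamma is entire, so only the factors Gamma(a_k + s) create poles. With Re a_k > 0 this
  forces alpha > 0.\<close>

lemma not_is_pole_Gamma_quotient:
  assumes "\<And>k. k \<in> {1..q} \<Longrightarrow> Re (a k + s) > 0"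
  shows "\<not> is_pole (\<lambda>s. Gamma_vec q a s / Gamma_vec p b s) s"
proof -
  define U where "U = {s. \<forall>k\<in>{1..q}. Re (a k + s) > 0}"
  have "open U"
  proof -
    have "Re (a k + s) > 0 \<longleftrightarrow> Re s > - Re (a k)" for k s by auto
    hence "U = (\<Inter>k\<in>{1..q}. {s. Re s > - Re (a k)})" unfolding U_def by blast
    thus ?thesis by (auto intro!: open_INT open_halfspace_Re_gt)
  qed
  moreover have "z \<notin> \<int>\<^sub>\<le>\<^sub>0" if "Re z > 0" for z :: complex
    using that by (auto elim!: nonpos_Ints_cases)
  hence "(\<lambda>s. Gamma_vec q a s / Gamma_vec p b s) holomorphic_on U"
    unfolding Gamma_vec_quotient_eq by (intro holomorphic_intros) (auto simp: U_def)
  moreover have "s \<in> U" using assms by (auto simp: U_def)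
  ultimately show ?thesis by (intro not_is_pole_holomorphic)
qed

text \<open>At N = 1 and r > 1 the factor ln N is 0 and the bound would force a vanishing remainder;
  hence the restriction to N >= 2 or r = 1. Uniform convergence is separate from alpha and r because
  the Gamma quotient may have no poles, as for p = 1.\<close>

theorem theorem3:
  fixes p :: nat and a b :: "nat \<Rightarrow> complex"
  assumes "p \<ge> 1"
    and "\<forall>k\<in>{1..p}. Re (a k) > 0"
    and "Re (a p) = (MIN k\<in>{1..p}. Re (a k))"
    and "\<forall>j\<in>{1..p}. - b j \<notin> \<nat>"
    and "Re (psi p p a b) > 0"
  shows "(\<forall>\<alpha> r. rightmost_poles (\<lambda>s. Gamma_vec (p - 1) a s / Gamma_vec p b s) \<alpha> r \<longrightarrow>
            (\<exists>K>0. \<exists>R :: nat \<Rightarrow> complex \<Rightarrow> complex. \<forall>N\<ge>1. \<forall>z.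
               hypergeom p p a b (- z) = expansion_sum p a b N z + R N z \<and>
               (N \<ge> 2 \<or> r = 1 \<longrightarrow>
                 cmod (R N z) \<le> K * max 1 (exp (- Re z)) * (ln (real N) ^ (r - 1) / real N powr \<alpha>)))) \<and>
         (\<forall>\<Lambda> :: real. uniform_limit {z. Re z \<ge> \<Lambda>}
            (expansion_sum p a b) (\<lambda>z. hypergeom p p a b (- z)) sequentially)"
proof -
  define f where "f = (\<lambda>s. Gamma_vec (p - 1) a s / Gamma_vec p b s)"
  have a: "Re (a k) > 0" if "k \<in> {1..p}" for k using assms(2) that by blast
  have a': "Re (a k) > 0" if "k \<in> {1..p-1}" for k using that by (intro a) auto
  have b: "- b j \<notin> \<nat>" if "j \<in> {1..p}" for j using assms(4) that by blast
  \<comment> \<open>Any alpha and l compatible with the poles are allowed, since uniform convergence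
    uses a smaller exponent.\<close>
  have bound: "\<exists>K>0. \<forall>N\<ge>1. \<forall>z. norm (hypergeom p p a b (- z) - expansion_sum p a b N z) \<le>
            K * max 1 (exp (- Re z)) * (logp N ^ l / real N powr \<alpha>)"
    if \<alpha>: "\<alpha> > 0" and P1: "\<And>s. is_pole f s \<Longrightarrow> Re s \<le> - \<alpha>"
      and P2: "\<And>s. is_pole f s \<Longrightarrow> Re s = - \<alpha> \<Longrightarrow> - zorder f s \<le> int (Suc l)" for \<alpha> l
  proof -
    obtain f' where f': "inv_fact_repr \<alpha> l (psi (p - 1) p a b) (norlund_g p a b) f'"
        "\<And>s. Re s > - \<alpha> \<Longrightarrow> (\<And>k. k \<in> {1..p-1} \<Longrightarrow> Re (a k + s) > 0) \<Longrightarrow> f' s = f s"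
      using norlund_sharp_repr[OF assms(1), of a b \<alpha> l] P1 P2 unfolding f_def by blast
    show ?thesis
    proof (rule expansion_remainder_bound[OF assms(1) a b assms(5) \<alpha> f'(1)])
      show "f' (of_nat k) = Gamma_vec (p - 1) a (of_nat k) / Gamma_vec p b (of_nat k)" for k
        using f'(2)[of "of_nat k"] \<alpha> a' by (simp add: f_def add_pos_nonneg)
    qed
  qed
  show ?thesis
  proof (intro conjI allI impI)
    fix \<alpha> r assume "rightmost_poles (\<lambda>s. Gamma_vec (p - 1) a s / Gamma_vec p b s) \<alpha> r"
    hence poles: "\<And>s. is_pole f s \<Longrightarrow> Re s \<le> - \<alpha>" "\<exists>s. is_pole f s \<and> Re s = - \<alpha>"
        "\<And>s. is_pole f s \<Longrightarrow> Re s = - \<alpha> \<Longrightarrow> - zorder f s \<le> int r"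
      unfolding rightmost_poles_def f_def by blast+
    have \<alpha>: "\<alpha> > 0"
    proof (rule ccontr)
      assume "\<not> \<alpha> > 0"
      moreover obtain s where s: "is_pole f s" "Re s = - \<alpha>" using poles(2) by blast
      ultimately have "Re (a k + s) > 0" if "k \<in> {1..p-1}" for k using a'[OF that] by auto
      from not_is_pole_Gamma_quotient[of "p - 1" a s p b, OF this] s(1) show False by (simp add: f_def)
    qed
    \<comment> \<open>Truncated subtraction is harmless, as r <= Suc (r - 1).\<close>
    define l where "l = r - 1"
    obtain K where K: "K > 0" "\<And>N z. N \<ge> 1 \<Longrightarrow> norm (hypergeom p p a b (- z) - expansion_sum p a b N z) \<le>
            K * max 1 (exp (- Re z)) * (logp N ^ l / real N powr \<alpha>)"
    proof -
      have "- zorder f s \<le> int (Suc l)" if "is_pole f s" "Re s = - \<alpha>" for s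
        using poles(3)[OF that] by (simp add: l_def)
      thus ?thesis using bound[OF \<alpha> poles(1)] that by blast
    qed
    \<comment> \<open>For N >= 2 both 1 <= ln N / ln 2 and ln (N + 1) <= 2 ln N hold; for N = 1 the
      exponent l is 0.\<close>
    define M where "M = (1 / ln 2 + 2 :: real) ^ l"
    have M: "M > 0" unfolding M_def by (intro zero_less_power add_pos_pos) auto
    have lM: "logp N ^ l \<le> M * ln (real N) ^ l" if "N \<ge> 1" "N \<ge> 2 \<or> r = 1" for N
    proof (cases "N \<ge> 2")
      case True
      have "1 \<le> ln (real N) / ln 2" using True by simp
      moreover have "ln (real N + 1) \<le> ln (real N ^ 2)"
      proof -
        have "real N + 1 \<le> 2 * real N" using True by simp
        also have "\<dots> \<le> real N * real N" using True by (intro mult_right_mono) auto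
        finally show ?thesis using True by (simp add: power2_eq_square)
      qed
      hence "ln (real N + 1) \<le> 2 * ln (real N)" using True by (simp add: ln_realpow)
      ultimately have "logp N \<le> ln (real N) / ln 2 + 2 * ln (real N)" by linarith
      hence "logp N \<le> (1 / ln 2 + 2) * ln (real N)" by (simp add: distrib_right)
      hence "logp N ^ l \<le> ((1 / ln 2 + 2) * ln (real N)) ^ l" by (intro power_mono) auto
      thus ?thesis by (simp add: M_def power_mult_distrib)
    next
      case False
      thus ?thesis using that by (simp add: l_def M_def)
    qed
    show "\<exists>K>0. \<exists>R. \<forall>N\<ge>1. \<forall>z. hypergeom p p a b (- z) = expansion_sum p a b N z + R N z \<and>
               (N \<ge> 2 \<or> r = 1 \<longrightarrow>
                 cmod (R N z) \<le> K * max 1 (exp (- Re z)) * (ln (real N) ^ (r - 1) / real N powr \<alpha>))"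
    proof (intro exI[of _ "K * M"] conjI exI[of _ "\<lambda>N z. hypergeom p p a b (- z) - expansion_sum p a b N z"] allI impI)
      show "K * M > 0" using K M by simp
      fix N z assume N: "N \<ge> (1::nat)" "N \<ge> 2 \<or> r = 1"
      have "cmod (hypergeom p p a b (- z) - expansion_sum p a b N z) \<le> K * max 1 (exp (- Re z)) * (logp N ^ l / real N powr \<alpha>)"
        by (rule K(2)[OF N(1)])
      also have "\<dots> \<le> K * max 1 (exp (- Re z)) * ((M * ln (real N) ^ l) / real N powr \<alpha>)"
        using K(1) by (intro mult_left_mono divide_right_mono lM N) auto
      finally show "cmod (hypergeom p p a b (- z) - expansion_sum p a b N z) \<le> K * M * max 1 (exp (- Re z)) * (ln (real N) ^ (r - 1) / real N powr \<alpha>)"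
        by (simp add: l_def mult_ac)
    qed simp
  next
    fix \<Lambda> :: real
    \<comment> \<open>Half of the smallest Re a_k: all poles lie strictly to the left of Re s = -
      delta, so the condition on their orders is vacuous and no logarithm appears.\<close>
    define \<delta> where "\<delta> = Re (a p) / 2"
    have \<delta>: "\<delta> > 0" using a[of p] assms(1) by (simp add: \<delta>_def)
    have ge: "Re (a k) > \<delta>" if "k \<in> {1..p-1}" for k
    proof -
      have "Re (a p) \<le> Re (a k)" unfolding assms(3) using that by (intro Min_le) auto
      thus ?thesis using \<delta> by (simp add: \<delta>_def)
    qed
    have np: "Re s < - \<delta>" if "is_pole f s" for s
    proof (rule ccontr)
      assume "\<not> Re s < - \<delta>"
      hence "Re (a k + s) > 0" if "k \<in> {1..p-1}" for k using ge[OF that] by auto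
      from not_is_pole_Gamma_quotient[of "p - 1" a s p b, OF this] that show False by (simp add: f_def)
    qed
    have "\<exists>K>0. \<forall>N\<ge>1. \<forall>z. norm (hypergeom p p a b (- z) - expansion_sum p a b N z) \<le>
            K * max 1 (exp (- Re z)) * (logp N ^ 0 / real N powr \<delta>)"
    proof (rule bound[OF \<delta>])
      show "Re s \<le> - \<delta>" if "is_pole f s" for s using np[OF that] by simp
      show "- zorder f s \<le> int (Suc 0)" if "is_pole f s" "Re s = - \<delta>" for s using np[OF that(1)] that(2) by simp
    qed
    then obtain K where K: "K > 0" "\<And>N z. N \<ge> 1 \<Longrightarrow> norm (hypergeom p p a b (- z) - expansion_sum p a b N z) \<le>
            K * max 1 (exp (- Re z)) * (logp N ^ 0 / real N powr \<delta>)"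
      by blast
    define H where "H = max 1 (exp (- \<Lambda>))"
    show "uniform_limit {z. Re z \<ge> \<Lambda>} (expansion_sum p a b) (\<lambda>z. hypergeom p p a b (- z)) sequentially"
    proof (rule uniform_limitI)
      fix e :: real assume e: "e > 0"
      have "(\<lambda>N. K * H * real N powr (- \<delta>)) \<longlonglongrightarrow> K * H * 0"
        using \<delta> by (intro tendsto_mult tendsto_const tendsto_neg_powr filterlim_real_sequentially) simp
      hence "eventually (\<lambda>N. K * H * real N powr (- \<delta>) < e) sequentially"
        using e by (intro order_tendstoD(2)) auto
      thus "\<forall>\<^sub>F N in sequentially. \<forall>z\<in>{z. Re z \<ge> \<Lambda>}. dist (expansion_sum p a b N z) (hypergeom p p a b (- z)) < e"
        using eventually_ge_at_top[of 1]
      proof eventually_elim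
        case (elim N)
        show ?case
        proof
          fix z assume z: "z \<in> {z. Re z \<ge> \<Lambda>}"
          have "dist (expansion_sum p a b N z) (hypergeom p p a b (- z)) = norm (hypergeom p p a b (- z) - expansion_sum p a b N z)"
            by (simp add: dist_norm norm_minus_commute)
          also have "\<dots> \<le> K * max 1 (exp (- Re z)) * (logp N ^ 0 / real N powr \<delta>)"
            using elim by (intro K) auto
          also have "\<dots> \<le> K * H * (logp N ^ 0 / real N powr \<delta>)"
            unfolding H_def using K(1) z by (intro mult_right_mono mult_left_mono max.mono) auto
          also have "\<dots> = K * H * real N powr (- \<delta>)" by (simp add: powr_minus divide_inverse)
          finally show "dist (expansion_sum p a b N z) (hypergeom p p a b (- z)) < e" using elim by simp
        qed
      qed
    qed
  qed
qed

end
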